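(* Let $K$ be a pathwise connected poset. For every finite-dimensional Hilbert net bundle $\mathcal{E}=(E,\pi,J,K)$, the projection $\pi$ defines a continuous map $\pi:\tau E\to\tau K$, and $\tau E$ becomes a locally constant vector bundle over $\tau K$. Thus there is a functor $$\tau_*:V_{net}(K)\to V_{top}(\tau K),\qquad \mathcal{E}\mapsto\tau E,$$ providing an isomorphism $V_{net}(K)\simeq V_{lc}(\tau K)$. For every net bundle of topological spaces $\mathcal{X}=(X,p,\Phi,K)$, the topological pullback $p^*(\tau E)$ along $p:\tau X\to\tau K$ defines a functor $$p^*:V_{net}(K)\to V_{lc}(\tau X).$$
   Context: Net bundle of topological spaces over $K$: $(X,p,\Phi,K)$ with $p:X\to K$ surjective, each fibre $X_a=p^{-1}(a)$ a topological space, and homeomorphisms $\Phi_{(a',a)}:X_a\to X_{a'}$ for $a\leq a'$ in $K$ with $\Phi_{(a,a)}=\mathrm{id}$, $\Phi_{(a'',a')}\Phi_{(a',a)}=\Phi_{(a'',a)}$. A Hilbert net bundle $\mathcal{E}=(E,\pi,J,K)$ is the same with each $E_a$ a (complex) Hilbert space and each $J_{(a',a)}$ unitary. A morphism $T\in(\mathcal{E},\hat{\mathcal{E}})$ is a family of bounded linear maps $T_a:E_a\to\hat E_a$ with $T_{a'}J_{(a',a)}=\hat J_{(a',a)}T_a$ for $a\leq a'$. $V_{net}(K)$ is the category of finite-dimensional Hilbert net bundles. $K$ is pathwise connected if any two elements are joined by a finite chain of elements of $K$ in which consecutive ones are comparable. Topologies: $\tau K$ is $K$ with the Alexandroff topology,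 with base $V_a=\{o\in K:a\leq o\}$, $a\in K$. $\tau X$ is $X$ with the topology having as base the cylinders $T_{a,U}=\bigcup_{o\in V_a}\Phi_{(o,a)}(U)$, $a\in K$, $U\subseteq X_a$ open; $p:\tau X\to\tau K$ is continuous. In particular this defines $\tau E$ for a Hilbert net bundle (fibres with the norm topology). For a topological space $Y$, $V_{top}(Y)$ is the category of (complex, finite-rank) vector bundles over $Y$ with bundle morphisms. A vector bundle is locally constant if it has an atlas of local trivializations, with values in $U_i\times\mathbb{C}^d$, defining locally constant transition maps (constant on the connected components of their domains); a bundle morphism between locally constant bundles is locally constant if in the given atlases it is locally of the form $(x,v)\mapsto(x,tv)$ with $t$ a fixed linear map. $V_{lc}(Y)$ is the (not full) subcategory of $V_{top}(Y)$ of locally constant vector bundles with arrows the locally constant morphisms.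
   Formalization: The isomorphism is proved as an equivalence of V_net(K) with the full subcategory of V_lc(τK) of bundles whose atlas has unitary transition maps; for all of V_lc(τK) it fails, e.g. for a line bundle of holonomy 2 over the four-point circle. *)

theory Defs
  imports "HOL-Analysis.Analysis" "HOL-Algebra.Module"
begin

section \<open>Categories, functors, equivalences\<close>

text \<open>Composition and the arrow part of a functor take the objects involved as arguments,
  because arrows will be plain functions, which do not determine their target.\<close>

record ('o, 'm) category =
  Ob :: "'o set"
  Hom :: "'o \<Rightarrow> 'o \<Rightarrow> 'm set"
  ident :: "'o \<Rightarrow> 'm"
  comp :: "'o \<Rightarrow> 'o \<Rightarrow> 'o \<Rightarrow> 'm \<Rightarrow> 'm \<Rightarrow> 'm"

definition is_category :: "('o, 'm) category \<Rightarrow> bool" where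
  "is_category C \<longleftrightarrow>
     (\<forall>A\<in>Ob C. ident C A \<in> Hom C A A) \<and>
     (\<forall>A\<in>Ob C. \<forall>B\<in>Ob C. \<forall>D\<in>Ob C. \<forall>f\<in>Hom C A B. \<forall>g\<in>Hom C B D. comp C A B D g f \<in> Hom C A D) \<and>
     (\<forall>A\<in>Ob C. \<forall>B\<in>Ob C. \<forall>f\<in>Hom C A B.
        comp C A A B f (ident C A) = f \<and> comp C A B B (ident C B) f = f) \<and>
     (\<forall>A\<in>Ob C. \<forall>B\<in>Ob C. \<forall>D\<in>Ob C. \<forall>E\<in>Ob C.
        \<forall>f\<in>Hom C A B. \<forall>g\<in>Hom C B D. \<forall>h\<in>Hom C D E.
          comp C A B E (comp C B D E h g) f = comp C A D E h (comp C A B D g f))"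

record ('o1, 'm1, 'o2, 'm2) cat_functor =
  on_Ob :: "'o1 \<Rightarrow> 'o2"
  on_Hom :: "'o1 \<Rightarrow> 'o1 \<Rightarrow> 'm1 \<Rightarrow> 'm2"

definition is_functor ::
  "('o1, 'm1) category \<Rightarrow> ('o2, 'm2) category \<Rightarrow> ('o1, 'm1, 'o2, 'm2) cat_functor \<Rightarrow> bool" where
  "is_functor C D F \<longleftrightarrow>
     is_category C \<and> is_category D \<and>
     (\<forall>A\<in>Ob C. on_Ob F A \<in> Ob D) \<and>
     (\<forall>A\<in>Ob C. \<forall>B\<in>Ob C. \<forall>f\<in>Hom C A B. on_Hom F A B f \<in> Hom D (on_Ob F A) (on_Ob F B)) \<and>
     (\<forall>A\<in>Ob C. on_Hom F A A (ident C A) = ident D (on_Ob F A)) \<and>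
     (\<forall>A\<in>Ob C. \<forall>B\<in>Ob C. \<forall>E\<in>Ob C. \<forall>f\<in>Hom C A B. \<forall>g\<in>Hom C B E.
        on_Hom F A E (comp C A B E g f) =
        comp D (on_Ob F A) (on_Ob F B) (on_Ob F E) (on_Hom F B E g) (on_Hom F A B f))"

definition id_functor :: "('o, 'm, 'o, 'm) cat_functor" where
  "id_functor = \<lparr>on_Ob = (\<lambda>A. A), on_Hom = (\<lambda>_ _ f. f)\<rparr>"

definition comp_functor ::
  "('o2, 'm2, 'o3, 'm3) cat_functor \<Rightarrow> ('o1, 'm1, 'o2, 'm2) cat_functor \<Rightarrow> ('o1, 'm1, 'o3, 'm3) cat_functor" where
  "comp_functor G F =
     \<lparr>on_Ob = (\<lambda>A. on_Ob G (on_Ob F A)),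
      on_Hom = (\<lambda>A B f. on_Hom G (on_Ob F A) (on_Ob F B) (on_Hom F A B f))\<rparr>"

definition is_iso :: "('o, 'm) category \<Rightarrow> 'o \<Rightarrow> 'o \<Rightarrow> 'm \<Rightarrow> bool" where
  "is_iso C A B f \<longleftrightarrow>
     f \<in> Hom C A B \<and>
     (\<exists>g\<in>Hom C B A. comp C A B A g f = ident C A \<and> comp C B A B f g = ident C B)"

definition natural_iso ::
  "('o1, 'm1) category \<Rightarrow> ('o2, 'm2) category \<Rightarrow> ('o1, 'm1, 'o2, 'm2) cat_functor \<Rightarrow>
   ('o1, 'm1, 'o2, 'm2) cat_functor \<Rightarrow> ('o1 \<Rightarrow> 'm2) \<Rightarrow> bool" where
  "natural_iso C D F G \<eta> \<longleftrightarrow>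
     (\<forall>A\<in>Ob C. is_iso D (on_Ob F A) (on_Ob G A) (\<eta> A)) \<and>
     (\<forall>A\<in>Ob C. \<forall>B\<in>Ob C. \<forall>f\<in>Hom C A B.
        comp D (on_Ob F A) (on_Ob F B) (on_Ob G B) (\<eta> B) (on_Hom F A B f) =
        comp D (on_Ob F A) (on_Ob G A) (on_Ob G B) (on_Hom G A B f) (\<eta> A))"

definition is_equivalence ::
  "('o1, 'm1) category \<Rightarrow> ('o2, 'm2) category \<Rightarrow> ('o1, 'm1, 'o2, 'm2) cat_functor \<Rightarrow> bool" where
  "is_equivalence C D F \<longleftrightarrow>
     is_functor C D F \<and>
     (\<exists>G \<eta> \<epsilon>. is_functor D C G \<and>
        natural_iso C C id_functor (comp_functor G F) \<eta> \<and>
        natural_iso D D (comp_functor F G) id_functor \<epsilon>)"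


section \<open>Families of complex vector spaces\<close>

text \<open>A vector space on a carrier set is a module of HOL-Algebra over the ring below. The
  ring multiplication and unit contained in the module record play no role.\<close>

definition complex_ring :: "complex ring" where
  "complex_ring = \<lparr>carrier = UNIV, monoid.mult = (*), one = 1, zero = 0, add = (+)\<rparr>"

definition linear_map :: "(complex, 'v) module \<Rightarrow> (complex, 'w) module \<Rightarrow> ('v \<Rightarrow> 'w) \<Rightarrow> bool" where
  "linear_map M N t \<longleftrightarrow>
     t \<in> carrier M \<rightarrow> carrier N \<and>
     (\<forall>x\<in>carrier M. \<forall>y\<in>carrier M. t (x \<oplus>\<^bsub>M\<^esub> y) = t x \<oplus>\<^bsub>N\<^esub> t y) \<and>
     (\<forall>c. \<forall>x\<in>carrier M. t (c \<odot>\<^bsub>M\<^esub> x) = c \<odot>\<^bsub>N\<^esub> t x)"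

definition finite_dim :: "(complex, 'v) module \<Rightarrow> bool" where
  "finite_dim M \<longleftrightarrow>
     (\<exists>B. finite B \<and> B \<subseteq> carrier M \<and>
        (\<forall>x\<in>carrier M. \<exists>c. x = finsum M (\<lambda>b. c b \<odot>\<^bsub>M\<^esub> b) B))"

text \<open>\<open>\<complex>\<^sup>d\<close>, for a natural number \<open>d\<close>, consists of the sequences vanishing from index \<open>d\<close> on
  (the convention of \<open>Euclidean_space\<close> in the library).\<close>

definition Cn :: "nat \<Rightarrow> (nat \<Rightarrow> complex) set" where
  "Cn d = {v. \<forall>i\<ge>d. v i = 0}"

definition Cn_module :: "nat \<Rightarrow> (complex, nat \<Rightarrow> complex) module" where
  "Cn_module d =
     \<lparr>carrier = Cn d, monoid.mult = undefined, one = undefined,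
      zero = (\<lambda>_. 0), add = (\<lambda>v w i. v i + w i), smult = (\<lambda>c v i. c * v i)\<rparr>"

definition Cn_top :: "nat \<Rightarrow> (nat \<Rightarrow> complex) topology" where
  "Cn_top d = subtopology (product_topology (\<lambda>_. euclidean) UNIV) (Cn d)"

definition Cn_inner :: "nat \<Rightarrow> (nat \<Rightarrow> complex) \<Rightarrow> (nat \<Rightarrow> complex) \<Rightarrow> complex" where
  "Cn_inner d v w = (\<Sum>i<d. v i * cnj (w i))"

definition GL :: "nat \<Rightarrow> ((nat \<Rightarrow> complex) \<Rightarrow> (nat \<Rightarrow> complex)) set" where
  "GL d = {g. linear_map (Cn_module d) (Cn_module d) g \<and> bij_betw g (Cn d) (Cn d)}"

definition Unitary :: "nat \<Rightarrow> ((nat \<Rightarrow> complex) \<Rightarrow> (nat \<Rightarrow> complex)) set" where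
  "Unitary d = {g \<in> GL d. \<forall>v\<in>Cn d. \<forall>w\<in>Cn d. Cn_inner d (g v) (g w) = Cn_inner d v w}"

text \<open>A set over \<open>'b\<close> whose fibres carry vector space operations. \<open>vadd x y\<close> is relevant only
  for \<open>x\<close>, \<open>y\<close> in the same fibre.\<close>

record ('b, 'e) vfamily =
  total :: "'e set"
  prj :: "'e \<Rightarrow> 'b"
  vzero :: "'b \<Rightarrow> 'e"
  vadd :: "'e \<Rightarrow> 'e \<Rightarrow> 'e"
  vscale :: "complex \<Rightarrow> 'e \<Rightarrow> 'e"

definition fibre :: "('b, 'e, 'z) vfamily_scheme \<Rightarrow> 'b \<Rightarrow> 'e set" where
  "fibre F b = {e \<in> total F. prj F e = b}"

definition fibre_module :: "('b, 'e, 'z) vfamily_scheme \<Rightarrow> 'b \<Rightarrow> (complex, 'e) module" where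
  "fibre_module F b =
     \<lparr>carrier = fibre F b, monoid.mult = undefined, one = undefined,
      zero = vzero F b, add = vadd F, smult = vscale F\<rparr>"


section \<open>Vector bundles and locally constant vector bundles\<close>

record ('b, 'e) vbundle = "('b, 'e) vfamily" +
  vtop :: "'e topology"

definition over :: "('b, 'e, 'z) vfamily_scheme \<Rightarrow> 'b set \<Rightarrow> 'e set" where
  "over F U = {e \<in> total F. prj F e \<in> U}"

text \<open>The local trivialization is \<open>e \<mapsto> (prj F e, \<phi> e)\<close>, from the part of the bundle over \<open>U\<close>
  onto \<open>U \<times> \<complex>\<^sup>d\<close>.\<close>

definition local_trivialization ::
  "'b topology \<Rightarrow> ('b, 'e, 'z) vbundle_scheme \<Rightarrow> nat \<Rightarrow> 'b set \<Rightarrow> ('e \<Rightarrow> nat \<Rightarrow> complex) \<Rightarrow> bool" where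
  "local_trivialization Y F d U \<phi> \<longleftrightarrow>
     openin Y U \<and>
     homeomorphic_map (subtopology (vtop F) (over F U))
       (prod_topology (subtopology Y U) (Cn_top d)) (\<lambda>e. (prj F e, \<phi> e)) \<and>
     (\<forall>y\<in>U. linear_map (fibre_module F y) (Cn_module d) \<phi>)"

definition vector_bundle :: "'b topology \<Rightarrow> ('b, 'e, 'z) vbundle_scheme \<Rightarrow> bool" where
  "vector_bundle Y F \<longleftrightarrow>
     topspace (vtop F) = total F \<and>
     continuous_map (vtop F) Y (prj F) \<and>
     (\<forall>y\<in>topspace Y. module complex_ring (fibre_module F y)) \<and>
     (\<forall>y\<in>topspace Y. \<exists>U d \<phi>. y \<in> U \<and> local_trivialization Y F d U \<phi>)"

text \<open>A locally constant bundle carries a given atlas, a set of pairs \<open>(U, \<phi>)\<close>; it is not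
  required to be maximal. \<open>G d\<close> is the group in which the transition maps take values:
  \<open>GL\<close> gives locally constant vector bundles without further structure.

  The transition map of \<open>(U, \<phi>)\<close>, \<open>(V, \<psi>)\<close> sends a point of \<open>U \<inter> V\<close> to the \<open>g\<close> with \<open>\<psi> = g \<circ> \<phi>\<close> on
  its fibre. That it is locally constant means constant near each point of \<open>U \<inter> V\<close>; it is then
  constant on the connected components of \<open>U \<inter> V\<close>, and the two conditions agree over a
  locally connected space, such as a poset with the Alexandroff topology.\<close>

record ('b, 'e) lc_vbundle = "('b, 'e) vbundle" +
  atlas :: "('b set \<times> ('e \<Rightarrow> nat \<Rightarrow> complex)) set"

definition lc_vector_bundle ::
  "(nat \<Rightarrow> ((nat \<Rightarrow> complex) \<Rightarrow> (nat \<Rightarrow> complex)) set) \<Rightarrow> 'b topology \<Rightarrow> ('b, 'e) lc_vbundle \<Rightarrow> bool" where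
  "lc_vector_bundle G Y F \<longleftrightarrow>
     vector_bundle Y F \<and>
     (\<Union>(U, \<phi>)\<in>atlas F. U) = topspace Y \<and>
     (\<exists>d. (\<forall>(U, \<phi>)\<in>atlas F. local_trivialization Y F d U \<phi>) \<and>
        (\<forall>(U, \<phi>)\<in>atlas F. \<forall>(V, \<psi>)\<in>atlas F. \<forall>y\<in>U \<inter> V.
           \<exists>W. openin Y W \<and> y \<in> W \<and> W \<subseteq> U \<inter> V \<and>
             (\<exists>g\<in>G d. \<forall>e\<in>over F W. \<psi> e = g (\<phi> e))))"

text \<open>Bundle morphisms are extensional functions on the total space, so that equality of
  arrows is equality of functions.\<close>

definition fibrewise_linear ::
  "('b, 'e, 'z) vfamily_scheme \<Rightarrow> ('b, 'f, 'w) vfamily_scheme \<Rightarrow> ('e \<Rightarrow> 'f) \<Rightarrow> bool" where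
  "fibrewise_linear F F' f \<longleftrightarrow>
     f \<in> extensional (total F) \<and>
     f \<in> total F \<rightarrow> total F' \<and>
     (\<forall>b\<in>prj F ` total F. linear_map (fibre_module F b) (fibre_module F' b) f)"

definition bundle_morphism ::
  "('b, 'e, 'z) vbundle_scheme \<Rightarrow> ('b, 'f, 'w) vbundle_scheme \<Rightarrow> ('e \<Rightarrow> 'f) \<Rightarrow> bool" where
  "bundle_morphism F F' f \<longleftrightarrow> fibrewise_linear F F' f \<and> continuous_map (vtop F) (vtop F') f"

definition lc_morphism ::
  "'b topology \<Rightarrow> ('b, 'e) lc_vbundle \<Rightarrow> ('b, 'f) lc_vbundle \<Rightarrow> ('e \<Rightarrow> 'f) \<Rightarrow> bool" where
  "lc_morphism Y F F' f \<longleftrightarrow>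
     bundle_morphism F F' f \<and>
     (\<forall>(U, \<phi>)\<in>atlas F. \<forall>(V, \<psi>)\<in>atlas F'. \<forall>y\<in>U \<inter> V.
        \<exists>W d d' t. openin Y W \<and> y \<in> W \<and> W \<subseteq> U \<inter> V \<and>
          local_trivialization Y F d U \<phi> \<and> local_trivialization Y F' d' V \<psi> \<and>
          linear_map (Cn_module d) (Cn_module d') t \<and>
          (\<forall>e\<in>over F W. \<psi> (f e) = t (\<phi> e)))"

definition V_top :: "'b topology \<Rightarrow> (('b, 'e) vbundle, 'e \<Rightarrow> 'e) category" where
  "V_top Y =
     \<lparr>Ob = {F. vector_bundle Y F},
      Hom = (\<lambda>F F'. {f. bundle_morphism F F' f}),
      ident = (\<lambda>F. restrict (\<lambda>e. e) (total F)),
      comp = (\<lambda>F F' F'' g f. compose (total F) g f)\<rparr>"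

text \<open>\<open>V_lc GL Y\<close> is the category of all locally constant vector bundles, and
  \<open>V_lc Unitary Y\<close> its full subcategory of those whose atlas has unitary transition maps (the
  morphisms need not be unitary). Over an Alexandroff space, the bundles of Hilbert net bundles
  are, up to isomorphism, those of the subcategory: the holonomy of a Hilbert net bundle is
  unitary, while an object of \<open>V_lc GL\<close> such as a line bundle with holonomy \<open>2\<close> over the
  four-point circle is not isomorphic to one with unitary transition maps.\<close>

definition V_lc ::
  "(nat \<Rightarrow> ((nat \<Rightarrow> complex) \<Rightarrow> (nat \<Rightarrow> complex)) set) \<Rightarrow> 'b topology \<Rightarrow>
   (('b, 'e) lc_vbundle, 'e \<Rightarrow> 'e) category" where
  "V_lc G Y =
     \<lparr>Ob = {F. lc_vector_bundle G Y F},
      Hom = (\<lambda>F F'. {f. lc_morphism Y F F' f}),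
      ident = (\<lambda>F. restrict (\<lambda>e. e) (total F)),
      comp = (\<lambda>F F' F'' g f. compose (total F) g f)\<rparr>"

definition pullback_bundle ::
  "'c topology \<Rightarrow> ('c \<Rightarrow> 'b) \<Rightarrow> ('b, 'e) lc_vbundle \<Rightarrow> ('c, 'c \<times> 'e) lc_vbundle" where
  "pullback_bundle Z f F =
     (let T = {(z, e). z \<in> topspace Z \<and> e \<in> total F \<and> f z = prj F e} in
      \<lparr>total = T, prj = fst,
       vzero = (\<lambda>z. (z, vzero F (f z))),
       vadd = (\<lambda>(z, e) (_, e'). (z, vadd F e e')),
       vscale = (\<lambda>c (z, e). (z, vscale F c e)),
       vtop = subtopology (prod_topology Z (vtop F)) T,
       atlas = (\<lambda>(U, \<phi>). ({z \<in> topspace Z. f z \<in> U}, \<phi> \<circ> snd)) ` atlas F\<rparr>)"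


section \<open>Net bundles\<close>

definition pathwise_connected :: "'k::order set \<Rightarrow> bool" where
  "pathwise_connected K \<longleftrightarrow>
     (\<forall>a\<in>K. \<forall>b\<in>K. (\<lambda>x y. x \<in> K \<and> y \<in> K \<and> (x \<le> y \<or> y \<le> x))\<^sup>*\<^sup>* a b)"

text \<open>The sets \<open>{a..}\<close> form a base of the topology they generate.\<close>

definition alexandroff :: "'k::order topology" where
  "alexandroff = topology_generated_by (range (\<lambda>a. {a..}))"

text \<open>\<open>tr X a' a\<close> is the map \<open>X\<^sub>a \<rightarrow> X\<^sub>a'\<close> for \<open>a \<le> a'\<close>.\<close>

record ('k, 'x) net_space =
  tot :: "'x set"
  proj_map :: "'x \<Rightarrow> 'k"
  ftop :: "'k \<Rightarrow> 'x topology"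
  tr :: "'k \<Rightarrow> 'k \<Rightarrow> 'x \<Rightarrow> 'x"

definition net_bundle_of_spaces :: "('k::order, 'x) net_space \<Rightarrow> bool" where
  "net_bundle_of_spaces X \<longleftrightarrow>
     proj_map X ` tot X = UNIV \<and>
     (\<forall>a. topspace (ftop X a) = {x \<in> tot X. proj_map X x = a}) \<and>
     (\<forall>a a'. a \<le> a' \<longrightarrow> homeomorphic_map (ftop X a) (ftop X a') (tr X a' a)) \<and>
     (\<forall>a. \<forall>x\<in>topspace (ftop X a). tr X a a x = x) \<and>
     (\<forall>a a' a''. a \<le> a' \<and> a' \<le> a'' \<longrightarrow>
        (\<forall>x\<in>topspace (ftop X a). tr X a'' a' (tr X a' a x) = tr X a'' a x))"

definition cylinder :: "('k::order, 'x) net_space \<Rightarrow> 'k \<Rightarrow> 'x set \<Rightarrow> 'x set" where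
  "cylinder X a U = (\<Union>b\<in>{a..}. tr X b a ` U)"

text \<open>The cylinders over a net bundle form a base of the topology they generate.\<close>

definition tau :: "('k::order, 'x) net_space \<Rightarrow> 'x topology" where
  "tau X = topology_generated_by {cylinder X a U | a U. openin (ftop X a) U}"

record ('k, 'e) hilbert_net = "('k, 'e) vfamily" +
  ip :: "'e \<Rightarrow> 'e \<Rightarrow> complex"
  J :: "'k \<Rightarrow> 'k \<Rightarrow> 'e \<Rightarrow> 'e"

definition fnorm :: "('k, 'e) hilbert_net \<Rightarrow> 'e \<Rightarrow> real" where
  "fnorm E x = sqrt (Re (ip E x x))"

text \<open>The value 0 off the fibre makes this function symmetric and nonnegative everywhere, as
  the locale \<open>Metric_space\<close> demands.\<close>

definition fdist :: "('k, 'e) hilbert_net \<Rightarrow> 'k \<Rightarrow> 'e \<Rightarrow> 'e \<Rightarrow> real" where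
  "fdist E a x y =
     (if x \<in> fibre E a \<and> y \<in> fibre E a then fnorm E (x \<ominus>\<^bsub>fibre_module E a\<^esub> y) else 0)"

definition hilbert_fibre :: "('k, 'e) hilbert_net \<Rightarrow> 'k \<Rightarrow> bool" where
  "hilbert_fibre E a \<longleftrightarrow>
     module complex_ring (fibre_module E a) \<and>
     (\<forall>x\<in>fibre E a. \<forall>y\<in>fibre E a. \<forall>z\<in>fibre E a. ip E (vadd E x y) z = ip E x z + ip E y z) \<and>
     (\<forall>c. \<forall>x\<in>fibre E a. \<forall>y\<in>fibre E a. ip E (vscale E c x) y = c * ip E x y) \<and>
     (\<forall>x\<in>fibre E a. \<forall>y\<in>fibre E a. ip E y x = cnj (ip E x y)) \<and>
     (\<forall>x\<in>fibre E a. 0 \<le> Re (ip E x x)) \<and>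
     (\<forall>x\<in>fibre E a. ip E x x = 0 \<longrightarrow> x = vzero E a) \<and>
     Metric_space.mcomplete (fibre E a) (fdist E a)"

definition hilbert_net_bundle :: "('k::order, 'e) hilbert_net \<Rightarrow> bool" where
  "hilbert_net_bundle E \<longleftrightarrow>
     prj E ` total E = UNIV \<and>
     (\<forall>a. hilbert_fibre E a) \<and>
     (\<forall>a a'. a \<le> a' \<longrightarrow>
        linear_map (fibre_module E a) (fibre_module E a') (J E a' a) \<and>
        bij_betw (J E a' a) (fibre E a) (fibre E a') \<and>
        (\<forall>x\<in>fibre E a. \<forall>y\<in>fibre E a. ip E (J E a' a x) (J E a' a y) = ip E x y)) \<and>
     (\<forall>a. \<forall>x\<in>fibre E a. J E a a x = x) \<and>
     (\<forall>a a' a''. a \<le> a' \<and> a' \<le> a'' \<longrightarrow>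
        (\<forall>x\<in>fibre E a. J E a'' a' (J E a' a x) = J E a'' a x))"

text \<open>The family \<open>(T\<^sub>a)\<close> is given by the single map \<open>T\<close> on the total set which restricts to
  \<open>T\<^sub>a\<close> on the fibre over \<open>a\<close>.\<close>

definition net_morphism :: "('k::order, 'e) hilbert_net \<Rightarrow> ('k, 'f) hilbert_net \<Rightarrow> ('e \<Rightarrow> 'f) \<Rightarrow> bool" where
  "net_morphism E E' T \<longleftrightarrow>
     fibrewise_linear E E' T \<and>
     (\<forall>a. \<exists>C. \<forall>x\<in>fibre E a. fnorm E' (T x) \<le> C * fnorm E x) \<and>
     (\<forall>a a'. a \<le> a' \<longrightarrow> (\<forall>x\<in>fibre E a. T (J E a' a x) = J E' a' a (T x)))"

definition V_net :: "(('k::order, 'e) hilbert_net, 'e \<Rightarrow> 'e) category" where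
  "V_net =
     \<lparr>Ob = {E. hilbert_net_bundle E \<and> (\<forall>a. finite_dim (fibre_module E a))},
      Hom = (\<lambda>E E'. {T. net_morphism E E' T}),
      ident = (\<lambda>E. restrict (\<lambda>e. e) (total E)),
      comp = (\<lambda>E E' E'' S T. compose (total E) S T)\<rparr>"


section \<open>The functors\<close>

definition net_space_of :: "('k::order, 'e) hilbert_net \<Rightarrow> ('k, 'e) net_space" where
  "net_space_of E =
     \<lparr>tot = total E, proj_map = prj E,
      ftop = (\<lambda>a. Metric_space.mtopology (fibre E a) (fdist E a)), tr = J E\<rparr>"

definition tau_bundle :: "('k::order, 'e) hilbert_net \<Rightarrow> ('k, 'e) vbundle" where
  "tau_bundle E =
     \<lparr>total = total E, prj = prj E, vzero = vzero E, vadd = vadd E, vscale = vscale E,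
      vtop = tau (net_space_of E)\<rparr>"

text \<open>A unitary identification \<open>E\<^sub>a \<cong> \<complex>\<^sup>d\<close>, transported along the maps \<open>J E b a\<close>, gives a
  chart over \<open>{a..}\<close>.\<close>

definition tau_atlas :: "('k::order, 'e) hilbert_net \<Rightarrow> ('k set \<times> ('e \<Rightarrow> nat \<Rightarrow> complex)) set" where
  "tau_atlas E =
     {({a..}, \<phi>) | a \<phi>.
        (\<exists>d. linear_map (fibre_module E a) (Cn_module d) \<phi> \<and>
           bij_betw \<phi> (fibre E a) (Cn d) \<and>
           (\<forall>x\<in>fibre E a. \<forall>y\<in>fibre E a. Cn_inner d (\<phi> x) (\<phi> y) = ip E x y)) \<and>
        (\<forall>b\<ge>a. \<forall>x\<in>fibre E a. \<phi> (J E b a x) = \<phi> x)}"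

definition tau_lc_bundle :: "('k::order, 'e) hilbert_net \<Rightarrow> ('k, 'e) lc_vbundle" where
  "tau_lc_bundle E = vbundle.extend (tau_bundle E) (lc_vbundle.fields (tau_atlas E))"

definition tau_star ::
  "(('k::order, 'e) hilbert_net, 'e \<Rightarrow> 'e, ('k, 'e) vbundle, 'e \<Rightarrow> 'e) cat_functor" where
  "tau_star = \<lparr>on_Ob = tau_bundle, on_Hom = (\<lambda>_ _ T. T)\<rparr>"

definition tau_star_lc ::
  "(('k::order, 'e) hilbert_net, 'e \<Rightarrow> 'e, ('k, 'e) lc_vbundle, 'e \<Rightarrow> 'e) cat_functor" where
  "tau_star_lc = \<lparr>on_Ob = tau_lc_bundle, on_Hom = (\<lambda>_ _ T. T)\<rparr>"

definition pullback_functor ::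
  "('k::order, 'x) net_space \<Rightarrow>
   (('k, 'e) hilbert_net, 'e \<Rightarrow> 'e, ('x, 'x \<times> 'e) lc_vbundle, 'x \<times> 'e \<Rightarrow> 'x \<times> 'e) cat_functor" where
  "pullback_functor X =
     \<lparr>on_Ob = (\<lambda>E. pullback_bundle (tau X) (proj_map X) (tau_lc_bundle E)),
      on_Hom = (\<lambda>E E' T.
        restrict (\<lambda>(x, e). (x, T e)) (total (pullback_bundle (tau X) (proj_map X) (tau_lc_bundle E))))\<rparr>"

end

(* The charts of tau E over the basic open set V_a are the unitary coordinate maps of the fibre E_a
   extended to all E_b with b >= a by constancy along J. Every element over V_a is J_(b,a) x for a
   unique x in E_a, so transition maps, and morphisms of nets read in charts, are constant on each
   V_y: they are determined by their value at y. Conversely, every neighbourhood of a in tau K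
   contains V_a, so a locally constant bundle with unitary transition maps has canonical parallel
   transports E_a -> E_b for a <= b and a well-defined inner product on its fibres, and a locally
   constant morphism commutes with the transports. *)

theory Submission
  imports Defs
begin

text \<open>The inverse construction needs an inner product on every fibre. A locally constant atlas
  supplies one only if its transition maps are unitary, since otherwise different charts at a point
  induce different inner products; this is why the equivalence is with \<open>V_lc Unitary\<close>.
  The functor and its inverse leave the total set, the projection, the fibre operations and the
  functions underlying arrows as they are, so unit and counit are identity functions. They are not
  equalities of objects: an object carries its atlas, and a bundle need not carry the one that its
  net produces. The rank has to be one number for a whole atlas. Comparing two charts on one fibre
  uses that unitary maps preserve dimension, and comparing charts at distant points uses
  connectedness. Topology and completeness of the fibres and bounds for morphisms are all read
  through isometries with \<open>\<complex>\<^sup>d\<close>, where they can be treated coordinate by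
  coordinate.\<close>

section \<open>Modules and linear maps on carrier sets\<close>

lemma complex_ring_simps [simp]:
  "carrier complex_ring = UNIV"
  "x \<otimes>\<^bsub>complex_ring\<^esub> y = x * y"
  "x \<oplus>\<^bsub>complex_ring\<^esub> y = x + y"
  "\<one>\<^bsub>complex_ring\<^esub> = 1"
  "\<zero>\<^bsub>complex_ring\<^esub> = 0"
  by (simp_all add: complex_ring_def)

lemma fibre_module_simps [simp]:
  "carrier (fibre_module F b) = fibre F b"
  "x \<oplus>\<^bsub>fibre_module F b\<^esub> y = vadd F x y"
  "c \<odot>\<^bsub>fibre_module F b\<^esub> x = vscale F c x"
  "\<zero>\<^bsub>fibre_module F b\<^esub> = vzero F b"
  by (simp_all add: fibre_module_def)

lemma Cn_module_simps [simp]: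
  "carrier (Cn_module d) = Cn d"
  "v \<oplus>\<^bsub>Cn_module d\<^esub> w = (\<lambda>i. v i + w i)"
  "c \<odot>\<^bsub>Cn_module d\<^esub> v = (\<lambda>i. c * v i)"
  "\<zero>\<^bsub>Cn_module d\<^esub> = (\<lambda>_. 0)"
  by (simp_all add: Cn_module_def)

lemma linear_mapD:
  assumes "linear_map M N t"
  shows "x \<in> carrier M \<Longrightarrow> t x \<in> carrier N"
    and "x \<in> carrier M \<Longrightarrow> y \<in> carrier M \<Longrightarrow> t (x \<oplus>\<^bsub>M\<^esub> y) = t x \<oplus>\<^bsub>N\<^esub> t y"
    and "x \<in> carrier M \<Longrightarrow> t (c \<odot>\<^bsub>M\<^esub> x) = c \<odot>\<^bsub>N\<^esub> t x"
  using assms by (auto simp: linear_map_def)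

lemma linear_map_compose:
  assumes "linear_map M N f" "linear_map N P g"
  shows "linear_map M P (\<lambda>x. g (f x))"
  using assms by (auto simp: linear_map_def Pi_iff)

lemma linear_map_inv_into:
  assumes "module complex_ring M" "linear_map M N f" "bij_betw f (carrier M) (carrier N)"
  shows "linear_map N M (inv_into (carrier M) f)"
proof -
  interpret module complex_ring M by fact
  let ?g = "inv_into (carrier M) f"
  have g: "?g y \<in> carrier M" "f (?g y) = y" if "y \<in> carrier N" for y
    using assms(3) that by (auto simp: bij_betw_def inv_into_into f_inv_into_f)
  have gf: "?g (f x) = x" if "x \<in> carrier M" for x
    using assms(3) that by (auto simp: bij_betw_def)
  show ?thesis
    unfolding linear_map_def
  proof (intro conjI ballI allI)
    show "?g \<in> carrier N \<rightarrow> carrier M" using g by auto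
    fix y z assume y: "y \<in> carrier N" and z: "z \<in> carrier N"
    have "f (?g y \<oplus>\<^bsub>M\<^esub> ?g z) = y \<oplus>\<^bsub>N\<^esub> z"
      using linear_mapD(2)[OF assms(2)] g y z by simp
    then show "?g (y \<oplus>\<^bsub>N\<^esub> z) = ?g y \<oplus>\<^bsub>M\<^esub> ?g z"
      by (metis gf g(1) y z M.add.m_closed)
  next
    fix c y assume y: "y \<in> carrier N"
    have "f (c \<odot>\<^bsub>M\<^esub> ?g y) = c \<odot>\<^bsub>N\<^esub> y"
      using linear_mapD(3)[OF assms(2)] g y by simp
    then show "?g (c \<odot>\<^bsub>N\<^esub> y) = c \<odot>\<^bsub>M\<^esub> ?g y"
      by (metis gf g(1) y UNIV_I complex_ring_simps(1) smult_closed)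
  qed
qed

text \<open>Each module axiom is an equation in \<open>M\<close>, so by injectivity it may be
  checked after applying \<open>h\<close>. This gives the fibres of a pullback bundle their module
  structure.\<close>

lemma module_via_bij:
  assumes "module complex_ring N" "bij_betw h (carrier M) (carrier N)"
    and "\<And>x y. x \<in> carrier M \<Longrightarrow> y \<in> carrier M \<Longrightarrow> x \<oplus>\<^bsub>M\<^esub> y \<in> carrier M"
    and "\<And>c x. x \<in> carrier M \<Longrightarrow> c \<odot>\<^bsub>M\<^esub> x \<in> carrier M"
    and "linear_map M N h" "\<zero>\<^bsub>M\<^esub> \<in> carrier M" "h \<zero>\<^bsub>M\<^esub> = \<zero>\<^bsub>N\<^esub>"
  shows "module complex_ring M"
proof -
  interpret N: module complex_ring N by fact
  note add = linear_mapD(2)[OF assms(5)] and sc = linear_mapD(3)[OF assms(5)]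
    and cl = linear_mapD(1)[OF assms(5)]
  have inj: "x = y" if "h x = h y" "x \<in> carrier M" "y \<in> carrier M" for x y
    using assms(2) that by (auto simp: bij_betw_def inj_on_def)
  have "abelian_group M"
  proof (rule abelian_groupI)
    fix x assume x: "x \<in> carrier M"
    \<comment> \<open>The candidate for the additive inverse is \<open>(-1)\<close> times
      \<open>x\<close>: its sum with \<open>x\<close> is sent by \<open>h\<close> to the multiple of
      \<open>h x\<close> by \<open>-1 + 1 = 0\<close>.\<close>
    have "h ((-1) \<odot>\<^bsub>M\<^esub> x \<oplus>\<^bsub>M\<^esub> x) = (-1) \<odot>\<^bsub>N\<^esub> h x \<oplus>\<^bsub>N\<^esub> 1 \<odot>\<^bsub>N\<^esub> h x"
      using x assms(4) N.smult_one[OF cl[OF x]] by (simp add: add sc)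
    also have "\<dots> = (-1 + 1) \<odot>\<^bsub>N\<^esub> h x"
      using N.smult_l_distr[of "-1" 1 "h x"] cl[OF x] by simp
    finally have "h ((-1) \<odot>\<^bsub>M\<^esub> x \<oplus>\<^bsub>M\<^esub> x) = h \<zero>\<^bsub>M\<^esub>"
      using N.smult_l_null[OF cl[OF x]] assms(7) by simp
    then have "(-1) \<odot>\<^bsub>M\<^esub> x \<oplus>\<^bsub>M\<^esub> x = \<zero>\<^bsub>M\<^esub>" using assms x by (intro inj) auto
    then show "\<exists>y\<in>carrier M. y \<oplus>\<^bsub>M\<^esub> x = \<zero>\<^bsub>M\<^esub>" using assms x by blast
  qed (auto intro!: inj assms simp: assms add cl N.M.add.m_ac)
  then show ?thesis
    using N.smult_one
    by (intro moduleI N.R.is_cring)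
      (auto intro!: inj assms simp: assms add sc cl N.smult_l_distr[simplified]
        N.smult_r_distr[simplified] N.smult_assoc1[simplified])
qed

section \<open>The spaces \<open>\<complex>\<^sup>d\<close>\<close>

definition unit_vec :: "nat \<Rightarrow> nat \<Rightarrow> complex" where
  "unit_vec j = (\<lambda>i. if i = j then 1 else 0)"

lemma unit_vec_in_Cn: "j < d \<Longrightarrow> unit_vec j \<in> Cn d"
  by (auto simp: unit_vec_def Cn_def)

lemma zero_in_Cn: "(\<lambda>_. 0) \<in> Cn d"
  by (simp add: Cn_def)

text \<open>For \<open>d < d'\<close> the vector \<open>unit_vec d\<close> lies in
  \<open>Cn d'\<close> but not in \<open>Cn d\<close>. The rank of a chart can therefore be
  recovered from the image of a fibre.\<close>

lemma Cn_eq_iff: "Cn d = Cn d' \<longleftrightarrow> d = d'"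
proof
  assume eq: "Cn d = Cn d'"
  show "d = d'"
  proof (rule ccontr)
    assume "d \<noteq> d'"
    then consider "d < d'" | "d' < d" by linarith
    then show False
    proof cases
      case 1
      then have "unit_vec d \<in> Cn d" using eq unit_vec_in_Cn by blast
      then show False by (auto simp: Cn_def unit_vec_def)
    next
      case 2
      then have "unit_vec d' \<in> Cn d'" using eq unit_vec_in_Cn by blast
      then show False by (auto simp: Cn_def unit_vec_def)
    qed
  qed
qed simp

lemma linear_map_Cn_expand:
  assumes t: "linear_map (Cn_module d) (Cn_module d') t" and v: "v \<in> Cn d"
  shows "t v = (\<lambda>i. \<Sum>j<d. v j * t (unit_vec j) i)"
proof -
  \<comment> \<open>Truncations of \<open>v\<close>, so that the induction adds one coordinate at a
    time; \<open>w d = v\<close> because \<open>v\<close> vanishes from index \<open>d\<close>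
    on.\<close>
  define w where "w n = (\<lambda>i. if i < n then v i else 0)" for n
  have w: "w n \<in> Cn d" for n using v by (auto simp: w_def Cn_def)
  have "t (w n) = (\<lambda>i. \<Sum>j<n. v j * t (unit_vec j) i)" if "n \<le> d" for n
    using that
  proof (induction n)
    case 0
    have "t (\<lambda>_. 0) = t (\<lambda>i. 0 * (\<lambda>_. 0) i)" by simp
    also have "\<dots> = (\<lambda>i. 0 * t (\<lambda>_. 0) i)"
      using linear_mapD(3)[OF t, of "\<lambda>_. 0" 0] by (simp add: zero_in_Cn)
    finally show ?case by (simp add: w_def)
  next
    case (Suc n)
    have u: "unit_vec n \<in> Cn d" using Suc.prems by (intro unit_vec_in_Cn) simp
    then have vu: "(\<lambda>i. v n * unit_vec n i) \<in> Cn d" by (auto simp: Cn_def)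
    have eq: "w (Suc n) = (\<lambda>i. w n i + v n * unit_vec n i)"
      by (auto simp: w_def unit_vec_def fun_eq_iff less_Suc_eq)
    have "t (w (Suc n)) = (\<lambda>i. t (w n) i + v n * t (unit_vec n) i)"
      unfolding eq using linear_mapD(2)[OF t, of "w n" "\<lambda>i. v n * unit_vec n i"]
        linear_mapD(3)[OF t, of "unit_vec n" "v n"] w u vu by simp
    with Suc show ?case by simp
  qed
  from this[of d] moreover have "w d = v" using v by (force simp: w_def Cn_def)
  ultimately show ?thesis by simp
qed

lemma topspace_Cn_top [simp]: "topspace (Cn_top d) = Cn d"
  by (simp add: Cn_top_def)

lemma continuous_map_Cn_coord: "continuous_map (Cn_top d) euclidean (\<lambda>v. v i)"
  unfolding Cn_top_def
  by (intro continuous_map_from_subtopology continuous_map_product_projection) auto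

lemma continuous_map_into_Cn_top:
  "continuous_map X (Cn_top d) f \<longleftrightarrow>
     (\<forall>i. continuous_map X euclidean (\<lambda>x. f x i)) \<and> f \<in> topspace X \<rightarrow> Cn d"
  unfolding Cn_top_def continuous_map_in_subtopology continuous_map_componentwise_UNIV
  by auto

text \<open>The topology on \<open>Cn d'\<close> is that of coordinatewise convergence, and each
  coordinate of \<open>t v\<close> is a finite combination of coordinates of \<open>v\<close> with
  fixed coefficients.\<close>

lemma continuous_map_linear_Cn:
  assumes t: "linear_map (Cn_module d) (Cn_module d') t"
  shows "continuous_map (Cn_top d) (Cn_top d') t"
  unfolding continuous_map_into_Cn_top
proof (intro conjI allI)
  fix i
  have "continuous_map (Cn_top d) euclidean (\<lambda>v. \<Sum>j<d. v j * t (unit_vec j) i)"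
  proof (intro continuous_map_sum)
    show "continuous_map (Cn_top d) euclidean (\<lambda>v. v j * t (unit_vec j) i)" for j
      using continuous_map_Cn_coord[of d j] unfolding continuous_map_atin limitin_canonical_iff
      by (intro ballI tendsto_mult tendsto_const) auto
  qed simp
  then show "continuous_map (Cn_top d) euclidean (\<lambda>v. t v i)"
    by (rule continuous_map_eq) (simp add: linear_map_Cn_expand[OF t])
next
  show "t \<in> topspace (Cn_top d) \<rightarrow> Cn d'" using linear_mapD(1)[OF t] by auto
qed

section \<open>The Euclidean metric on the coordinate spaces\<close>

text \<open>The distance belonging to \<open>Cn_inner\<close>; unitary charts become isometries for
  it.\<close>

definition Cn_dist :: "nat \<Rightarrow> (nat \<Rightarrow> complex) \<Rightarrow> (nat \<Rightarrow> complex) \<Rightarrow> real" where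
  "Cn_dist d v w = L2_set (\<lambda>i. cmod (v i - w i)) {..<d}"

lemma Cn_inner_self: "Cn_inner d v v = complex_of_real ((L2_set (\<lambda>i. cmod (v i)) {..<d})\<^sup>2)"
  by (simp add: Cn_inner_def L2_set_def sum_nonneg complex_norm_square[symmetric] del: of_real_power)

lemma Cn_coord_le_dist: "i < d \<Longrightarrow> cmod (v i - w i) \<le> Cn_dist d v w"
  unfolding Cn_dist_def by (rule member_le_L2_set) auto

lemma Metric_space_Cn: "Metric_space (Cn d) (Cn_dist d)"
proof
  fix v w z :: "nat \<Rightarrow> complex"
  show "0 \<le> Cn_dist d v w" by (simp add: Cn_dist_def)
  show "Cn_dist d v w = Cn_dist d w v" by (simp add: Cn_dist_def norm_minus_commute)
  show "Cn_dist d v w = 0 \<longleftrightarrow> v = w" if "v \<in> Cn d" "w \<in> Cn d"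
  proof -
    have "v = w" if "\<forall>i<d. v i = w i"
    proof
      fix i
      show "v i = w i"
        using that \<open>v \<in> Cn d\<close> \<open>w \<in> Cn d\<close> by (cases "i < d") (simp_all add: Cn_def)
    qed
    then show ?thesis by (auto simp: Cn_dist_def L2_set_eq_0_iff)
  qed
  have "Cn_dist d v z \<le> L2_set (\<lambda>i. cmod (v i - w i) + cmod (w i - z i)) {..<d}"
    unfolding Cn_dist_def
    by (rule L2_set_mono) (use dist_triangle[of "v _" "z _" "w _"] in \<open>simp_all add: dist_norm\<close>)
  also have "\<dots> \<le> Cn_dist d v w + Cn_dist d w z"
    unfolding Cn_dist_def by (rule L2_set_triangle_ineq)
  finally show "Cn_dist d v z \<le> Cn_dist d v w + Cn_dist d w z" .
qed

text \<open>The identity is continuous in both directions: coordinates are 1-Lipschitz for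
  \<open>Cn_dist\<close>, and the distance from a fixed point is a continuous expression in finitely
  many coordinates, so balls are open in the product topology.\<close>

lemma mtopology_Cn: "Metric_space.mtopology (Cn d) (Cn_dist d) = Cn_top d"
proof -
  interpret Metric_space "Cn d" "Cn_dist d" by (rule Metric_space_Cn)
  have "continuous_map mtopology euclidean (\<lambda>v. v i)" for i
  proof (cases "i < d")
    case True
    have "continuous_map mtopology (Met_TC.mtopology :: complex topology) (\<lambda>v. v i)"
      unfolding metric_continuous_map[OF Met_TC.Metric_space_axioms]
    proof (intro conjI ballI allI impI)
      fix a and e :: real assume "0 < e"
      then show "\<exists>\<delta>>0. \<forall>x. x \<in> Cn d \<and> Cn_dist d a x < \<delta> \<longrightarrow> dist (a i) (x i) < e"
        using Cn_coord_le_dist[OF True, of a] by (intro exI[of _ e]) (auto simp: dist_norm intro: le_less_trans)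
    qed auto
    then show ?thesis by simp
  next
    case False
    have "continuous_map mtopology euclidean (\<lambda>v. 0::complex)" by simp
    then show ?thesis
      by (rule continuous_map_eq) (use False in \<open>auto simp: Cn_def[of d] topspace_mtopology[unfolded Cn_def]\<close>)
  qed
  then have 1: "continuous_map mtopology (Cn_top d) id"
    by (simp add: continuous_map_into_Cn_top)
  have dist: "continuous_map (Cn_top d) euclideanreal (\<lambda>w. Cn_dist d v w)" for v
  proof -
    have "limitin euclidean (\<lambda>w. w i) (x i) (atin (Cn_top d) x)" if "x \<in> Cn d" for x i
      using continuous_map_Cn_coord[of d i] that unfolding continuous_map_atin by simp
    then show ?thesis
      unfolding Cn_dist_def L2_set_def continuous_map_atin limitin_canonical_iff topspace_Cn_top
      by (intro ballI tendsto_intros)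
  qed
  have 2: "continuous_map (Cn_top d) mtopology id"
    unfolding continuous_map_to_metric
  proof (intro ballI allI impI)
    fix v and e :: real assume v: "v \<in> topspace (Cn_top d)" and "0 < e"
    have "openin (Cn_top d) {w \<in> topspace (Cn_top d). Cn_dist d v w \<in> {..<e}}"
      by (rule openin_continuous_map_preimage[OF dist]) simp
    then show "\<exists>U. openin (Cn_top d) U \<and> v \<in> U \<and> (\<forall>y\<in>U. id y \<in> mball (id v) e)"
      using v \<open>0 < e\<close> by (intro exI[of _ "{w \<in> topspace (Cn_top d). Cn_dist d v w \<in> {..<e}}"]) auto
  qed
  have "openin mtopology S \<longleftrightarrow> openin (Cn_top d) S" for S
    using topology_finer_continuous_id[of mtopology "Cn_top d"]
      topology_finer_continuous_id[of "Cn_top d" mtopology] 1 2 by auto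
  then show ?thesis by (simp add: topology_eq)
qed

text \<open>A Cauchy sequence is Cauchy in every coordinate, and the limits vanish from
  \<open>d\<close> on because the terms do; coordinatewise convergence is metric convergence by
  \<open>mtopology_Cn\<close>.\<close>

lemma mcomplete_Cn: "Metric_space.mcomplete (Cn d) (Cn_dist d)"
proof -
  interpret Metric_space "Cn d" "Cn_dist d" by (rule Metric_space_Cn)
  show ?thesis
    unfolding mcomplete_def
  proof (intro allI impI)
    fix \<sigma> assume \<sigma>: "MCauchy \<sigma>"
    then have \<sigma>C: "\<sigma> n \<in> Cn d" for n by (auto simp: MCauchy_def)
    have "Cauchy (\<lambda>n. \<sigma> n i)" for i
    proof (cases "i < d")
      case True
      show ?thesis
        unfolding Cauchy_def dist_norm
        using \<sigma> Cn_coord_le_dist[OF True] unfolding MCauchy_def by (meson order_le_less_trans)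
    next
      case False
      then have "(\<lambda>n. \<sigma> n i) = (\<lambda>_. 0)" using \<sigma>C by (auto simp: Cn_def)
      then show ?thesis by (simp add: Cauchy_def)
    qed
    then obtain l where l: "(\<lambda>n. \<sigma> n i) \<longlonglongrightarrow> l i" for i
      unfolding Cauchy_convergent_iff convergent_def by metis
    have "l i = 0" if "d \<le> i" for i
      using l[of i] \<sigma>C that by (simp add: Cn_def LIMSEQ_const_iff)
    then have lC: "l \<in> Cn d" by (simp add: Cn_def)
    have "limitin (Cn_top d) \<sigma> l sequentially"
      unfolding Cn_top_def limitin_subtopology
      using l lC \<sigma>C by (simp add: limitin_componentwise)
    then show "\<exists>x. limitin mtopology \<sigma> x sequentially"
      using mtopology_Cn by metis
  qed
qed

text \<open>The squared moduli of the matrix entries of \<open>g\<close> add up to \<open>d\<close>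
  when summed by columns and to \<open>d'\<close> when summed by rows, since columns and rows
  consist of unit vectors.\<close>

lemma unitary_dim_unique:
  assumes "linear_map (Cn_module d) (Cn_module d') g" "bij_betw g (Cn d) (Cn d')"
    and ip: "\<And>v w. v \<in> Cn d \<Longrightarrow> w \<in> Cn d \<Longrightarrow> Cn_inner d' (g v) (g w) = Cn_inner d v w"
  shows "d = d'"
proof -
  let ?e = unit_vec
  define h where "h = inv_into (Cn d) g"
  have h: "h w \<in> Cn d" "g (h w) = w" if "w \<in> Cn d'" for w
    using assms(2) that by (auto simp: bij_betw_def h_def inv_into_into f_inv_into_f)
  have coordl: "Cn_inner n (?e i) v = cnj (v i)" and coordr: "Cn_inner n v (?e i) = v i" 
    if "i < n" for n i v
    using that by (simp_all add: Cn_inner_def unit_vec_def if_distrib[of cnj] if_distrib[of "\<lambda>x. _ * x"]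
      if_distrib[of "\<lambda>x. x * _"] cong: if_cong)
  \<comment> \<open>The inverse of a unitary map is its adjoint, written in matrix entries; this
    turns rows of \<open>g\<close> into columns of \<open>h\<close>.\<close>
  have entry: "g (?e j) i = cnj (h (?e i) j)" if "j < d" "i < d'" for i j
  proof -
    have "g (?e j) i = Cn_inner d' (g (?e j)) (g (h (?e i)))"
      using that h(2)[of "?e i"] by (simp add: coordr unit_vec_in_Cn)
    also have "\<dots> = Cn_inner d (?e j) (h (?e i))"
      using that by (simp add: ip unit_vec_in_Cn h(1))
    finally show ?thesis using that by (simp add: coordl)
  qed
  have one: "Cn_inner n (?e i) (?e i) = 1" if "i < n" for i n
    using coordr[OF that, of "?e i"] by (simp add: unit_vec_def)
  have "(of_nat d :: complex) = (\<Sum>j<d. Cn_inner d' (g (?e j)) (g (?e j)))"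
    by (simp add: ip unit_vec_in_Cn one)
  also have "\<dots> = (\<Sum>j<d. \<Sum>i<d'. g (?e j) i * cnj (g (?e j) i))"
    by (simp add: Cn_inner_def)
  also have "\<dots> = (\<Sum>i<d'. \<Sum>j<d. h (?e i) j * cnj (h (?e i) j))"
    by (subst sum.swap) (simp add: entry mult.commute)
  also have "\<dots> = (\<Sum>i<d'. Cn_inner d (h (?e i)) (h (?e i)))"
    by (simp add: Cn_inner_def)
  also have "\<dots> = (\<Sum>i<d'. 1)"
    by (intro sum.cong refl, subst ip[symmetric]) (simp_all add: h unit_vec_in_Cn one)
  finally show ?thesis by simp
qed

section \<open>Orthonormal bases\<close>

text \<open>The axioms are those of \<open>hilbert_fibre\<close> without completeness. Positivity is
  imposed on the real part; that \<open>ip x x\<close> is real comes from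
  \<open>ip_sym\<close>.\<close>

locale inner_product_module = module complex_ring M for M :: "(complex, 'v) module" (structure) +
  fixes ip :: "'v \<Rightarrow> 'v \<Rightarrow> complex"
  assumes ip_add: "\<lbrakk>x \<in> carrier M; y \<in> carrier M; z \<in> carrier M\<rbrakk> \<Longrightarrow> ip (x \<oplus> y) z = ip x z + ip y z"
    and ip_smult: "\<lbrakk>x \<in> carrier M; y \<in> carrier M\<rbrakk> \<Longrightarrow> ip (c \<odot> x) y = c * ip x y"
    and ip_sym: "\<lbrakk>x \<in> carrier M; y \<in> carrier M\<rbrakk> \<Longrightarrow> ip y x = cnj (ip x y)"
    and ip_nonneg: "x \<in> carrier M \<Longrightarrow> 0 \<le> Re (ip x x)"
    and ip_definite: "x \<in> carrier M \<Longrightarrow> ip x x = 0 \<Longrightarrow> x = \<zero>"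
begin

lemma smult_in [simp]: "x \<in> carrier M \<Longrightarrow> c \<odot> x \<in> carrier M"
  by (rule smult_closed) auto

lemma ip_zero: "x \<in> carrier M \<Longrightarrow> ip \<zero> x = 0"
  using ip_smult[of "\<zero>" x 0] smult_l_null[of "\<zero>"] by simp

lemma ip_finsum:
  assumes "finite A" "f \<in> A \<rightarrow> carrier M" "z \<in> carrier M"
  shows "ip (finsum M f A) z = (\<Sum>i\<in>A. ip (f i) z)"
  using assms by (induction A) (auto simp: ip_zero ip_add Pi_iff finsum_closed)

lemma ip_smult_right:
  "\<lbrakk>x \<in> carrier M; y \<in> carrier M\<rbrakk> \<Longrightarrow> ip y (c \<odot> x) = cnj c * ip y x"
  using ip_sym[of "c \<odot> x" y] ip_sym[of x y] by (simp add: ip_smult)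

definition orthonormal :: "nat \<Rightarrow> (nat \<Rightarrow> 'v) \<Rightarrow> bool" where
  "orthonormal n u \<longleftrightarrow>
     u \<in> {..<n} \<rightarrow> carrier M \<and> (\<forall>i<n. \<forall>j<n. ip (u i) (u j) = (if i = j then 1 else 0))"

text \<open>Indexed by positions rather than by vectors, so that a coefficient function is at the
  same time a coordinate vector.\<close>

definition lincomb :: "nat \<Rightarrow> (nat \<Rightarrow> 'v) \<Rightarrow> (nat \<Rightarrow> complex) \<Rightarrow> 'v" where
  "lincomb n u c = finsum M (\<lambda>i. c i \<odot> u i) {..<n}"

lemma lincomb_closed: "u \<in> {..<n} \<rightarrow> carrier M \<Longrightarrow> lincomb n u c \<in> carrier M"
  unfolding lincomb_def by (intro finsum_closed) auto

lemma lincomb_Suc: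
  "u \<in> {..<Suc n} \<rightarrow> carrier M \<Longrightarrow> lincomb (Suc n) u c = c n \<odot> u n \<oplus> lincomb n u c"
  unfolding lincomb_def lessThan_Suc by (subst finsum_insert) auto

lemma lincomb_cong:
  "\<lbrakk>u \<in> {..<n} \<rightarrow> carrier M; \<And>i. i < n \<Longrightarrow> u i = u' i; \<And>i. i < n \<Longrightarrow> c i = c' i\<rbrakk>
     \<Longrightarrow> lincomb n u c = lincomb n u' c'"
  unfolding lincomb_def by (intro finsum_cong') (auto simp: Pi_iff)

lemma ip_lincomb:
  "\<lbrakk>u \<in> {..<n} \<rightarrow> carrier M; z \<in> carrier M\<rbrakk> \<Longrightarrow> ip (lincomb n u c) z = (\<Sum>i<n. c i * ip (u i) z)"
  unfolding lincomb_def by (subst ip_finsum) (auto simp: ip_smult Pi_iff intro!: sum.cong)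

lemma ip_lincomb_orthonormal:
  assumes "orthonormal n u" "j < n"
  shows "ip (lincomb n u c) (u j) = c j"
proof -
  have "ip (lincomb n u c) (u j) = (\<Sum>i<n. c i * (if i = j then 1 else 0))"
    using assms unfolding orthonormal_def
    by (subst ip_lincomb) (auto intro!: sum.cong)
  also have "\<dots> = c j" using assms(2) by (simp add: if_distrib[of "\<lambda>x. _ * x"] cong: if_cong)
  finally show ?thesis .
qed

lemma lincomb_add:
  assumes "u \<in> {..<n} \<rightarrow> carrier M"
  shows "lincomb n u c \<oplus> lincomb n u c' = lincomb n u (\<lambda>i. c i + c' i)"
proof -
  have "lincomb n u (\<lambda>i. c i + c' i) = finsum M (\<lambda>i. c i \<odot> u i \<oplus> c' i \<odot> u i) {..<n}"
    unfolding lincomb_def using assms by (intro finsum_cong') (auto simp: smult_l_distr[simplified] Pi_iff)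
  then show ?thesis unfolding lincomb_def using assms by (subst finsum_addf[symmetric]) auto
qed

lemma lincomb_smult:
  assumes "u \<in> {..<n} \<rightarrow> carrier M"
  shows "a \<odot> lincomb n u c = lincomb n u (\<lambda>i. a * c i)"
proof -
  have "lincomb n u (\<lambda>i. a * c i) = finsum M (\<lambda>i. a \<odot> (c i \<odot> u i)) {..<n}"
    unfolding lincomb_def using assms by (intro finsum_cong') (auto simp: smult_assoc1[simplified] Pi_iff)
  then show ?thesis unfolding lincomb_def using assms by (subst finsum_smult_ldistr) auto
qed

lemma lincomb_zero: "u \<in> {..<n} \<rightarrow> carrier M \<Longrightarrow> lincomb n u (\<lambda>_. 0) = \<zero>"
  using lincomb_smult[of u n 0 "\<lambda>_. 0"] smult_l_null[OF lincomb_closed, of u n "\<lambda>_. 0"] by simp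

text \<open>The vector \<open>b\<close> is split into its projection \<open>p\<close> onto the span
  and a remainder \<open>w\<close> orthogonal to it. A vanishing remainder means that
  \<open>b\<close> adds nothing, so the given vectors may be dependent; otherwise \<open>w\<close>
  is normalised and appended.\<close>

lemma gram_schmidt_step:
  assumes u: "orthonormal n u" and b: "b \<in> carrier M"
  shows "\<exists>n' u'. orthonormal n' u' \<and> range (lincomb n u) \<subseteq> range (lincomb n' u')
           \<and> b \<in> range (lincomb n' u')"
proof -
  have uc: "u \<in> {..<n} \<rightarrow> carrier M" using u by (simp add: orthonormal_def)
  define p where "p = lincomb n u (\<lambda>i. ip b (u i))"
  have pc: "p \<in> carrier M" using lincomb_closed[OF uc] by (simp add: p_def)
  define w where "w = b \<oplus> (-1) \<odot> p"
  have wc: "w \<in> carrier M" using b pc by (simp add: w_def)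
  have "p \<oplus> (-1) \<odot> p = (1 + -1) \<odot> p"
    using smult_l_distr[of 1 "-1" p] smult_one pc by simp
  then have pp: "p \<oplus> (-1) \<odot> p = \<zero>" using smult_l_null[of p] pc by simp
  have "w \<oplus> p = b \<oplus> (p \<oplus> (-1) \<odot> p)" using b pc by (simp add: w_def M.add.m_ac)
  then have wp: "w \<oplus> p = b" using pp b by simp
  have wu: "ip w (u j) = 0" if "j < n" for j
  proof -
    have "u j \<in> carrier M" using uc that by auto
    moreover have "ip p (u j) = ip b (u j)"
      unfolding p_def by (rule ip_lincomb_orthonormal[OF u that])
    ultimately show ?thesis using b pc by (simp add: w_def ip_add ip_smult)
  qed
  show ?thesis
  proof (cases "w = \<zero>")
    case True
    then have "b = p" using wp pc by simp
    then show ?thesis using u p_def by blast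
  next
    case False
    define r where "r = Re (ip w w)"
    have ipw: "ip w w = complex_of_real r"
      using arg_cong[OF ip_sym[OF wc wc], of Im] by (simp add: r_def complex_eq_iff)
    have r: "r > 0"
      using ip_nonneg[OF wc] ip_definite[OF wc] False ipw by (cases "r = 0") auto
    \<comment> \<open>The norm of \<open>w\<close>; being real it equals its conjugate, which makes
      \<open>(1/s) \<odot> w\<close> a unit vector.\<close>
    define s where "s = complex_of_real (sqrt r)"
    have ss: "s * s = complex_of_real r" and s0: "s \<noteq> 0" and cs: "cnj s = s"
      using r by (auto simp: s_def simp flip: of_real_mult)
    define u' where "u' = u(n := (1/s) \<odot> w)"
    have u'n: "u' n = (1/s) \<odot> w" and u'i: "i < n \<Longrightarrow> u' i = u i" for i by (auto simp: u'_def)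
    have u'c: "u' \<in> {..<Suc n} \<rightarrow> carrier M" using uc wc by (auto simp: u'_def less_Suc_eq)
    have "ip (u' n) (u' n) = 1"
      using wc s0 cs by (simp add: u'n ip_smult ip_smult_right ipw ss[symmetric])
    moreover have "ip (u' n) (u' j) = 0" "ip (u' j) (u' n) = 0" if "j < n" for j
    proof -
      have uj: "u j \<in> carrier M" using uc that by auto
      show 1: "ip (u' n) (u' j) = 0"
        using wc uj wu[OF that] that by (simp add: u'n u'i ip_smult)
      then show "ip (u' j) (u' n) = 0"
        using ip_sym[of "u' n" "u' j"] funcset_mem[OF u'c] that by simp
    qed
    ultimately have on: "orthonormal (Suc n) u'"
      using u u'c unfolding orthonormal_def by (auto simp: less_Suc_eq u'i)
    \<comment> \<open>Setting the new coefficient to 0 recovers every old combination, so the span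
      can only grow.\<close>
    have "lincomb (Suc n) u' (c(n := 0)) = lincomb n u c" for c
    proof -
      have "lincomb n u' (c(n := 0)) = lincomb n u c"
        using u'c by (intro lincomb_cong) (auto simp: u'i)
      then show ?thesis
        using lincomb_Suc[OF u'c, of "c(n := 0)"] lincomb_closed[OF uc] smult_l_null[of "u' n"] u'n wc
        by simp
    qed
    then have "range (lincomb n u) \<subseteq> range (lincomb (Suc n) u')" by (metis image_subsetI rangeI)
    \<comment> \<open>Here \<open>b\<close> is the sum of \<open>p\<close> and \<open>w\<close>, and
      \<open>w\<close> is \<open>s\<close> times the new unit vector.\<close>
    moreover have "b = lincomb (Suc n) u' ((\<lambda>i. ip b (u i))(n := s))"
    proof -
      have "lincomb n u' ((\<lambda>i. ip b (u i))(n := s)) = p"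
        unfolding p_def using u'c by (intro lincomb_cong) (auto simp: u'i)
      moreover have "s \<odot> u' n = w"
        using wc s0 smult_assoc1[of s "1/s" w] smult_one[OF wc] by (simp add: u'n)
      ultimately show ?thesis using lincomb_Suc[OF u'c] wp by simp
    qed
    ultimately show ?thesis using on by blast
  qed
qed

lemma gram_schmidt:
  assumes "finite B" "B \<subseteq> carrier M"
  shows "\<exists>n u. orthonormal n u \<and> B \<subseteq> range (lincomb n u)"
  using assms
proof (induction B)
  case empty
  have "orthonormal 0 (\<lambda>_. \<zero>)" by (simp add: orthonormal_def)
  then show ?case by blast
next
  case (insert b B)
  then have "B \<subseteq> carrier M" by simp
  from insert.IH[OF this] obtain n u where u: "orthonormal n u" "B \<subseteq> range (lincomb n u)" by metis
  obtain n' u' where u': "orthonormal n' u'" "range (lincomb n u) \<subseteq> range (lincomb n' u')"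
      "b \<in> range (lincomb n' u')"
    using gram_schmidt_step[OF u(1), of b] insert.prems by auto
  have "insert b B \<subseteq> range (lincomb n' u')"
    using u'(3) subset_trans[OF u(2) u'(2)] by (rule insert_subsetI)
  with u'(1) show ?case by blast
qed

lemma orthonormal_basis_exists:
  assumes "finite_dim M"
  shows "\<exists>n u. orthonormal n u \<and> range (lincomb n u) = carrier M"
proof -
  obtain B where B: "finite B" "B \<subseteq> carrier M"
    and gen: "\<And>x. x \<in> carrier M \<Longrightarrow> \<exists>c. x = finsum M (\<lambda>b. c b \<odot> b) B"
    using assms unfolding finite_dim_def by blast
  obtain n u where u: "orthonormal n u" and Bu: "B \<subseteq> range (lincomb n u)"
    using gram_schmidt[OF B] by blast
  have uc: "u \<in> {..<n} \<rightarrow> carrier M" using u by (simp add: orthonormal_def)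
  have add: "x \<oplus> y \<in> range (lincomb n u)"
    if "x \<in> range (lincomb n u)" "y \<in> range (lincomb n u)" for x y
    using that lincomb_add[OF uc] by auto
  have smult: "c \<odot> x \<in> range (lincomb n u)" if "x \<in> range (lincomb n u)" for c x
    using that lincomb_smult[OF uc] by auto
  \<comment> \<open>Subsets of \<open>B\<close> instead of \<open>B\<close> itself, so that the
    induction over \<open>A\<close> keeps \<open>B\<close> and its inclusion in the span
    fixed.\<close>
  have fin: "finsum M (\<lambda>b. c b \<odot> b) A \<in> range (lincomb n u)" if "A \<subseteq> B" for c A
    using finite_subset[OF that B(1)] that
  proof (induction A)
    case empty
    have "\<zero> = lincomb n u (\<lambda>_. 0)" using lincomb_zero[OF uc] by simp
    then show ?case by auto
  next
    case (insert b A)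
    have "c b \<odot> b \<in> range (lincomb n u)"
      using subsetD[OF Bu] insert.prems by (intro smult) simp
    then have "c b \<odot> b \<oplus> finsum M (\<lambda>b. c b \<odot> b) A \<in> range (lincomb n u)"
      using add insert.IH insert.prems by simp
    moreover have "b \<in> carrier M" "A \<subseteq> carrier M" using insert.prems B(2) by auto
    ultimately show ?case
      using insert.hyps by (subst finsum_insert) (auto simp: subset_iff)
  qed
  have "x \<in> range (lincomb n u)" if "x \<in> carrier M" for x
    using gen[OF that] fin[OF order_refl] by auto
  then have "range (lincomb n u) = carrier M"
    using lincomb_closed[OF uc] by auto
  with u show ?thesis by metis
qed

text \<open>Coordinates are the inner products with an orthonormal basis, padded by 0 from index
  \<open>n\<close> on; \<open>lincomb n u\<close> inverts them, and expanding \<open>x\<close> in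
  the basis gives Parseval's identity.\<close>

lemma unitary_coordinates_exist:
  assumes "finite_dim M"
  shows "\<exists>d \<phi>. linear_map M (Cn_module d) \<phi> \<and> bij_betw \<phi> (carrier M) (Cn d) \<and>
           (\<forall>x\<in>carrier M. \<forall>y\<in>carrier M. Cn_inner d (\<phi> x) (\<phi> y) = ip x y)"
proof -
  obtain n u where u: "orthonormal n u" and span: "range (lincomb n u) = carrier M"
    using orthonormal_basis_exists[OF assms] by blast
  have uc: "u \<in> {..<n} \<rightarrow> carrier M" using u by (simp add: orthonormal_def)
  have ui: "i < n \<Longrightarrow> u i \<in> carrier M" for i using uc by auto
  define \<phi> where "\<phi> x = (\<lambda>i. if i < n then ip x (u i) else 0)" for x
  have \<phi>C: "\<phi> x \<in> Cn n" for x by (simp add: \<phi>_def Cn_def)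
  have \<phi>l: "\<phi> (lincomb n u v) = v" if "v \<in> Cn n" for v
    using that ip_lincomb_orthonormal[OF u] by (auto simp: \<phi>_def Cn_def)
  have l\<phi>: "lincomb n u (\<phi> x) = x" if x: "x \<in> carrier M" for x
  proof -
    obtain c where "x = lincomb n u c" using span x by blast
    then show ?thesis
      using ip_lincomb_orthonormal[OF u] by (auto simp: \<phi>_def intro!: lincomb_cong[OF uc])
  qed
  have "bij_betw \<phi> (carrier M) (Cn n)"
    by (rule bij_betw_byWitness[where f' = "lincomb n u"])
      (use \<phi>C \<phi>l l\<phi> lincomb_closed[OF uc] in auto)
  moreover have "linear_map M (Cn_module n) \<phi>"
    unfolding linear_map_def
    by (auto simp: \<phi>C) (auto simp: \<phi>_def ip_add ip_smult ui fun_eq_iff)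
  moreover have "Cn_inner n (\<phi> x) (\<phi> y) = ip x y" if xy: "x \<in> carrier M" "y \<in> carrier M" for x y
  proof -
    have "ip x y = (\<Sum>i<n. \<phi> x i * ip (u i) y)"
      using ip_lincomb[OF uc, of y "\<phi> x"] l\<phi> xy by simp
    also have "\<dots> = Cn_inner n (\<phi> x) (\<phi> y)"
      unfolding Cn_inner_def using ui xy
      by (intro sum.cong refl) (simp add: \<phi>_def ip_sym[of y])
    finally show ?thesis by simp
  qed
  ultimately show ?thesis by blast
qed

end

section \<open>The Alexandroff topology and the topology of a net bundle\<close>

text \<open>Up-sets form a topology containing the base, which is the induction; conversely an
  up-set is a union of sets \<open>{x..}\<close>. Hence \<open>{a..}\<close> is the least
  neighbourhood of \<open>a\<close>, and what is constant near \<open>a\<close> is constant on all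
  of it.\<close>

lemma openin_alexandroff: "openin alexandroff U \<longleftrightarrow> (\<forall>x\<in>U. {x..} \<subseteq> (U :: 'k::order set))"
proof
  assume "openin alexandroff U"
  then have "generate_topology_on (range (\<lambda>a::'k. {a..})) U"
    by (simp add: alexandroff_def openin_topology_generated_by_iff)
  then show "\<forall>x\<in>U. {x..} \<subseteq> U"
    by induction (auto intro: order_trans, blast+)
next
  assume U: "\<forall>x\<in>U. {x..} \<subseteq> U"
  have "openin alexandroff {x..}" for x :: 'k
    unfolding alexandroff_def by (rule topology_generated_by_Basis) simp
  then show "openin alexandroff U"
    by (subst openin_subopen) (use U in \<open>meson atLeast_iff order_refl\<close>)
qed

lemma openin_alexandroff_atLeast [simp]: "openin alexandroff {a..}"
  by (auto simp: openin_alexandroff)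

lemma topspace_alexandroff [simp]: "topspace alexandroff = UNIV"
  using openin_subset[of alexandroff UNIV] by (auto simp: openin_alexandroff)

lemma net_bundle_of_spacesD:
  assumes "net_bundle_of_spaces X"
  shows "topspace (ftop X a) = {x \<in> tot X. proj_map X x = a}"
    and "a \<le> b \<Longrightarrow> homeomorphic_map (ftop X a) (ftop X b) (tr X b a)"
    and "x \<in> tot X \<Longrightarrow> tr X (proj_map X x) (proj_map X x) x = x"
    and "\<lbrakk>a \<le> b; b \<le> c; x \<in> tot X; proj_map X x = a\<rbrakk> \<Longrightarrow> tr X c b (tr X b a x) = tr X c a x"
    and "\<lbrakk>a \<le> b; x \<in> tot X; proj_map X x = a\<rbrakk> \<Longrightarrow> tr X b a x \<in> tot X \<and> proj_map X (tr X b a x) = b"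
proof -
  show top: "topspace (ftop X a) = {x \<in> tot X. proj_map X x = a}" for a
    using assms by (simp add: net_bundle_of_spaces_def)
  show hom: "a \<le> b \<Longrightarrow> homeomorphic_map (ftop X a) (ftop X b) (tr X b a)"
    using assms by (simp add: net_bundle_of_spaces_def)
  show "x \<in> tot X \<Longrightarrow> tr X (proj_map X x) (proj_map X x) x = x"
    and "\<lbrakk>a \<le> b; b \<le> c; x \<in> tot X; proj_map X x = a\<rbrakk> \<Longrightarrow> tr X c b (tr X b a x) = tr X c a x"
    using assms by (auto simp: net_bundle_of_spaces_def)
  show "tr X b a x \<in> tot X \<and> proj_map X (tr X b a x) = b"
    if "a \<le> b" "x \<in> tot X" "proj_map X x = a"
    using homeomorphic_imp_surjective_map[OF hom[OF that(1)]] top[of a] top[of b] that(2,3) by auto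
qed

lemma cylinder_subset:
  assumes "net_bundle_of_spaces X" "openin (ftop X a) U"
  shows "cylinder X a U \<subseteq> {x \<in> tot X. a \<le> proj_map X x}"
  using openin_subset[OF assms(2)] net_bundle_of_spacesD[OF assms(1)]
  by (auto simp: cylinder_def)

text \<open>If a point of a cylinder over \<open>b\<close> lies in the fibre over \<open>a\<close>,
  the cylinder also contains one based at \<open>a\<close> around that point, because
  \<open>tr X a b\<close> is an open map. So neighbourhoods of \<open>x\<close> may always be based
  at the fibre of \<open>x\<close> itself.\<close>

lemma openin_tau:
  assumes X: "net_bundle_of_spaces X"
  shows "openin (tau X) W \<longleftrightarrow>
    W \<subseteq> tot X \<and> (\<forall>x\<in>W. \<exists>U. openin (ftop X (proj_map X x)) U \<and> x \<in> U \<and> cylinder X (proj_map X x) U \<subseteq> W)"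
    (is "_ \<longleftrightarrow> ?R W")
proof
  note D = net_bundle_of_spacesD[OF X]
  assume "openin (tau X) W"
  then have "generate_topology_on {cylinder X a U | a U. openin (ftop X a) U} W"
    by (simp add: tau_def openin_topology_generated_by_iff)
  then show "?R W"
  proof induction
    case Empty
    show ?case by simp
  next
    case (Int V W)
    show ?case
    proof (intro conjI ballI)
      show "V \<inter> W \<subseteq> tot X" using Int by blast
      fix x assume x: "x \<in> V \<inter> W"
      obtain U where U: "openin (ftop X (proj_map X x)) U" "x \<in> U" "cylinder X (proj_map X x) U \<subseteq> V"
        using Int x by blast
      obtain U' where U': "openin (ftop X (proj_map X x)) U'" "x \<in> U'" "cylinder X (proj_map X x) U' \<subseteq> W"
        using Int x by blast
      \<comment> \<open>Both cylinders start from the fibre of \<open>x\<close>, so it is enough to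
        intersect their bases.\<close>
      have "cylinder X (proj_map X x) (U \<inter> U') \<subseteq> V \<inter> W"
        using U(3) U'(3) unfolding cylinder_def by blast
      then show "\<exists>U. openin (ftop X (proj_map X x)) U \<and> x \<in> U \<and> cylinder X (proj_map X x) U \<subseteq> V \<inter> W"
        using U U' openin_Int by blast
    qed
  next
    case (UN K)
    then show ?case by (meson Sup_le_iff Union_iff Sup_upper order_trans)
  next
    case (Basis s)
    then obtain b U where s: "s = cylinder X b U" and U: "openin (ftop X b) U" by blast
    have Ub: "u \<in> tot X" "proj_map X u = b" if "u \<in> U" for u
      using openin_subset[OF U] D(1) that by auto
    show ?case
      unfolding s
    proof (intro conjI ballI)
      show "cylinder X b U \<subseteq> tot X" using cylinder_subset[OF X U] by auto
      fix x assume "x \<in> cylinder X b U"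
      then obtain a u where a: "b \<le> a" and u: "u \<in> U" and x: "x = tr X a b u"
        by (auto simp: cylinder_def)
      have px: "proj_map X x = a" using D(5)[OF a Ub[OF u]] x by simp
      \<comment> \<open>The base is moved from \<open>b\<close> up to \<open>a\<close>; by the
        composition law of \<open>tr\<close> nothing outside the old cylinder is reached.\<close>
      have "openin (ftop X a) (tr X a b ` U)"
        using homeomorphic_imp_open_map[OF D(2)[OF a]] U by (simp add: open_map_def)
      moreover have "cylinder X a (tr X a b ` U) \<subseteq> cylinder X b U"
      proof
        fix y assume "y \<in> cylinder X a (tr X a b ` U)"
        then obtain c v where c: "a \<le> c" and v: "v \<in> U" and y: "y = tr X c a (tr X a b v)"
          by (auto simp: cylinder_def)
        have "y = tr X c b v" using D(4)[OF a c Ub[OF v]] y by simp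
        then show "y \<in> cylinder X b U" using order_trans[OF a c] v by (auto simp: cylinder_def)
      qed
      ultimately show "\<exists>U'. openin (ftop X (proj_map X x)) U' \<and> x \<in> U' \<and>
          cylinder X (proj_map X x) U' \<subseteq> cylinder X b U"
        using px u x by blast
    qed
  qed
next
  note D = net_bundle_of_spacesD[OF X]
  assume R: "?R W"
  show "openin (tau X) W"
  proof (subst openin_subopen, intro ballI)
    fix x assume x: "x \<in> W"
    let ?a = "proj_map X x"
    obtain U where U: "openin (ftop X ?a) U" "x \<in> U" "cylinder X ?a U \<subseteq> W"
      using R x by blast
    have "openin (tau X) (cylinder X ?a U)"
      unfolding tau_def using U(1) by (intro topology_generated_by_Basis) blast
    moreover have "x \<in> cylinder X ?a U"
      unfolding cylinder_def using U(2) D(3)[of x] R x by force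
    ultimately show "\<exists>T. openin (tau X) T \<and> x \<in> T \<and> T \<subseteq> W" using U(3) by blast
  qed
qed

text \<open>The cylinder on the whole fibre through a point stays over the up-set
  \<open>V\<close>.\<close>

lemma openin_tau_over:
  assumes X: "net_bundle_of_spaces X" and V: "openin alexandroff V"
  shows "openin (tau X) {x \<in> tot X. proj_map X x \<in> V}"
  unfolding openin_tau[OF X]
proof (intro conjI ballI)
  fix x assume x: "x \<in> {x \<in> tot X. proj_map X x \<in> V}"
  let ?U = "topspace (ftop X (proj_map X x))"
  have "cylinder X (proj_map X x) ?U \<subseteq> {x \<in> tot X. proj_map X x \<in> V}"
    using cylinder_subset[OF X openin_topspace, of "proj_map X x"] V x
    unfolding openin_alexandroff by fastforce
  moreover have "x \<in> ?U" using net_bundle_of_spacesD(1)[OF X] x by simp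
  ultimately show "\<exists>U. openin (ftop X (proj_map X x)) U \<and> x \<in> U \<and>
      cylinder X (proj_map X x) U \<subseteq> {x \<in> tot X. proj_map X x \<in> V}"
    using openin_topspace by blast
qed simp

lemma topspace_tau [simp]:
  assumes X: "net_bundle_of_spaces X"
  shows "topspace (tau X) = tot X"
proof -
  have "openin (tau X) (tot X)" using openin_tau_over[OF X, of UNIV] by (simp add: openin_alexandroff)
  moreover have "topspace (tau X) \<subseteq> tot X" using openin_tau[OF X] openin_topspace by blast
  ultimately show ?thesis using openin_subset by blast
qed

lemma continuous_map_proj_map:
  assumes X: "net_bundle_of_spaces X"
  shows "continuous_map (tau X) alexandroff (proj_map X)"
  using openin_tau_over[OF X] by (simp add: continuous_map_def X)

section \<open>Charts of Hilbert net bundles\<close>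

definition unitary_chart :: "('k, 'e) hilbert_net \<Rightarrow> 'k \<Rightarrow> nat \<Rightarrow> ('e \<Rightarrow> nat \<Rightarrow> complex) \<Rightarrow> bool" where
  "unitary_chart E a d \<phi> \<longleftrightarrow>
     linear_map (fibre_module E a) (Cn_module d) \<phi> \<and> bij_betw \<phi> (fibre E a) (Cn d) \<and>
     (\<forall>x\<in>fibre E a. \<forall>y\<in>fibre E a. Cn_inner d (\<phi> x) (\<phi> y) = ip E x y)"

text \<open>The value of \<open>g\<close> has to be known at sums and multiples too; these stay in
  \<open>carrier M\<close> because \<open>M\<close> is a module.\<close>

lemma linear_map_cong:
  assumes "module complex_ring M" "linear_map M N f" "\<And>x. x \<in> carrier M \<Longrightarrow> g x = f x"
  shows "linear_map M N g"
proof -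
  interpret module complex_ring M by fact
  show ?thesis
    using assms(2,3) M.add.m_closed smult_closed by (simp add: linear_map_def Pi_iff)
qed

text \<open>\<open>fdist\<close> is defined by subtraction, while \<open>linear_map\<close> speaks
  of sums and multiples; this bridges the two.\<close>

lemma a_inv_eq_smult:
  assumes "module complex_ring M" "x \<in> carrier M"
  shows "\<ominus>\<^bsub>M\<^esub> x = (-1) \<odot>\<^bsub>M\<^esub> x"
proof -
  interpret module complex_ring M by fact
  have "(-1) \<odot>\<^bsub>M\<^esub> x \<oplus>\<^bsub>M\<^esub> x = (-1 + 1) \<odot>\<^bsub>M\<^esub> x"
    using smult_l_distr[of "-1" 1 x] smult_one[OF assms(2)] assms by simp
  then have "(-1) \<odot>\<^bsub>M\<^esub> x \<oplus>\<^bsub>M\<^esub> x = \<zero>\<^bsub>M\<^esub>"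
    using smult_l_null[OF assms(2)] by simp
  then show ?thesis
    using assms smult_closed[of "-1" x] by (intro M.minus_equality) auto
qed

lemma unitary_chart_dist:
  assumes "module complex_ring (fibre_module E a)" "unitary_chart E a d \<phi>"
    and x: "x \<in> fibre E a" and y: "y \<in> fibre E a"
  shows "fdist E a x y = Cn_dist d (\<phi> x) (\<phi> y)"
proof -
  interpret module complex_ring "fibre_module E a" by fact
  have lin: "linear_map (fibre_module E a) (Cn_module d) \<phi>"
    using assms(2) by (simp add: unitary_chart_def)
  define z where "z = x \<ominus>\<^bsub>fibre_module E a\<^esub> y"
  have my: "vscale E (-1) y \<in> fibre E a" using y smult_closed[of "-1" y] by simp
  have zeq: "z = vadd E x (vscale E (-1) y)"
    using a_inv_eq_smult[OF assms(1), of y] y by (simp add: z_def a_minus_def)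
  have z: "z \<in> fibre E a" using M.add.m_closed[of x "vscale E (-1) y"] x my zeq by simp
  have "\<phi> z = (\<lambda>i. \<phi> x i - \<phi> y i)"
    using linear_mapD(2)[OF lin, of x "vscale E (-1) y"] linear_mapD(3)[OF lin, of y "-1"] x y my zeq
    by simp
  moreover have "ip E z z = Cn_inner d (\<phi> z) (\<phi> z)"
    using assms(2) z by (simp add: unitary_chart_def)
  ultimately show ?thesis
    using x y unfolding fdist_def fnorm_def z_def[symmetric] Cn_dist_def
    by (simp add: Cn_inner_self)
qed

text \<open>The chart is an isometry onto \<open>Cn d\<close>, from which everything is pulled back.
  The assumptions speak of a module with a chart and not of a Hilbert fibre, so that completeness
  can also be deduced for inner products built from a bundle atlas.\<close>

lemma unitary_chart_metric:
  assumes "module complex_ring (fibre_module E a)" "unitary_chart E a d \<phi>"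
  shows "Metric_space (fibre E a) (fdist E a)"
    and "homeomorphic_map (Metric_space.mtopology (fibre E a) (fdist E a)) (Cn_top d) \<phi>"
    and "Metric_space.mcomplete (fibre E a) (fdist E a)"
proof -
  note dist = unitary_chart_dist[OF assms]
  have bij: "bij_betw \<phi> (fibre E a) (Cn d)" using assms(2) by (simp add: unitary_chart_def)
  then have im: "\<phi> x \<in> Cn d" if "x \<in> fibre E a" for x using that by (auto simp: bij_betw_def)
  have inj: "\<phi> x = \<phi> y \<longleftrightarrow> x = y" if "x \<in> fibre E a" "y \<in> fibre E a" for x y
    using bij that by (auto simp: bij_betw_def inj_on_def)
  interpret C: Metric_space "Cn d" "Cn_dist d" by (rule Metric_space_Cn)
  show ms: "Metric_space (fibre E a) (fdist E a)"
  proof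
    fix x y z
    show "0 \<le> fdist E a x y" using dist[of x y] by (cases "x \<in> fibre E a \<and> y \<in> fibre E a") (auto simp: fdist_def)
    show "fdist E a x y = fdist E a y x"
    proof (cases "x \<in> fibre E a \<and> y \<in> fibre E a")
      case True
      then show ?thesis using dist[of x y] dist[of y x] C.commute by simp
    qed (auto simp: fdist_def)
    assume x: "x \<in> fibre E a" and y: "y \<in> fibre E a"
    show "fdist E a x y = 0 \<longleftrightarrow> x = y" using dist[OF x y] inj[OF x y] im x y by simp
    assume z: "z \<in> fibre E a"
    show "fdist E a x z \<le> fdist E a x y + fdist E a y z"
      using C.triangle[of "\<phi> x" "\<phi> y" "\<phi> z"] dist im x y z by simp
  qed
  interpret Metric_space12 "fibre E a" "fdist E a" "Cn d" "Cn_dist d"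
    by (simp add: Metric_space12_def ms Metric_space_Cn)
  have "homeomorphic_map M1.mtopology C.mtopology \<phi>"
    by (rule isometry_imp_homeomorphic_map) (use bij dist in \<open>auto simp: bij_betw_def\<close>)
  then show "homeomorphic_map M1.mtopology (Cn_top d) \<phi>" by (simp add: mtopology_Cn)
  show "M1.mcomplete"
    unfolding M1.mcomplete_def
  proof (intro allI impI)
    fix \<sigma> assume s: "M1.MCauchy \<sigma>"
    then have sf: "\<sigma> n \<in> fibre E a" for n by (auto simp: M1.MCauchy_def)
    have "C.MCauchy (\<phi> \<circ> \<sigma>)"
      using s sf im unfolding C.MCauchy_def M1.MCauchy_def by (auto simp: dist)
    then obtain v where v: "limitin C.mtopology (\<phi> \<circ> \<sigma>) v sequentially"
      using mcomplete_Cn[of d] unfolding C.mcomplete_def by blast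
    then have "v \<in> Cn d" using limitin_topspace C.topspace_mtopology by metis
    then obtain x where x: "x \<in> fibre E a" "v = \<phi> x" using bij by (auto simp: bij_betw_def)
    have "limitin M1.mtopology \<sigma> x sequentially"
      using v x sf dist im unfolding M1.limit_metric_sequentially C.limit_metric_sequentially
      by simp
    then show "\<exists>x. limitin M1.mtopology \<sigma> x sequentially" by blast
  qed
qed

lemma hilbert_fibre_inner_product_module:
  "hilbert_fibre E a \<Longrightarrow> inner_product_module (fibre_module E a) (ip E)"
  unfolding hilbert_fibre_def inner_product_module_def inner_product_module_axioms_def fibre_module_simps
  by (elim conjE, intro conjI) (assumption, blast+)

lemma hilbert_net_bundleD:
  assumes "hilbert_net_bundle E"
  shows "hilbert_fibre E a"
    and "module complex_ring (fibre_module E a)"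
    and "a \<le> b \<Longrightarrow> linear_map (fibre_module E a) (fibre_module E b) (J E b a)"
    and "a \<le> b \<Longrightarrow> bij_betw (J E b a) (fibre E a) (fibre E b)"
    and "\<lbrakk>a \<le> b; x \<in> fibre E a; y \<in> fibre E a\<rbrakk> \<Longrightarrow> ip E (J E b a x) (J E b a y) = ip E x y"
    and "x \<in> fibre E a \<Longrightarrow> J E a a x = x"
    and "\<lbrakk>a \<le> b; b \<le> c; x \<in> fibre E a\<rbrakk> \<Longrightarrow> J E c b (J E b a x) = J E c a x"
    and "\<lbrakk>a \<le> b; x \<in> fibre E a\<rbrakk> \<Longrightarrow> J E b a x \<in> fibre E b"
proof -
  show hf: "hilbert_fibre E a" for a using assms by (simp add: hilbert_net_bundle_def)
  show "module complex_ring (fibre_module E a)"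
    by (rule conjunct1[OF iffD1[OF hilbert_fibre_def hf]])
  show "x \<in> fibre E a \<Longrightarrow> J E a a x = x"
    and "\<lbrakk>a \<le> b; b \<le> c; x \<in> fibre E a\<rbrakk> \<Longrightarrow> J E c b (J E b a x) = J E c a x"
    and "a \<le> b \<Longrightarrow> linear_map (fibre_module E a) (fibre_module E b) (J E b a)"
    and "\<lbrakk>a \<le> b; x \<in> fibre E a; y \<in> fibre E a\<rbrakk> \<Longrightarrow> ip E (J E b a x) (J E b a y) = ip E x y"
    using assms by (simp_all add: hilbert_net_bundle_def)
  show bij: "a \<le> b \<Longrightarrow> bij_betw (J E b a) (fibre E a) (fibre E b)"
    using assms by (simp add: hilbert_net_bundle_def)
  show "\<lbrakk>a \<le> b; x \<in> fibre E a\<rbrakk> \<Longrightarrow> J E b a x \<in> fibre E b"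
    using bij by (auto simp: bij_betw_def)
qed

lemma V_netD:
  assumes "E \<in> Ob V_net"
  shows "hilbert_net_bundle E" and "finite_dim (fibre_module E a)"
  using assms by (simp_all add: V_net_def)

lemma unitary_chart_exists:
  assumes "E \<in> Ob V_net"
  obtains d \<phi> where "unitary_chart E a d \<phi>"
proof -
  interpret inner_product_module "fibre_module E a" "ip E"
    using hilbert_net_bundleD(1) V_netD(1) assms by (blast intro: hilbert_fibre_inner_product_module)
  show ?thesis
    using unitary_coordinates_exist[OF V_netD(2)[OF assms]] that by (auto simp: unitary_chart_def)
qed

lemma unitary_chart_J:
  assumes E: "hilbert_net_bundle E" and ab: "a \<le> b" and \<psi>: "unitary_chart E b d \<psi>"
  shows "unitary_chart E a d (\<lambda>x. \<psi> (J E b a x))"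
proof -
  note D = hilbert_net_bundleD[OF E]
  have "linear_map (fibre_module E a) (Cn_module d) (\<lambda>x. \<psi> (J E b a x))"
    using linear_map_compose[OF D(3)[OF ab], of "Cn_module d" \<psi>] \<psi> by (simp add: unitary_chart_def)
  moreover have "bij_betw (\<lambda>x. \<psi> (J E b a x)) (fibre E a) (Cn d)"
    using bij_betw_trans[OF D(4)[OF ab], of \<psi> "Cn d"] \<psi> by (simp add: unitary_chart_def o_def)
  ultimately show ?thesis
    using \<psi> D(5)[OF ab] D(8)[OF ab] by (simp add: unitary_chart_def)
qed

text \<open>Every element of the fibre over \<open>b\<close> is \<open>J E b a x\<close> for some
  \<open>x\<close>, so \<open>eq\<close> forces \<open>\<psi>\<close> to be \<open>\<phi>\<close>
  composed with the inverse of \<open>J E b a\<close>, a composite of unitaries.\<close>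

lemma unitary_chart_pushforward:
  assumes E: "hilbert_net_bundle E" and ab: "a \<le> b" and \<phi>: "unitary_chart E a d \<phi>"
    and eq: "\<And>x. x \<in> fibre E a \<Longrightarrow> \<psi> (J E b a x) = \<phi> x"
  shows "unitary_chart E b d \<psi>"
proof -
  note D = hilbert_net_bundleD[OF E]
  define g where "g = inv_into (fibre E a) (J E b a)"
  have g: "g y \<in> fibre E a" "J E b a (g y) = y" if "y \<in> fibre E b" for y
    using D(4)[OF ab] that by (auto simp: g_def bij_betw_def inv_into_into f_inv_into_f)
  have \<psi>: "\<psi> y = \<phi> (g y)" if "y \<in> fibre E b" for y using eq g that by metis
  have lin: "linear_map (fibre_module E b) (fibre_module E a) g"
    using linear_map_inv_into[OF D(2) D(3)[OF ab]] D(4)[OF ab] by (simp add: g_def)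
  have "linear_map (fibre_module E b) (Cn_module d) \<psi>"
  proof (rule linear_map_cong[OF D(2)])
    show "linear_map (fibre_module E b) (Cn_module d) (\<lambda>y. \<phi> (g y))"
      using linear_map_compose[OF lin, of "Cn_module d" \<phi>] \<phi> by (simp add: unitary_chart_def)
  qed (simp add: \<psi>)
  moreover have "bij_betw \<psi> (fibre E b) (Cn d)"
  proof -
    have "bij_betw g (fibre E b) (fibre E a)"
      unfolding g_def by (rule bij_betw_inv_into[OF D(4)[OF ab]])
    then have "bij_betw (\<phi> \<circ> g) (fibre E b) (Cn d)"
      using \<phi> by (auto simp: unitary_chart_def intro: bij_betw_trans)
    then show ?thesis by (subst bij_betw_cong[of _ _ "\<phi> \<circ> g"]) (simp_all add: \<psi>)
  qed
  moreover have "Cn_inner d (\<psi> x) (\<psi> y) = ip E x y" if "x \<in> fibre E b" "y \<in> fibre E b" for x y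
    using \<phi> g that D(5)[OF ab, of "g x" "g y"] by (simp add: \<psi> unitary_chart_def)
  ultimately show ?thesis by (simp add: unitary_chart_def)
qed

text \<open>With \<open>\<psi>\<close> on the fibre over \<open>b\<close> and its pullback along
  \<open>J\<close> on the fibre over \<open>a\<close>, both distances are the same distance in
  \<open>Cn d\<close>.\<close>

lemma fdist_J:
  assumes E: "E \<in> Ob V_net" and ab: "a \<le> b" and "x \<in> fibre E a" "y \<in> fibre E a"
  shows "fdist E b (J E b a x) (J E b a y) = fdist E a x y"
proof -
  note D = hilbert_net_bundleD[OF V_netD(1)[OF E]]
  obtain d \<psi> where \<psi>: "unitary_chart E b d \<psi>" using unitary_chart_exists[OF E] .
  show ?thesis
    using unitary_chart_dist[OF D(2) \<psi>] assms D(8)[OF ab]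
      unitary_chart_dist[OF D(2) unitary_chart_J[OF V_netD(1)[OF E] ab \<psi>]] by simp
qed

lemma Metric_space_fdist:
  assumes E: "E \<in> Ob V_net"
  shows "Metric_space (fibre E a) (fdist E a)"
  using unitary_chart_exists[OF E] unitary_chart_metric(1) hilbert_net_bundleD(2)[OF V_netD(1)[OF E]]
  by metis

lemma net_space_of_simps [simp]:
  "tot (net_space_of E) = total E" "proj_map (net_space_of E) = prj E"
  "ftop (net_space_of E) a = Metric_space.mtopology (fibre E a) (fdist E a)" "tr (net_space_of E) = J E"
  by (simp_all add: net_space_of_def)

text \<open>The maps \<open>J\<close> are isometric bijections, hence homeomorphisms; the general
  facts about \<open>tau\<close> thereby apply to Hilbert nets.\<close>

lemma net_bundle_net_space_of:
  assumes E: "E \<in> Ob V_net"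
  shows "net_bundle_of_spaces (net_space_of E)"
proof -
  note D = hilbert_net_bundleD[OF V_netD(1)[OF E]]
  note M = Metric_space_fdist[OF E]
  have top: "topspace (Metric_space.mtopology (fibre E a) (fdist E a)) = fibre E a" for a
    by (rule Metric_space.topspace_mtopology[OF M])
  show ?thesis
    unfolding net_bundle_of_spaces_def net_space_of_simps top
  proof (intro conjI allI impI ballI)
    show "prj E ` total E = UNIV" using V_netD(1)[OF E] by (simp add: hilbert_net_bundle_def)
    show "fibre E a = {x \<in> total E. prj E x = a}" for a by (simp add: fibre_def)
    fix a b :: 'a assume ab: "a \<le> b"
    interpret Metric_space12 "fibre E a" "fdist E a" "fibre E b" "fdist E b"
      by (simp add: Metric_space12_def M)
    show "homeomorphic_map M1.mtopology M2.mtopology (J E b a)"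
      by (rule isometry_imp_homeomorphic_map)
        (use D(4)[OF ab] fdist_J[OF E ab] in \<open>auto simp: bij_betw_def\<close>)
  qed (auto simp: D(6,7))
qed

section \<open>Charts constant along the transport maps\<close>

text \<open>Formulated at every point above \<open>a\<close>, so that the base point can be raised
  without further argument; \<open>flat_chartI\<close> recovers this from the conditions in
  \<open>tau_atlas\<close>, which concern transport out of \<open>a\<close>.\<close>

definition flat_chart :: "('k::order, 'e) hilbert_net \<Rightarrow> 'k \<Rightarrow> nat \<Rightarrow> ('e \<Rightarrow> nat \<Rightarrow> complex) \<Rightarrow> bool" where
  "flat_chart E a d \<phi> \<longleftrightarrow>
     (\<forall>b\<ge>a. unitary_chart E b d \<phi>) \<and> (\<forall>b\<ge>a. \<forall>c\<ge>b. \<forall>x\<in>fibre E b. \<phi> (J E c b x) = \<phi> x)"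

lemma flat_chart_mono: "flat_chart E a d \<phi> \<Longrightarrow> a \<le> b \<Longrightarrow> flat_chart E b d \<phi>"
  unfolding flat_chart_def by (meson order_trans)

text \<open>An element over \<open>b\<close> comes from some \<open>u\<close> over \<open>a\<close>;
  transporting it further is transporting \<open>u\<close> directly, and both values of
  \<open>\<phi>\<close> equal \<open>\<phi> u\<close>.\<close>

lemma flat_chartI:
  assumes E: "hilbert_net_bundle E" and \<phi>: "unitary_chart E a d \<phi>"
    and eq: "\<And>b x. a \<le> b \<Longrightarrow> x \<in> fibre E a \<Longrightarrow> \<phi> (J E b a x) = \<phi> x"
  shows "flat_chart E a d \<phi>"
  unfolding flat_chart_def
proof (intro conjI allI impI ballI)
  note D = hilbert_net_bundleD[OF E]
  fix b assume ab: "a \<le> b"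
  show "unitary_chart E b d \<phi>"
    using unitary_chart_pushforward[OF E ab \<phi>] eq[OF ab] .
  fix c x assume bc: "b \<le> c" and x: "x \<in> fibre E b"
  obtain u where u: "u \<in> fibre E a" "x = J E b a u"
    using D(4)[OF ab] x by (auto simp: bij_betw_def)
  then show "\<phi> (J E c b x) = \<phi> x"
    using D(7)[OF ab bc u(1)] eq ab bc order_trans[OF ab bc] by simp
qed

lemma tau_atlas_iff:
  assumes E: "hilbert_net_bundle E"
  shows "(U, \<phi>) \<in> tau_atlas E \<longleftrightarrow> (\<exists>a d. U = {a..} \<and> flat_chart E a d \<phi>)"
proof
  assume "(U, \<phi>) \<in> tau_atlas E"
  then obtain a d where "U = {a..}" "unitary_chart E a d \<phi>"
    "\<And>b x. a \<le> b \<Longrightarrow> x \<in> fibre E a \<Longrightarrow> \<phi> (J E b a x) = \<phi> x"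
    by (auto simp: tau_atlas_def unitary_chart_def)
  then show "\<exists>a d. U = {a..} \<and> flat_chart E a d \<phi>" using flat_chartI[OF E] by blast
next
  assume "\<exists>a d. U = {a..} \<and> flat_chart E a d \<phi>"
  then obtain a d where U: "U = {a..}" and f: "flat_chart E a d \<phi>" by blast
  have "unitary_chart E a d \<phi>" "\<forall>b\<ge>a. \<forall>x\<in>fibre E a. \<phi> (J E b a x) = \<phi> x"
    using f by (auto simp: flat_chart_def)
  then show "(U, \<phi>) \<in> tau_atlas E"
    unfolding tau_atlas_def unitary_chart_def U by blast
qed

lemma flat_chart_exists:
  assumes E: "E \<in> Ob V_net"
  obtains d \<phi> where "flat_chart E a d \<phi>"
proof -
  note D = hilbert_net_bundleD[OF V_netD(1)[OF E]]
  obtain d \<phi> where \<phi>: "unitary_chart E a d \<phi>" using unitary_chart_exists[OF E] .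
  \<comment> \<open>Transport back to the fibre over \<open>a\<close>, then take coordinates. This
    is meaningful over points above \<open>a\<close>; elsewhere the values are arbitrary.\<close>
  define \<psi> where "\<psi> e = \<phi> (inv_into (fibre E a) (J E (prj E e) a) e)" for e
  have eq: "\<psi> (J E b a x) = \<phi> x" if "a \<le> b" "x \<in> fibre E a" for b x
    using D(4)[OF that(1)] D(8)[OF that] that(2)
    by (simp add: \<psi>_def fibre_def[of E b] bij_betw_def inv_into_f_f)
  have eq': "\<psi> x = \<phi> x" if "x \<in> fibre E a" for x
    using eq[OF order_refl that] D(6)[OF that] by simp
  \<comment> \<open>Pushing forward along \<open>J E a a\<close>, the identity of the fibre,
    exchanges \<open>\<phi>\<close> for \<open>\<psi>\<close>.\<close>
  have "unitary_chart E a d \<psi>"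
    by (rule unitary_chart_pushforward[OF V_netD(1)[OF E] order_refl \<phi>]) (simp add: eq)
  then have "flat_chart E a d \<psi>"
    using eq eq' by (intro flat_chartI[OF V_netD(1)[OF E]]) auto
  then show ?thesis using that by blast
qed

lemma unitary_chart_dim:
  assumes "module complex_ring (fibre_module E a)" "unitary_chart E a d \<phi>" "unitary_chart E a d' \<psi>"
  shows "d = d'"
proof -
  define g where "g = inv_into (fibre E a) \<phi>"
  have bij: "bij_betw \<phi> (fibre E a) (Cn d)" and bij': "bij_betw \<psi> (fibre E a) (Cn d')"
    using assms by (simp_all add: unitary_chart_def)
  have g: "g v \<in> fibre E a" "\<phi> (g v) = v" if "v \<in> Cn d" for v
    using bij that by (auto simp: g_def bij_betw_def inv_into_into f_inv_into_f)
  have "linear_map (Cn_module d) (fibre_module E a) g"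
    using linear_map_inv_into[OF assms(1), of "Cn_module d" \<phi>] assms(2) by (simp add: unitary_chart_def g_def)
  then have "linear_map (Cn_module d) (Cn_module d') (\<lambda>v. \<psi> (g v))"
    using linear_map_compose assms(3) by (auto simp: unitary_chart_def)
  moreover have "bij_betw (\<lambda>v. \<psi> (g v)) (Cn d) (Cn d')"
    using bij_betw_trans[OF bij_betw_inv_into[OF bij] bij'] by (simp add: g_def o_def)
  moreover have "Cn_inner d' (\<psi> (g v)) (\<psi> (g w)) = Cn_inner d v w" if "v \<in> Cn d" "w \<in> Cn d" for v w
    using assms(2,3) g that unfolding unitary_chart_def by metis
  ultimately show ?thesis by (rule unitary_dim_unique)
qed

text \<open>Flat charts at two comparable points both restrict to the fibre over the larger one,
  where their ranks agree; a chain of comparable points carries the equality from \<open>a\<close>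
  to \<open>b\<close>. Connectedness enters the development here.\<close>

lemma flat_chart_dim:
  assumes conn: "pathwise_connected (UNIV :: 'k::order set)" and E: "(E :: ('k, 'e) hilbert_net) \<in> Ob V_net"
    and "flat_chart E a d \<phi>" "flat_chart E b d' \<psi>"
  shows "d = d'"
proof -
  note M = hilbert_net_bundleD(2)[OF V_netD(1)[OF E]]
  have uc: "flat_chart E a d \<phi> \<Longrightarrow> a \<le> b \<Longrightarrow> unitary_chart E b d \<phi>" for a b d \<phi>
    by (simp add: flat_chart_def)
  have "(\<lambda>x y. x \<in> UNIV \<and> y \<in> UNIV \<and> (x \<le> y \<or> y \<le> x))\<^sup>*\<^sup>* a b"
    using conn by (simp add: pathwise_connected_def)
  then have "\<forall>d' \<psi>. flat_chart E b d' \<psi> \<longrightarrow> d = d'"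
  proof induction
    case base
    then show ?case using unitary_chart_dim[OF M uc uc] assms(3) by blast
  next
    case (step b c)
    obtain d'' \<rho> where "flat_chart E b d'' \<rho>" using flat_chart_exists[OF E] .
    then show ?case using step unitary_chart_dim[OF M uc uc] by (metis order_refl)
  qed
  then show ?thesis using assms(4) by blast
qed

lemma fibre_tau_bundle [simp]:
  "fibre_module (tau_bundle E) a = fibre_module E a" "fibre (tau_bundle E) a = fibre E a"
  "over (tau_bundle E) U = over E U"
  "total (tau_bundle E) = total E" "prj (tau_bundle E) = prj E" "vtop (tau_bundle E) = tau (net_space_of E)"
  by (simp_all add: fibre_module_def fibre_def over_def tau_bundle_def fun_eq_iff)

lemma fibre_tau_lc_bundle [simp]:
  "fibre_module (tau_lc_bundle E) a = fibre_module E a" "fibre (tau_lc_bundle E) a = fibre E a"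
  "over (tau_lc_bundle E) U = over E U"
  "total (tau_lc_bundle E) = total E" "prj (tau_lc_bundle E) = prj E"
  "vtop (tau_lc_bundle E) = tau (net_space_of E)" "atlas (tau_lc_bundle E) = tau_atlas E"
  by (simp_all add: fibre_module_def fibre_def over_def tau_lc_bundle_def tau_bundle_def
      vbundle.extend_def lc_vbundle.fields_def fun_eq_iff)

text \<open>Being constant along transport, the chart turns the cylinder with base \<open>U\<close>
  over \<open>b\<close> into the product of \<open>{b..}\<close> with the image of \<open>U\<close>.
  Such cylinders and such products are bases of the two topologies, which gives continuity as well
  as openness.\<close>

lemma flat_chart_homeomorphic_map:
  assumes E: "E \<in> Ob V_net" and \<phi>: "flat_chart E a d \<phi>"
  shows "homeomorphic_map (subtopology (tau (net_space_of E)) (over E {a..}))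
       (prod_topology (subtopology alexandroff {a..}) (Cn_top d)) (\<lambda>e. (prj E e, \<phi> e))"
    (is "homeomorphic_map (subtopology ?T ?S) (prod_topology ?A _) ?h")
proof -
  note D = hilbert_net_bundleD[OF V_netD(1)[OF E]]
  note X = net_bundle_net_space_of[OF E]
  have uc: "unitary_chart E b d \<phi>" if "a \<le> b" for b using \<phi> that by (simp add: flat_chart_def)
  have homeo: "homeomorphic_map (Metric_space.mtopology (fibre E b) (fdist E b)) (Cn_top d) \<phi>"
    if "a \<le> b" for b using unitary_chart_metric(2)[OF D(2) uc[OF that]] .
  have bij: "bij_betw \<phi> (fibre E b) (Cn d)" if "a \<le> b" for b
    using uc[OF that] by (simp add: unitary_chart_def)
  have mtop: "topspace (Metric_space.mtopology (fibre E b) (fdist E b)) = fibre E b" for b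
    by (rule Metric_space.topspace_mtopology[OF Metric_space_fdist[OF E]])
  have S: "openin ?T ?S" using openin_tau_over[OF X, of "{a..}"] by (simp add: over_def)
  have topS: "topspace (subtopology ?T ?S) = ?S" using openin_subset[OF S] by (auto simp: X)
  have eS: "a \<le> prj E e" "e \<in> fibre E (prj E e)" "e \<in> total E" if "e \<in> ?S" for e
    using that by (auto simp: over_def fibre_def)
  have \<phi>C: "\<phi> e \<in> Cn d" if "e \<in> ?S" for e
    using bij_betwE[OF bij[OF eS(1)[OF that]]] eS(2)[OF that] by simp
  have fS: "e \<in> ?S" "prj E e = b" if "e \<in> fibre E b" "a \<le> b" for e b
    using that by (auto simp: over_def fibre_def)
  show ?thesis
  proof (rule bijective_open_imp_homeomorphic_map)
    show "continuous_map (subtopology ?T ?S) (prod_topology ?A (Cn_top d)) ?h"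
    proof (rule continuous_map_pairedI)
      show "continuous_map (subtopology ?T ?S) ?A (prj E)"
        using continuous_map_proj_map[OF X] eS
        by (intro continuous_map_into_subtopology continuous_map_from_subtopology) (auto simp: X)
      show "continuous_map (subtopology ?T ?S) (Cn_top d) \<phi>"
        unfolding continuous_map_def topS
      proof (intro conjI allI impI)
        show "\<phi> \<in> ?S \<rightarrow> topspace (Cn_top d)"
          using \<phi>C by simp
        fix V assume V: "openin (Cn_top d) V"
        have "openin ?T {e \<in> ?S. \<phi> e \<in> V}"
          unfolding openin_tau[OF X] net_space_of_simps
        proof (intro conjI ballI)
          show "{e \<in> ?S. \<phi> e \<in> V} \<subseteq> total E" by (auto simp: over_def)
          fix e assume e: "e \<in> {e \<in> ?S. \<phi> e \<in> V}"
          \<comment> \<open>Flatness keeps the value of the chart along the cylinder, so an open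
            piece of the single fibre through \<open>e\<close> suffices.\<close>
          let ?b = "prj E e" and ?U = "{x \<in> fibre E (prj E e). \<phi> x \<in> V}"
          have ab: "a \<le> ?b" using e eS by auto
          have "openin (Metric_space.mtopology (fibre E ?b) (fdist E ?b)) ?U"
            using openin_continuous_map_preimage[OF homeomorphic_imp_continuous_map[OF homeo[OF ab]] V]
            by (simp add: mtop)
          moreover have "cylinder (net_space_of E) ?b ?U \<subseteq> {e \<in> ?S. \<phi> e \<in> V}"
          proof
            fix y assume "y \<in> cylinder (net_space_of E) ?b ?U"
            then obtain c x where c: "?b \<le> c" and x: "x \<in> fibre E ?b" "\<phi> x \<in> V" and y: "y = J E c ?b x"
              by (auto simp: cylinder_def)
            have "\<phi> y = \<phi> x" using \<phi> ab c x y by (simp add: flat_chart_def)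
            then show "y \<in> {e \<in> ?S. \<phi> e \<in> V}"
              using fS(1)[OF D(8)[OF c x(1)]] order_trans[OF ab c] x y by simp
          qed
          ultimately show "\<exists>U. openin (Metric_space.mtopology (fibre E ?b) (fdist E ?b)) U \<and> e \<in> U \<and>
              cylinder (net_space_of E) ?b U \<subseteq> {e \<in> ?S. \<phi> e \<in> V}"
            using e eS by (intro exI[of _ ?U]) auto
        qed
        then show "openin (subtopology ?T ?S) {e \<in> ?S. \<phi> e \<in> V}"
          by (subst openin_open_subtopology[OF S]) auto
      qed
    qed
    show "open_map (subtopology ?T ?S) (prod_topology ?A (Cn_top d)) ?h"
      unfolding open_map_def
    proof (intro allI impI)
      fix W assume "openin (subtopology ?T ?S) W"
      then have W: "openin ?T W" "W \<subseteq> ?S" using openin_open_subtopology[OF S] by auto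
      show "openin (prod_topology ?A (Cn_top d)) (?h ` W)"
        unfolding openin_prod_topology_alt
      proof (intro allI impI)
        fix b v assume "(b, v) \<in> ?h ` W"
        then obtain e where e: "e \<in> W" "b = prj E e" "v = \<phi> e" by auto
        obtain U where U: "openin (Metric_space.mtopology (fibre E b) (fdist E b)) U" "e \<in> U"
            "cylinder (net_space_of E) b U \<subseteq> W"
          using W(1) e(1,2) unfolding openin_tau[OF X] net_space_of_simps by blast
        have ab: "a \<le> b" using W(2) e eS by auto
        have UF: "U \<subseteq> fibre E b" using openin_subset[OF U(1)] mtop by simp
        have "openin ?A {b..}"
          using ab by (subst openin_open_subtopology) auto
        moreover have "openin (Cn_top d) (\<phi> ` U)"
          using homeomorphic_imp_open_map[OF homeo[OF ab]] U(1) by (simp add: open_map_def)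
        \<comment> \<open>Every point \<open>(c, \<phi> u)\<close> of the box is the image of the
          transported vector \<open>J E c b u\<close>.\<close>
        moreover have "{b..} \<times> \<phi> ` U \<subseteq> ?h ` W"
        proof clarify
          fix c u assume c: "b \<le> c" and u: "u \<in> U"
          have "J E c b u \<in> cylinder (net_space_of E) b U" using c u by (auto simp: cylinder_def)
          moreover have "?h (J E c b u) = (c, \<phi> u)"
            using \<phi> ab c u UF D(8)[OF c] by (auto simp: flat_chart_def fibre_def[of E c])
          ultimately show "(c, \<phi> u) \<in> ?h ` W"
            using U(3) by (intro image_eqI[where x = "J E c b u"]) auto
        qed
        ultimately show "\<exists>U V. openin ?A U \<and> openin (Cn_top d) V \<and> b \<in> U \<and> v \<in> V \<and> U \<times> V \<subseteq> ?h ` W"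
          using e U(2) by (intro exI[of _ "{b..}"] exI[of _ "\<phi> ` U"] conjI) auto
      qed
    qed
    show "?h ` topspace (subtopology ?T ?S) = topspace (prod_topology ?A (Cn_top d))"
      unfolding topS
    proof (intro equalityI subsetI)
      fix p assume "p \<in> ?h ` ?S"
      then show "p \<in> topspace (prod_topology ?A (Cn_top d))"
        using eS(1) \<phi>C by auto
    next
      fix p assume "p \<in> topspace (prod_topology ?A (Cn_top d))"
      then obtain b v where p: "p = (b, v)" "a \<le> b" "v \<in> Cn d" by auto
      then obtain e where "e \<in> fibre E b" "v = \<phi> e" using bij by (auto simp: bij_betw_def)
      then show "p \<in> ?h ` ?S" using fS[of e b] p by auto
    qed
    show "inj_on ?h (topspace (subtopology ?T ?S))"
      unfolding topS
    proof (rule inj_onI)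
      fix x y assume xy: "x \<in> ?S" "y \<in> ?S" "?h x = ?h y"
      then show "x = y"
        using inj_onD[OF bij_betw_imp_inj_on[OF bij[OF eS(1)[OF xy(1)]]], of x y]
          eS(2)[OF xy(1)] eS(2)[OF xy(2)] by simp
    qed
  qed
qed

section \<open>Morphisms of bundles\<close>

lemma fibrewise_linearD:
  assumes "fibrewise_linear F F' f"
  shows "f \<in> extensional (total F)" and "e \<in> total F \<Longrightarrow> f e \<in> total F'"
    and "e \<in> total F \<Longrightarrow> prj F' (f e) = prj F e"
    and "e \<in> total F \<Longrightarrow> linear_map (fibre_module F (prj F e)) (fibre_module F' (prj F e)) f"
    and "e \<in> fibre F b \<Longrightarrow> f e \<in> fibre F' b"
    and "e \<in> fibre F b \<Longrightarrow> linear_map (fibre_module F b) (fibre_module F' b) f"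
proof -
  show "f \<in> extensional (total F)" and "e \<in> total F \<Longrightarrow> f e \<in> total F'"
    and lin: "e \<in> total F \<Longrightarrow> linear_map (fibre_module F (prj F e)) (fibre_module F' (prj F e)) f" for e
    using assms by (auto simp: fibrewise_linear_def)
  then show lin': "e \<in> fibre F b \<Longrightarrow> linear_map (fibre_module F b) (fibre_module F' b) f" for e
    by (auto simp: fibre_def)
  show fib: "e \<in> fibre F b \<Longrightarrow> f e \<in> fibre F' b" for e b
    using linear_mapD(1)[OF lin, of e e] by (auto simp: fibre_def)
  show "e \<in> total F \<Longrightarrow> prj F' (f e) = prj F e"
    using fib[of e "prj F e"] by (simp add: fibre_def)
qed

text \<open>Source and target are kept apart because the unit and counit of the equivalence are
  identity functions between objects with the same fibres but different further structure.\<close>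

lemma fibrewise_linear_ident:
  assumes "\<And>b. b \<in> prj F ` total F \<Longrightarrow> module complex_ring (fibre_module F b)"
    and "total F' = total F" "\<And>b. fibre_module F' b = fibre_module F b"
  shows "fibrewise_linear F F' (restrict (\<lambda>e. e) (total F))"
  unfolding fibrewise_linear_def
proof (intro conjI ballI)
  fix b assume b: "b \<in> prj F ` total F"
  have "linear_map (fibre_module F b) (fibre_module F b) (\<lambda>e. e)"
    by (simp add: linear_map_def)
  then show "linear_map (fibre_module F b) (fibre_module F' b) (restrict (\<lambda>e. e) (total F))"
    unfolding assms(3) by (rule linear_map_cong[OF assms(1)[OF b]]) (simp add: fibre_def)
qed (use assms in auto)

lemma fibrewise_linear_compose:
  assumes "\<And>b. b \<in> prj F ` total F \<Longrightarrow> module complex_ring (fibre_module F b)"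
    and f: "fibrewise_linear F F' f" and g: "fibrewise_linear F' F'' g"
  shows "fibrewise_linear F F'' (compose (total F) g f)"
  unfolding fibrewise_linear_def
proof (intro conjI ballI)
  show "compose (total F) g f \<in> extensional (total F)" by simp
  show "compose (total F) g f \<in> total F \<rightarrow> total F''"
    using fibrewise_linearD(2)[OF f] fibrewise_linearD(2)[OF g] by (simp add: compose_def)
  fix b assume b: "b \<in> prj F ` total F"
  then obtain e where e: "e \<in> fibre F b" by (auto simp: fibre_def)
  have "linear_map (fibre_module F b) (fibre_module F'' b) (\<lambda>x. g (f x))"
    using linear_map_compose[OF fibrewise_linearD(6)[OF f e] fibrewise_linearD(6)[OF g]]
      fibrewise_linearD(5)[OF f e] by simp
  then show "linear_map (fibre_module F b) (fibre_module F'' b) (compose (total F) g f)"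
    by (rule linear_map_cong[OF assms(1)[OF b]]) (simp add: fibre_def compose_def)
qed

text \<open>The categories of bundles and of nets all compose extensional functions in the same way,
  so unit and associativity laws are settled once and closure remains for each.\<close>

lemma is_category_compose:
  assumes "\<And>A. A \<in> O' \<Longrightarrow> restrict (\<lambda>e. e) (T A) \<in> H A A"
    and "\<And>A B f. \<lbrakk>A \<in> O'; B \<in> O'; f \<in> H A B\<rbrakk> \<Longrightarrow> f \<in> extensional (T A) \<inter> (T A \<rightarrow> T B)"
    and "\<And>A B D f g. \<lbrakk>A \<in> O'; B \<in> O'; D \<in> O'; f \<in> H A B; g \<in> H B D\<rbrakk> \<Longrightarrow> compose (T A) g f \<in> H A D"
  shows "is_category \<lparr>Ob = O', Hom = H, ident = (\<lambda>A. restrict (\<lambda>e. e) (T A)),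
      comp = (\<lambda>A A' A'' g f. compose (T A) g f)\<rparr>"
  unfolding is_category_def category.simps
proof (intro conjI ballI)
  fix A B D E f g h
  assume A: "A \<in> O'" and B: "B \<in> O'" and f: "f \<in> H A B"
  show "compose (T A) f (restrict (\<lambda>e. e) (T A)) = f"
    using assms(2)[OF A B f] by (intro compose_Id) auto
  show "compose (T A) (restrict (\<lambda>e. e) (T B)) f = f"
    using assms(2)[OF A B f] by (intro Id_compose) auto
  show "compose (T A) (compose (T B) h g) f = compose (T A) h (compose (T A) g f)"
    using assms(2)[OF A B f] by (intro compose_assoc[symmetric]) auto
qed (use assms in auto)

lemma vector_bundleD:
  assumes "vector_bundle Y F"
  shows "topspace (vtop F) = total F" and "continuous_map (vtop F) Y (prj F)"
    and "y \<in> topspace Y \<Longrightarrow> module complex_ring (fibre_module F y)"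
    and "y \<in> prj F ` total F \<Longrightarrow> module complex_ring (fibre_module F y)"
    and "openin Y W \<Longrightarrow> openin (vtop F) (over F W)"
proof -
  show top: "topspace (vtop F) = total F" and cont: "continuous_map (vtop F) Y (prj F)"
    and mod: "y \<in> topspace Y \<Longrightarrow> module complex_ring (fibre_module F y)" for y
    using assms by (auto simp: vector_bundle_def)
  show "y \<in> prj F ` total F \<Longrightarrow> module complex_ring (fibre_module F y)"
    using mod cont top by (auto simp: continuous_map_def)
  show "openin Y W \<Longrightarrow> openin (vtop F) (over F W)"
    using openin_continuous_map_preimage[OF cont, of W] top by (simp add: over_def)
qed

text \<open>The fibre over \<open>y\<close> is exactly what the trivialization sends onto
  \<open>{y} \<times> Cn d\<close>.\<close>

lemma local_trivialization_bij:
  assumes "topspace (vtop F) = total F" "local_trivialization Y F d U \<phi>" "y \<in> U"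
  shows "bij_betw \<phi> (fibre F y) (Cn d)"
proof -
  have U: "U \<subseteq> topspace Y" using assms(2) openin_subset by (auto simp: local_trivialization_def)
  have h: "homeomorphic_map (subtopology (vtop F) (over F U))
       (prod_topology (subtopology Y U) (Cn_top d)) (\<lambda>e. (prj F e, \<phi> e))"
    using assms(2) by (simp add: local_trivialization_def)
  have top: "topspace (subtopology (vtop F) (over F U)) = over F U"
    using assms(1) by (auto simp: over_def)
  have inj: "inj_on (\<lambda>e. (prj F e, \<phi> e)) (over F U)"
    using homeomorphic_imp_injective_map[OF h] top by simp
  have surj: "(\<lambda>e. (prj F e, \<phi> e)) ` over F U = U \<times> Cn d"
    using homeomorphic_imp_surjective_map[OF h] top U by (simp add: inf_absorb2)
  have fib: "e \<in> over F U \<and> prj F e = y \<longleftrightarrow> e \<in> fibre F y" for e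
    using assms(3) by (auto simp: over_def fibre_def)
  show ?thesis
    unfolding bij_betw_def
  proof
    show "inj_on \<phi> (fibre F y)"
      using inj fib unfolding inj_on_def by (metis (no_types, lifting))
    show "\<phi> ` fibre F y = Cn d"
    proof (intro equalityI subsetI)
      fix v assume "v \<in> \<phi> ` fibre F y"
      then obtain e where e: "e \<in> over F U" "v = \<phi> e" using fib by blast
      then have "(prj F e, \<phi> e) \<in> U \<times> Cn d" using surj by blast
      then show "v \<in> Cn d" using e by simp
    next
      fix v assume "v \<in> Cn d"
      then have "(y, v) \<in> (\<lambda>e. (prj F e, \<phi> e)) ` over F U" using surj assms(3) by simp
      then show "v \<in> \<phi> ` fibre F y" using fib by auto
    qed
  qed
qed

text \<open>A fibre has image exactly \<open>Cn d\<close>, and this set determines \<open>d\<close>.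
  Two morphisms that meet in one chart name its rank separately; this makes the numbers
  equal.\<close>

lemma local_trivialization_dim:
  assumes "topspace (vtop F) = total F" "local_trivialization Y F d U \<phi>"
    "local_trivialization Y F d' U \<phi>" "y \<in> U"
  shows "d = d'"
  using local_trivialization_bij[OF assms(1,2,4)] local_trivialization_bij[OF assms(1,3,4)]
  by (simp add: bij_betw_def flip: Cn_eq_iff)

text \<open>In the given trivializations \<open>f\<close> is \<open>id \<times> t\<close>, and \<open>t\<close> is continuous since \<open>\<complex>\<^sup>d\<close> is
  finite-dimensional.\<close>

lemma locally_constant_imp_continuous_map:
  assumes F: "vector_bundle Y F" and F': "vector_bundle Y F'"
    and \<phi>: "local_trivialization Y F d U \<phi>" and \<psi>: "local_trivialization Y F' d' V \<psi>"
    and W: "W \<subseteq> U \<inter> V" and t: "linear_map (Cn_module d) (Cn_module d') t"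
    and f: "fibrewise_linear F F' f" and ft: "\<And>e. e \<in> over F W \<Longrightarrow> \<psi> (f e) = t (\<phi> e)"
  shows "continuous_map (subtopology (vtop F) (over F W)) (vtop F') f"
proof -
  let ?S = "subtopology (vtop F) (over F W)"
  let ?S' = "subtopology (vtop F') (over F' V)"
  note fD = fibrewise_linearD[OF f]
  have hU: "homeomorphic_map (subtopology (vtop F) (over F U))
       (prod_topology (subtopology Y U) (Cn_top d)) (\<lambda>e. (prj F e, \<phi> e))"
    using \<phi> by (simp add: local_trivialization_def)
  have "homeomorphic_map ?S' (prod_topology (subtopology Y V) (Cn_top d')) (\<lambda>e. (prj F' e, \<psi> e))"
    using \<psi> by (simp add: local_trivialization_def)
  then obtain k where k: "homeomorphic_maps ?S' (prod_topology (subtopology Y V) (Cn_top d'))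
      (\<lambda>e. (prj F' e, \<psi> e)) k"
    by (auto simp: homeomorphic_map_maps)
  have topS: "topspace ?S = over F W" "topspace ?S' = over F' V"
    using vector_bundleD(1)[OF F] vector_bundleD(1)[OF F'] by (auto simp: over_def)
  have WU: "over F W \<subseteq> over F U" using W by (auto simp: over_def)
  have "continuous_map (subtopology (vtop F) (over F U)) (Cn_top d) \<phi>"
    using homeomorphic_imp_continuous_map[OF hU] by (simp add: continuous_map_paired)
  then have "continuous_map ?S (Cn_top d) \<phi>"
    using WU by (rule continuous_map_from_subtopology_mono)
  then have t\<phi>: "continuous_map ?S (Cn_top d') (\<lambda>e. t (\<phi> e))"
    using continuous_map_compose[OF _ continuous_map_linear_Cn[OF t], of ?S \<phi>] by (simp add: o_def)
  have pr: "continuous_map ?S (subtopology Y V) (prj F)"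
    using vector_bundleD(2)[OF F] W topS
    by (intro continuous_map_into_subtopology continuous_map_from_subtopology) (auto simp: over_def)
  have kc: "continuous_map (prod_topology (subtopology Y V) (Cn_top d')) ?S' k"
    using k by (simp add: homeomorphic_maps_def)
  have "continuous_map ?S ?S' (\<lambda>e. k (prj F e, t (\<phi> e)))"
    using continuous_map_compose[OF continuous_map_pairedI[OF pr t\<phi>] kc] by (simp add: o_def)
  then have "continuous_map ?S ?S' f"
  proof (rule continuous_map_eq)
    fix e assume "e \<in> topspace ?S"
    then have e: "e \<in> over F W" using topS by simp
    then have fe: "f e \<in> over F' V" "prj F' (f e) = prj F e"
      using fD(2,3)[of e] W by (auto simp: over_def)
    have "k (prj F' (f e), \<psi> (f e)) = f e"
      using k fe(1) topS(2) by (simp add: homeomorphic_maps_def)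
    then show "k (prj F e, t (\<phi> e)) = f e" using fe(2) ft[OF e] by simp
  qed
  then show ?thesis by (rule continuous_map_into_fulltopology)
qed

lemma continuous_map_locally:
  assumes "\<And>x. x \<in> topspace X \<Longrightarrow> \<exists>U. openin X U \<and> x \<in> U \<and> continuous_map (subtopology X U) Y f"
  shows "continuous_map X Y f"
\<comment> \<open>The cover consists of all open sets on which continuity is known.\<close>
proof (rule pasting_lemma[where I = "{U. openin X U \<and> continuous_map (subtopology X U) Y f}"
      and T = "\<lambda>U. U" and f = "\<lambda>_. f"])
  fix x assume "x \<in> topspace X"
  then show "\<exists>U. U \<in> {U. openin X U \<and> continuous_map (subtopology X U) Y f} \<and> x \<in> U \<and> f x = f x"
    using assms by blast
qed auto

text \<open>Near each point \<open>f\<close> is a fixed linear map in charts, hence continuous by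
  \<open>locally_constant_imp_continuous_map\<close>; so continuity never has to be shown separately
  for a locally constant morphism.\<close>

lemma lc_morphismI:
  assumes F: "vector_bundle Y F" and F': "vector_bundle Y F'"
    and cov: "(\<Union>(U, \<phi>)\<in>atlas F. U) = topspace Y" "(\<Union>(U, \<phi>)\<in>atlas F'. U) = topspace Y"
    and f: "fibrewise_linear F F' f"
    and lc: "\<And>U \<phi> V \<psi> y. \<lbrakk>(U, \<phi>) \<in> atlas F; (V, \<psi>) \<in> atlas F'; y \<in> U \<inter> V\<rbrakk> \<Longrightarrow>
        \<exists>W d d' t. openin Y W \<and> y \<in> W \<and> W \<subseteq> U \<inter> V \<and>
          local_trivialization Y F d U \<phi> \<and> local_trivialization Y F' d' V \<psi> \<and>
          linear_map (Cn_module d) (Cn_module d') t \<and>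
          (\<forall>e\<in>over F W. \<psi> (f e) = t (\<phi> e))"
  shows "lc_morphism Y F F' f"
proof -
  have "continuous_map (vtop F) (vtop F') f"
  proof (rule continuous_map_locally)
    fix e assume "e \<in> topspace (vtop F)"
    then have e: "e \<in> total F" using vector_bundleD(1)[OF F] by simp
    then have y: "prj F e \<in> topspace Y"
      using vector_bundleD(1,2)[OF F] by (auto simp: continuous_map_def)
    obtain U \<phi> where U: "(U, \<phi>) \<in> atlas F" "prj F e \<in> U" using y cov(1) by blast
    obtain V \<psi> where V: "(V, \<psi>) \<in> atlas F'" "prj F e \<in> V" using y cov(2) by blast
    obtain W d d' t where W: "openin Y W" "prj F e \<in> W" "W \<subseteq> U \<inter> V"
      "local_trivialization Y F d U \<phi>" "local_trivialization Y F' d' V \<psi>"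
      "linear_map (Cn_module d) (Cn_module d') t" "\<And>e. e\<in>over F W \<Longrightarrow> \<psi> (f e) = t (\<phi> e)"
      using lc[OF U(1) V(1), of "prj F e"] U(2) V(2) by blast
    have "continuous_map (subtopology (vtop F) (over F W)) (vtop F') f"
      by (rule locally_constant_imp_continuous_map[OF F F' W(4,5,3,6) f W(7)])
    moreover have "openin (vtop F) (over F W)" by (rule vector_bundleD(5)[OF F W(1)])
    ultimately show "\<exists>U. openin (vtop F) U \<and> e \<in> U \<and> continuous_map (subtopology (vtop F) U) (vtop F') f"
      using e W(2) by (intro exI[of _ "over F W"]) (simp add: over_def)
  qed
  then show ?thesis
    unfolding lc_morphism_def bundle_morphism_def using f lc by (auto simp del: ex_simps)
qed

section \<open>Categories of vector bundles and of locally constant bundles\<close>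

lemma is_category_V_top: "is_category (V_top Y)"
  unfolding V_top_def
proof (rule is_category_compose, goal_cases)
  case (1 A)
  then have A: "vector_bundle Y A" by simp
  have "continuous_map (vtop A) (vtop A) (restrict (\<lambda>e. e) (total A))"
    by (rule continuous_map_eq[OF continuous_map_id]) (simp add: vector_bundleD(1)[OF A])
  then show ?case
    using fibrewise_linear_ident[of A A] vector_bundleD(4)[OF A] by (simp add: bundle_morphism_def)
next
  case (2 A B f)
  then show ?case by (auto simp: bundle_morphism_def fibrewise_linear_def)
next
  case (3 A B D f g)
  then have A: "vector_bundle Y A" by simp
  have "continuous_map (vtop A) (vtop D) (g \<circ> f)"
    using 3 by (auto simp: bundle_morphism_def intro: continuous_map_compose)
  then have "continuous_map (vtop A) (vtop D) (compose (total A) g f)"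
    by (rule continuous_map_eq) (simp add: vector_bundleD(1)[OF A] compose_def)
  then show ?case
    using 3 fibrewise_linear_compose[of A B f D g] vector_bundleD(4)[OF A] by (simp add: bundle_morphism_def)
qed

lemma lc_vector_bundleD:
  assumes "lc_vector_bundle G Y F"
  shows "vector_bundle Y F" and "(\<Union>(U, \<phi>)\<in>atlas F. U) = topspace Y"
  using assms by (simp_all add: lc_vector_bundle_def)

lemma lc_vector_bundleI:
  assumes "vector_bundle Y F" and "(\<Union>(U, \<phi>)\<in>atlas F. U) = topspace Y"
    and "\<And>U \<phi>. (U, \<phi>) \<in> atlas F \<Longrightarrow> local_trivialization Y F d U \<phi>"
    and "\<And>U \<phi> V \<psi> y. \<lbrakk>(U, \<phi>) \<in> atlas F; (V, \<psi>) \<in> atlas F; y \<in> U \<inter> V\<rbrakk> \<Longrightarrow>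
      \<exists>W. openin Y W \<and> y \<in> W \<and> W \<subseteq> U \<inter> V \<and> (\<exists>g\<in>G d. \<forall>e\<in>over F W. \<psi> e = g (\<phi> e))"
  shows "lc_vector_bundle G Y F"
  unfolding lc_vector_bundle_def
proof (intro conjI exI[of _ d])
  show "\<forall>(U, \<phi>)\<in>atlas F. local_trivialization Y F d U \<phi>" using assms(3) by (intro ballI) auto
  show "\<forall>(U, \<phi>)\<in>atlas F. \<forall>(V, \<psi>)\<in>atlas F. \<forall>y\<in>U \<inter> V.
           \<exists>W. openin Y W \<and> y \<in> W \<and> W \<subseteq> U \<inter> V \<and> (\<exists>g\<in>G d. \<forall>e\<in>over F W. \<psi> e = g (\<phi> e))"
    by clarify (rule assms(4), auto)
qed (use assms in auto)

lemma lc_vector_bundle_atlasE: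
  assumes "lc_vector_bundle G Y F"
  obtains d where "\<And>U \<phi>. (U, \<phi>) \<in> atlas F \<Longrightarrow> local_trivialization Y F d U \<phi>"
    and "\<And>U \<phi> V \<psi> y. \<lbrakk>(U, \<phi>) \<in> atlas F; (V, \<psi>) \<in> atlas F; y \<in> U \<inter> V\<rbrakk> \<Longrightarrow>
      \<exists>W. openin Y W \<and> y \<in> W \<and> W \<subseteq> U \<inter> V \<and> (\<exists>g\<in>G d. \<forall>e\<in>over F W. \<psi> e = g (\<phi> e))"
proof -
  have "\<exists>d. (\<forall>(U, \<phi>)\<in>atlas F. local_trivialization Y F d U \<phi>) \<and>
        (\<forall>(U, \<phi>)\<in>atlas F. \<forall>(V, \<psi>)\<in>atlas F. \<forall>y\<in>U \<inter> V.
           \<exists>W. openin Y W \<and> y \<in> W \<and> W \<subseteq> U \<inter> V \<and>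
             (\<exists>g\<in>G d. \<forall>e\<in>over F W. \<psi> e = g (\<phi> e)))"
    using assms by (simp add: lc_vector_bundle_def)
  then obtain d where d: "\<forall>(U, \<phi>)\<in>atlas F. local_trivialization Y F d U \<phi>"
    "\<forall>(U, \<phi>)\<in>atlas F. \<forall>(V, \<psi>)\<in>atlas F. \<forall>y\<in>U \<inter> V.
           \<exists>W. openin Y W \<and> y \<in> W \<and> W \<subseteq> U \<inter> V \<and>
             (\<exists>g\<in>G d. \<forall>e\<in>over F W. \<psi> e = g (\<phi> e))" by blast
  show ?thesis
  proof (rule that)
    show "local_trivialization Y F d U \<phi>" if "(U, \<phi>) \<in> atlas F" for U \<phi> using d(1) that by blast
    show "\<exists>W. openin Y W \<and> y \<in> W \<and> W \<subseteq> U \<inter> V \<and> (\<exists>g\<in>G d. \<forall>e\<in>over F W. \<psi> e = g (\<phi> e))"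
      if "(U, \<phi>) \<in> atlas F" "(V, \<psi>) \<in> atlas F" "y \<in> U \<inter> V" for U \<phi> V \<psi> y
      using bspec[OF bspec[OF d(2) that(1), simplified] that(2), simplified] that(3) by simp
  qed
qed

lemma lc_vector_bundle_rankE:
  assumes "lc_vector_bundle G Y F"
  obtains d where "\<And>U \<phi>. (U, \<phi>) \<in> atlas F \<Longrightarrow> local_trivialization Y F d U \<phi>"
proof -
  show ?thesis
    by (rule lc_vector_bundle_atlasE[OF assms], rule that)
qed

lemma lc_vector_bundle_chartE:
  assumes "lc_vector_bundle G Y F" "y \<in> topspace Y"
  obtains U \<phi> where "(U, \<phi>) \<in> atlas F" "y \<in> U"
  using lc_vector_bundleD(2)[OF assms(1)] assms(2) by blast

lemma lc_morphismE:
  assumes "lc_morphism Y F F' f" "(U, \<phi>) \<in> atlas F" "(V, \<psi>) \<in> atlas F'" "y \<in> U" "y \<in> V"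
  obtains W d d' t where "openin Y W" "y \<in> W" "W \<subseteq> U \<inter> V"
      "local_trivialization Y F d U \<phi>" "local_trivialization Y F' d' V \<psi>"
      "linear_map (Cn_module d) (Cn_module d') t" "\<And>e. e\<in>over F W \<Longrightarrow> \<psi> (f e) = t (\<phi> e)"
proof -
  have *: "\<forall>(U, \<phi>)\<in>atlas F. \<forall>(V, \<psi>)\<in>atlas F'. \<forall>y\<in>U \<inter> V.
        \<exists>W d d' t. openin Y W \<and> y \<in> W \<and> W \<subseteq> U \<inter> V \<and>
          local_trivialization Y F d U \<phi> \<and> local_trivialization Y F' d' V \<psi> \<and>
          linear_map (Cn_module d) (Cn_module d') t \<and>
          (\<forall>e\<in>over F W. \<psi> (f e) = t (\<phi> e))"
    using assms(1) by (simp add: lc_morphism_def)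
  have "\<exists>W d d' t. openin Y W \<and> y \<in> W \<and> W \<subseteq> U \<inter> V \<and>
          local_trivialization Y F d U \<phi> \<and> local_trivialization Y F' d' V \<psi> \<and>
          linear_map (Cn_module d) (Cn_module d') t \<and>
          (\<forall>e\<in>over F W. \<psi> (f e) = t (\<phi> e))"
    using bspec[OF bspec[OF * assms(2), simplified] assms(3), simplified] assms(4,5) by simp
  then show ?thesis using that by blast
qed

text \<open>In two charts of the atlas the identity reads as their transition map, which is locally
  constant; both choices of \<open>G\<close> consist of linear maps.\<close>

lemma lc_morphism_ident:
  assumes F: "lc_vector_bundle G Y F" and G: "G = GL \<or> G = Unitary"
  shows "lc_morphism Y F F (restrict (\<lambda>e. e) (total F))"
proof (rule lc_morphismI[OF lc_vector_bundleD(1)[OF F] lc_vector_bundleD(1)[OF F]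
      lc_vector_bundleD(2)[OF F] lc_vector_bundleD(2)[OF F]])
  show "fibrewise_linear F F (restrict (\<lambda>e. e) (total F))"
    using fibrewise_linear_ident[of F F] vector_bundleD(4)[OF lc_vector_bundleD(1)[OF F]] by simp
  fix U \<phi> V \<psi> y assume U: "(U, \<phi>) \<in> atlas F" and V: "(V, \<psi>) \<in> atlas F" and y: "y \<in> U \<inter> V"
  obtain d where triv: "\<And>U \<phi>. (U, \<phi>) \<in> atlas F \<Longrightarrow> local_trivialization Y F d U \<phi>"
    and trans: "\<And>U \<phi> V \<psi> y. \<lbrakk>(U, \<phi>) \<in> atlas F; (V, \<psi>) \<in> atlas F; y \<in> U \<inter> V\<rbrakk> \<Longrightarrow>
      \<exists>W. openin Y W \<and> y \<in> W \<and> W \<subseteq> U \<inter> V \<and> (\<exists>g\<in>G d. \<forall>e\<in>over F W. \<psi> e = g (\<phi> e))"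
    using lc_vector_bundle_atlasE[OF F] by blast
  obtain W g where W: "openin Y W" "y \<in> W" "W \<subseteq> U \<inter> V" and g: "g \<in> G d"
    and eq: "\<forall>e\<in>over F W. \<psi> e = g (\<phi> e)"
    using trans[OF U V y] by blast
  have "linear_map (Cn_module d) (Cn_module d) g"
    using g G by (auto simp: Unitary_def GL_def)
  moreover have "\<forall>e\<in>over F W. \<psi> (restrict (\<lambda>e. e) (total F) e) = g (\<phi> e)"
    using eq by (simp add: over_def)
  ultimately show "\<exists>W d d' t. openin Y W \<and> y \<in> W \<and> W \<subseteq> U \<inter> V \<and>
          local_trivialization Y F d U \<phi> \<and> local_trivialization Y F d' V \<psi> \<and>
          linear_map (Cn_module d) (Cn_module d') t \<and>
          (\<forall>e\<in>over F W. \<psi> (restrict (\<lambda>e. e) (total F) e) = t (\<phi> e))"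
    using W triv[OF U] triv[OF V] by blast
qed

text \<open>A chart of \<open>B\<close> around \<open>y\<close> is inserted between those of
  \<open>A\<close> and \<open>D\<close>; on the common neighbourhood the two fixed linear maps
  compose.\<close>

lemma lc_morphism_compose:
  assumes A: "lc_vector_bundle G Y A" and B: "lc_vector_bundle G Y B" and D: "lc_vector_bundle G Y D"
    and f: "lc_morphism Y A B f" and g: "lc_morphism Y B D g"
  shows "lc_morphism Y A D (compose (total A) g f)"
proof (rule lc_morphismI[OF lc_vector_bundleD(1)[OF A] lc_vector_bundleD(1)[OF D]
      lc_vector_bundleD(2)[OF A] lc_vector_bundleD(2)[OF D]])
  have fl: "fibrewise_linear A B f" and gl: "fibrewise_linear B D g"
    using f g by (simp_all add: lc_morphism_def bundle_morphism_def)
  show "fibrewise_linear A D (compose (total A) g f)"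
    by (rule fibrewise_linear_compose[OF vector_bundleD(4)[OF lc_vector_bundleD(1)[OF A]] fl gl])
  fix U \<phi> V \<psi> y assume U: "(U, \<phi>) \<in> atlas A" and V: "(V, \<psi>) \<in> atlas D" and y: "y \<in> U \<inter> V"
  have "U \<subseteq> topspace Y" using lc_vector_bundleD(2)[OF A] U by blast
  then obtain V' \<rho> where V': "(V', \<rho>) \<in> atlas B" "y \<in> V'"
    using y lc_vector_bundleD(2)[OF B] by blast
  obtain W d d' t where W: "openin Y W" "y \<in> W" "W \<subseteq> U \<inter> V'"
      "local_trivialization Y A d U \<phi>" "local_trivialization Y B d' V' \<rho>"
      "linear_map (Cn_module d) (Cn_module d') t" "\<And>e. e\<in>over A W \<Longrightarrow> \<rho> (f e) = t (\<phi> e)"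
    using lc_morphismE[OF f U V'(1) _ V'(2)] y by (metis IntD1)
  obtain W2 e' d'' t2 where W2: "openin Y W2" "y \<in> W2" "W2 \<subseteq> V' \<inter> V"
      "local_trivialization Y B e' V' \<rho>" "local_trivialization Y D d'' V \<psi>"
      "linear_map (Cn_module e') (Cn_module d'') t2" "\<And>e. e\<in>over B W2 \<Longrightarrow> \<psi> (g e) = t2 (\<rho> e)"
    using lc_morphismE[OF g V'(1) V V'(2)] y by (metis IntD2)
  \<comment> \<open>\<open>f\<close> and \<open>g\<close> each come with a rank for the inserted
    chart of \<open>B\<close>; the two must agree before \<open>t\<close> and \<open>t2\<close> can
    be composed.\<close>
  have e': "e' = d'"
    by (rule local_trivialization_dim[OF vector_bundleD(1)[OF lc_vector_bundleD(1)[OF B]] W2(4) W(5) V'(2)])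
  have "linear_map (Cn_module d) (Cn_module d'') (\<lambda>v. t2 (t v))"
    using linear_map_compose[OF W(6) W2(6)[unfolded e']] .
  moreover have "\<psi> (compose (total A) g f e) = t2 (t (\<phi> e))" if e: "e \<in> over A (W \<inter> W2)" for e
  proof -
    have "e \<in> total A" "e \<in> over A W" using e by (auto simp: over_def)
    moreover have "f e \<in> over B W2"
      using fibrewise_linearD(2,3)[OF fl, of e] e by (auto simp: over_def)
    ultimately show ?thesis using W(7) W2(7) by (simp add: compose_def)
  qed
  ultimately show "\<exists>W d d' t. openin Y W \<and> y \<in> W \<and> W \<subseteq> U \<inter> V \<and>
          local_trivialization Y A d U \<phi> \<and> local_trivialization Y D d' V \<psi> \<and>
          linear_map (Cn_module d) (Cn_module d') t \<and>
          (\<forall>e\<in>over A W. \<psi> (compose (total A) g f e) = t (\<phi> e))"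
    using W W2 by (intro exI[of _ "W \<inter> W2"] exI[of _ d] exI[of _ d''] exI[of _ "\<lambda>v. t2 (t v)"]) auto
qed

lemma is_category_V_lc:
  assumes "G = GL \<or> G = Unitary"
  shows "is_category (V_lc G Y)"
  unfolding V_lc_def
proof (rule is_category_compose, goal_cases)
  case (1 A)
  then show ?case using lc_morphism_ident assms by blast
next
  case (2 A B f)
  then show ?case by (auto simp: lc_morphism_def bundle_morphism_def fibrewise_linear_def)
next
  case (3 A B D f g)
  then show ?case using lc_morphism_compose by blast
qed

section \<open>The functor \<open>\<tau>\<^sub>*\<close>\<close>

lemma local_trivialization_tau:
  assumes E: "E \<in> Ob V_net" and \<phi>: "flat_chart E a d \<phi>"
  shows "local_trivialization alexandroff (tau_lc_bundle E) d {a..} \<phi>"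
    and "local_trivialization alexandroff (tau_bundle E) d {a..} \<phi>"
  using flat_chart_homeomorphic_map[OF E \<phi>] \<phi>
  by (simp_all add: local_trivialization_def flat_chart_def unitary_chart_def)

lemma vector_bundle_tau:
  assumes E: "E \<in> Ob V_net"
  shows "vector_bundle alexandroff (tau_lc_bundle E)" and "vector_bundle alexandroff (tau_bundle E)"
proof -
  note D = hilbert_net_bundleD[OF V_netD(1)[OF E]]
  note X = net_bundle_net_space_of[OF E]
  have "\<exists>U d \<phi>. y \<in> U \<and> local_trivialization alexandroff (tau_lc_bundle E) d U \<phi>"
    and "\<exists>U d \<phi>. y \<in> U \<and> local_trivialization alexandroff (tau_bundle E) d U \<phi>" for y
  proof -
    obtain d \<phi> where \<phi>: "flat_chart E y d \<phi>" using flat_chart_exists[OF E] .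
    show "\<exists>U d \<phi>. y \<in> U \<and> local_trivialization alexandroff (tau_lc_bundle E) d U \<phi>"
      and "\<exists>U d \<phi>. y \<in> U \<and> local_trivialization alexandroff (tau_bundle E) d U \<phi>"
      using local_trivialization_tau[OF E \<phi>] atLeast_iff[of y y] by blast+
  qed
  then show "vector_bundle alexandroff (tau_lc_bundle E)" and "vector_bundle alexandroff (tau_bundle E)"
    using continuous_map_proj_map[OF X] topspace_tau[OF X] D(2) by (simp_all add: vector_bundle_def)
qed

text \<open>A map of nets is determined over \<open>{y..}\<close> by its value at \<open>y\<close>, and so are flat charts;
  hence \<open>t\<close> can be read off on the fibre over \<open>y\<close>.\<close>

lemma flat_charts_intertwine:
  assumes E: "E \<in> Ob V_net"
    and \<phi>: "flat_chart E y d \<phi>" and \<psi>: "flat_chart E' y d' \<psi>"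
    and T: "linear_map (fibre_module E y) (fibre_module E' y) T"
    and TJ: "\<And>c x. y \<le> c \<Longrightarrow> x \<in> fibre E y \<Longrightarrow> T (J E c y x) = J E' c y (T x)"
  defines "t \<equiv> \<lambda>v. \<psi> (T (inv_into (fibre E y) \<phi> v))"
  shows "linear_map (Cn_module d) (Cn_module d') t"
    and "e \<in> over E {y..} \<Longrightarrow> \<psi> (T e) = t (\<phi> e)"
proof -
  note D = hilbert_net_bundleD[OF V_netD(1)[OF E]]
  have uc: "unitary_chart E y d \<phi>" "unitary_chart E' y d' \<psi>"
    using \<phi> \<psi> by (simp_all add: flat_chart_def)
  then have bij: "bij_betw \<phi> (fibre E y) (Cn d)" by (simp add: unitary_chart_def)
  have "linear_map (Cn_module d) (fibre_module E y) (inv_into (fibre E y) \<phi>)"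
    using linear_map_inv_into[OF D(2), where N = "Cn_module d" and f = \<phi>] uc(1) by (simp add: unitary_chart_def)
  then show "linear_map (Cn_module d) (Cn_module d') t"
    unfolding t_def using linear_map_compose[OF linear_map_compose[OF _ T], of _ _ "Cn_module d'" \<psi>] uc(2)
    by (simp add: unitary_chart_def)
  show "\<psi> (T e) = t (\<phi> e)" if "e \<in> over E {y..}"
  proof -
    have c: "y \<le> prj E e" "e \<in> fibre E (prj E e)" using that by (auto simp: over_def fibre_def)
    then obtain x where x: "x \<in> fibre E y" "e = J E (prj E e) y x"
      using D(4)[OF c(1)] by (auto simp: bij_betw_def)
    have Tx: "T x \<in> fibre E' y" using linear_mapD(1)[OF T] x(1) by simp
    have "\<psi> (T e) = \<psi> (J E' (prj E e) y (T x))" using TJ[OF c(1) x(1)] x(2) by simp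
    also have "\<dots> = \<psi> (T x)" using \<psi> c(1) Tx by (simp add: flat_chart_def)
    also have "\<phi> e = \<phi> (J E (prj E e) y x)" using x(2) by simp
    then have "\<phi> e = \<phi> x" using \<phi> c(1) x(1) by (simp add: flat_chart_def)
    then have "\<psi> (T x) = t (\<phi> e)" using bij x(1) by (simp add: t_def bij_betw_def)
    finally show ?thesis .
  qed
qed

lemma atlas_tau_cover:
  assumes E: "E \<in> Ob V_net"
  shows "(\<Union>(U, \<phi>)\<in>atlas (tau_lc_bundle E). U) = topspace alexandroff"
proof -
  have "y \<in> (\<Union>(U, \<phi>)\<in>tau_atlas E. U)" for y
  proof -
    obtain d \<phi> where "flat_chart E y d \<phi>" using flat_chart_exists[OF E] .
    then have "({y..}, \<phi>) \<in> tau_atlas E" using tau_atlas_iff[OF V_netD(1)[OF E]] by blast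
    then show ?thesis by force
  qed
  then show ?thesis by auto
qed

text \<open>Over \<open>{y..}\<close> two flat charts differ by the map that they define on the
  single fibre over \<open>y\<close>, and this map is unitary since both carry \<open>ip E\<close>
  to \<open>Cn_inner d\<close>.\<close>

lemma lc_vector_bundle_tau:
  assumes conn: "pathwise_connected (UNIV :: 'k::order set)" and E: "(E :: ('k, 'e) hilbert_net) \<in> Ob V_net"
  shows "lc_vector_bundle Unitary alexandroff (tau_lc_bundle E)"
proof -
  note H = V_netD(1)[OF E]
  \<comment> \<open>Any point may fix the common rank; by connectedness every chart of the atlas has
    the same one.\<close>
  obtain d \<phi>0 where \<phi>0: "flat_chart E undefined d \<phi>0" using flat_chart_exists[OF E] .
  have chart: "\<exists>a. U = {a..} \<and> flat_chart E a d \<phi>" if U: "(U, \<phi>) \<in> tau_atlas E" for U \<phi>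
  proof -
    obtain a d' where "U = {a..}" "flat_chart E a d' \<phi>"
      using U unfolding tau_atlas_iff[OF H] by blast
    then show ?thesis using flat_chart_dim[OF conn E _ \<phi>0] by blast
  qed
  have "\<exists>W. openin alexandroff W \<and> y \<in> W \<and> W \<subseteq> U \<inter> V \<and> (\<exists>g\<in>Unitary d. \<forall>e\<in>over E W. \<psi> e = g (\<phi> e))"
    if UV: "(U, \<phi>) \<in> tau_atlas E" "(V, \<psi>) \<in> tau_atlas E" and y: "y \<in> U \<inter> V" for U \<phi> V \<psi> y
  proof -
    obtain a where a: "U = {a..}" "flat_chart E a d \<phi>" using chart[OF UV(1)] by blast
    obtain b where b: "V = {b..}" "flat_chart E b d \<psi>" using chart[OF UV(2)] by blast
    have ab: "a \<le> y" "b \<le> y" using y a b by auto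
    have \<phi>: "flat_chart E y d \<phi>" and \<psi>: "flat_chart E y d \<psi>"
      using flat_chart_mono a b ab by blast+
    define g where "g = (\<lambda>v. \<psi> (inv_into (fibre E y) \<phi> v))"
    \<comment> \<open>A transition map is the case of \<open>flat_charts_intertwine\<close> in which
      the morphism is the identity.\<close>
    have lin: "linear_map (Cn_module d) (Cn_module d) g"
      and eq: "\<And>e. e \<in> over E {y..} \<Longrightarrow> \<psi> e = g (\<phi> e)"
      using flat_charts_intertwine[OF E \<phi> \<psi>, of "\<lambda>x. x"] by (auto simp: g_def linear_map_def)
    have bij: "bij_betw \<phi> (fibre E y) (Cn d)" "bij_betw \<psi> (fibre E y) (Cn d)"
      and ip: "\<And>u v. u \<in> fibre E y \<Longrightarrow> v \<in> fibre E y \<Longrightarrow> Cn_inner d (\<phi> u) (\<phi> v) = ip E u v"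
        "\<And>u v. u \<in> fibre E y \<Longrightarrow> v \<in> fibre E y \<Longrightarrow> Cn_inner d (\<psi> u) (\<psi> v) = ip E u v"
      using \<phi> \<psi> by (auto simp: flat_chart_def unitary_chart_def)
    have inv: "inv_into (fibre E y) \<phi> v \<in> fibre E y" "\<phi> (inv_into (fibre E y) \<phi> v) = v" if "v \<in> Cn d" for v
      using bij(1) that by (auto simp: bij_betw_def inv_into_into f_inv_into_f)
    have "bij_betw g (Cn d) (Cn d)"
      using bij_betw_trans[OF bij_betw_inv_into[OF bij(1)] bij(2)] by (simp add: g_def o_def)
    moreover have "Cn_inner d (g v) (g w) = Cn_inner d v w" if "v \<in> Cn d" "w \<in> Cn d" for v w
      using ip[OF inv(1)[OF that(1)] inv(1)[OF that(2)]] inv(2) that by (simp add: g_def)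
    ultimately have "g \<in> Unitary d" using lin by (simp add: Unitary_def GL_def)
    then show ?thesis
      using eq ab a b by (intro exI[of _ "{y..}"]) auto
  qed
  then show ?thesis
    using chart[THEN exE] local_trivialization_tau(1)[OF E]
    by (intro lc_vector_bundleI[where d = d] vector_bundle_tau(1)[OF E] atlas_tau_cover[OF E])
      (simp, metis, simp)
qed

lemma lc_vector_bundle_Unitary_GL:
  assumes "lc_vector_bundle Unitary Y F"
  shows "lc_vector_bundle GL Y F"
proof -
  obtain d where triv: "\<And>U \<phi>. (U, \<phi>) \<in> atlas F \<Longrightarrow> local_trivialization Y F d U \<phi>"
    and trans: "\<And>U \<phi> V \<psi> y. \<lbrakk>(U, \<phi>) \<in> atlas F; (V, \<psi>) \<in> atlas F; y \<in> U \<inter> V\<rbrakk> \<Longrightarrow>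
      \<exists>W. openin Y W \<and> y \<in> W \<and> W \<subseteq> U \<inter> V \<and> (\<exists>g\<in>Unitary d. \<forall>e\<in>over F W. \<psi> e = g (\<phi> e))"
    using lc_vector_bundle_atlasE[OF assms] by blast
  have "Unitary d \<subseteq> GL d" by (auto simp: Unitary_def)
  then show ?thesis
    using lc_vector_bundleD[OF assms] triv trans by (intro lc_vector_bundleI) (assumption, assumption, blast, meson subsetD)
qed

text \<open>The set \<open>{y..}\<close> serves as the neighbourhood on which \<open>T\<close> is
  constant in charts. Continuity of \<open>T\<close> comes along with this, so the functor into
  \<open>V_top\<close> rests on the same fact.\<close>

lemma lc_morphism_tau:
  assumes E: "E \<in> Ob V_net" and E': "E' \<in> Ob V_net" and T: "net_morphism E E' T"
  shows "lc_morphism alexandroff (tau_lc_bundle E) (tau_lc_bundle E') T"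
proof (rule lc_morphismI[OF vector_bundle_tau(1)[OF E] vector_bundle_tau(1)[OF E']
      atlas_tau_cover[OF E] atlas_tau_cover[OF E']])
  have T': "fibrewise_linear E E' T" using T by (simp add: net_morphism_def)
  then show "fibrewise_linear (tau_lc_bundle E) (tau_lc_bundle E') T"
    by (simp add: fibrewise_linear_def)
  fix U \<phi> V \<psi> y
  assume "(U, \<phi>) \<in> atlas (tau_lc_bundle E)" "(V, \<psi>) \<in> atlas (tau_lc_bundle E')" and y: "y \<in> U \<inter> V"
  then obtain a d b d' where a: "U = {a..}" "flat_chart E a d \<phi>" and b: "V = {b..}" "flat_chart E' b d' \<psi>"
    using tau_atlas_iff[OF V_netD(1)[OF E]] tau_atlas_iff[OF V_netD(1)[OF E']] by auto
  have ab: "a \<le> y" "b \<le> y" using y a b by auto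
  have \<phi>: "flat_chart E y d \<phi>" and \<psi>: "flat_chart E' y d' \<psi>"
    using flat_chart_mono a b ab by blast+
  have "linear_map (fibre_module E y) (fibre_module E' y) T"
  proof -
    have "y \<in> prj E ` total E" using V_netD(1)[OF E] by (simp add: hilbert_net_bundle_def)
    then show ?thesis using T' unfolding fibrewise_linear_def by blast
  qed
  then obtain t where t: "linear_map (Cn_module d) (Cn_module d') t"
      "\<And>e. e \<in> over E {y..} \<Longrightarrow> \<psi> (T e) = t (\<phi> e)"
    using flat_charts_intertwine[OF E \<phi> \<psi>, of T] T by (auto simp: net_morphism_def)
  show "\<exists>W d d' t. openin alexandroff W \<and> y \<in> W \<and> W \<subseteq> U \<inter> V \<and>
          local_trivialization alexandroff (tau_lc_bundle E) d U \<phi> \<and>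
          local_trivialization alexandroff (tau_lc_bundle E') d' V \<psi> \<and>
          linear_map (Cn_module d) (Cn_module d') t \<and>
          (\<forall>e\<in>over (tau_lc_bundle E) W. \<psi> (T e) = t (\<phi> e))"
    using local_trivialization_tau(1)[OF E a(2)] local_trivialization_tau(1)[OF E' b(2)] a(1) b(1) ab t
    by (intro exI[of _ "{y..}"] exI[of _ d] exI[of _ d'] exI[of _ t]) auto
qed

section \<open>The category of nets and the functors out of it\<close>

text \<open>Norm and transport are compared on the fibres of \<open>E\<close>: elsewhere the two
  records may differ, as they do for the unit of the equivalence.\<close>

lemma net_morphism_ident:
  assumes "hilbert_net_bundle E" "total E' = total E" "\<And>b. fibre_module E' b = fibre_module E b"
    and "\<And>x. x \<in> total E \<Longrightarrow> fnorm E' x = fnorm E x"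
    and "\<And>a b x. a \<le> b \<Longrightarrow> x \<in> fibre E a \<Longrightarrow> J E' b a x = J E b a x"
  shows "net_morphism E E' (restrict (\<lambda>e. e) (total E))"
  unfolding net_morphism_def
proof (intro conjI allI impI ballI)
  note D = hilbert_net_bundleD[OF assms(1)]
  show "fibrewise_linear E E' (restrict (\<lambda>e. e) (total E))"
    by (rule fibrewise_linear_ident) (use assms D(2) in auto)
  show "\<exists>C. \<forall>x\<in>fibre E a. fnorm E' (restrict (\<lambda>e. e) (total E) x) \<le> C * fnorm E x" for a
    using assms(4) by (intro exI[of _ 1]) (simp add: fibre_def)
  fix a b x assume ab: "a \<le> b" and x: "x \<in> fibre E a"
  then show "restrict (\<lambda>e. e) (total E) (J E b a x) = J E' b a (restrict (\<lambda>e. e) (total E) x)"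
    using D(8)[OF ab x] assms(5)[OF ab x] by (simp add: fibre_def)
qed

lemma net_morphism_compose:
  assumes E: "hilbert_net_bundle E" and E': "hilbert_net_bundle E'"
    and T: "net_morphism E E' T" and S: "net_morphism E' E'' S"
  shows "net_morphism E E'' (compose (total E) S T)"
  unfolding net_morphism_def
proof (intro conjI allI impI ballI)
  note D = hilbert_net_bundleD[OF E]
  have lT: "fibrewise_linear E E' T" and lS: "fibrewise_linear E' E'' S"
    using T S by (simp_all add: net_morphism_def)
  note Tf = fibrewise_linearD(5)[OF lT]
  show "fibrewise_linear E E'' (compose (total E) S T)"
    by (rule fibrewise_linear_compose[OF D(2) lT lS])
  have tot: "x \<in> total E" if "x \<in> fibre E a" for a x using that by (simp add: fibre_def)
  fix a
  obtain C where C: "\<forall>x\<in>fibre E a. fnorm E' (T x) \<le> C * fnorm E x"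
    using T unfolding net_morphism_def by blast
  obtain C' where C': "\<forall>x\<in>fibre E' a. fnorm E'' (S x) \<le> C' * fnorm E' x"
    using S unfolding net_morphism_def by blast
  have pos: "0 \<le> fnorm E' x" if "x \<in> fibre E' a" for x
    using inner_product_module.ip_nonneg[OF hilbert_fibre_inner_product_module[OF
        hilbert_net_bundleD(1)[OF E', of a]], of x] that by (simp add: fnorm_def)
  \<comment> \<open>The bound \<open>C'\<close> is not assumed nonnegative, hence
    \<open>max 0 C'\<close> before it is multiplied by the estimate for \<open>T\<close>.\<close>
  have "fnorm E'' (compose (total E) S T x) \<le> (max 0 C' * C) * fnorm E x" if x: "x \<in> fibre E a" for x
  proof -
    have "fnorm E'' (compose (total E) S T x) \<le> C' * fnorm E' (T x)"
      using C' Tf[OF x] tot[OF x] by (simp add: compose_def)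
    also have "\<dots> \<le> max 0 C' * fnorm E' (T x)"
      by (intro mult_right_mono pos Tf[OF x]) simp
    also have "\<dots> \<le> max 0 C' * (C * fnorm E x)"
      using C x by (intro mult_left_mono) auto
    finally show ?thesis by (simp add: mult.assoc)
  qed
  then show "\<exists>C. \<forall>x\<in>fibre E a. fnorm E'' (compose (total E) S T x) \<le> C * fnorm E x" by blast
  fix b x assume ab: "a \<le> b" and x: "x \<in> fibre E a"
  then show "compose (total E) S T (J E b a x) = J E'' b a (compose (total E) S T x)"
    using T S D(8)[OF ab x] Tf[OF x] tot by (simp add: net_morphism_def compose_def)
qed

lemma is_category_V_net: "is_category V_net"
  unfolding V_net_def
proof (rule is_category_compose, goal_cases)
  case (1 A)
  then show ?case using net_morphism_ident[of A A] by simp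
next
  case (2 A B f)
  then show ?case by (auto simp: net_morphism_def fibrewise_linear_def)
next
  case (3 A B D f g)
  then show ?case using net_morphism_compose[of A B f D g] by simp
qed

lemma is_functor_tau_star: "is_functor V_net (V_top alexandroff) tau_star"
  unfolding is_functor_def
proof (intro conjI ballI is_category_V_net is_category_V_top)
  fix A assume A: "A \<in> Ob V_net"
  then show "on_Ob tau_star A \<in> Ob (V_top alexandroff)"
    using vector_bundle_tau(2) by (simp add: tau_star_def V_top_def)
  fix B f assume B: "B \<in> Ob V_net" and f: "f \<in> Hom V_net A B"
  have "lc_morphism alexandroff (tau_lc_bundle A) (tau_lc_bundle B) f"
    using lc_morphism_tau[OF A B] f by (simp add: V_net_def)
  then show "on_Hom tau_star A B f \<in> Hom (V_top alexandroff) (on_Ob tau_star A) (on_Ob tau_star B)"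
    by (simp add: tau_star_def V_top_def lc_morphism_def bundle_morphism_def fibrewise_linear_def)
qed (simp_all add: tau_star_def V_top_def V_net_def)

lemma is_functor_tau_star_lc:
  assumes conn: "pathwise_connected (UNIV :: 'k::order set)" and G: "G = GL \<or> G = Unitary"
  shows "is_functor (V_net :: (('k, 'e) hilbert_net, 'e \<Rightarrow> 'e) category) (V_lc G alexandroff) tau_star_lc"
  unfolding is_functor_def
proof (intro conjI ballI is_category_V_net is_category_V_lc[OF G])
  fix A :: "('k, 'e) hilbert_net" assume A: "A \<in> Ob V_net"
  then show "on_Ob tau_star_lc A \<in> Ob (V_lc G alexandroff)"
    using lc_vector_bundle_tau[OF conn A] lc_vector_bundle_Unitary_GL G
    by (auto simp: tau_star_lc_def V_lc_def)
  fix B :: "('k, 'e) hilbert_net" and f assume B: "B \<in> Ob V_net" and f: "f \<in> Hom V_net A B"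
  have "lc_morphism alexandroff (tau_lc_bundle A) (tau_lc_bundle B) f"
    using lc_morphism_tau[OF A B] f by (simp add: V_net_def)
  then show "on_Hom tau_star_lc A B f \<in> Hom (V_lc G alexandroff) (on_Ob tau_star_lc A) (on_Ob tau_star_lc B)"
    by (simp add: tau_star_lc_def V_lc_def)
qed (simp_all add: tau_star_lc_def V_lc_def V_net_def)

section \<open>The inverse functor\<close>

text \<open>The preimages of the unit vectors generate, with the coordinates as
  coefficients.\<close>

lemma finite_dim_via_coordinates:
  assumes M: "module complex_ring M" and \<phi>: "linear_map M (Cn_module d) \<phi>" "bij_betw \<phi> (carrier M) (Cn d)"
  shows "finite_dim M"
proof -
  interpret module complex_ring M by fact
  define u where "u i = inv_into (carrier M) \<phi> (unit_vec i)" for i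
  have u: "u i \<in> carrier M" "\<phi> (u i) = unit_vec i" if "i < d" for i
    using \<phi>(2) unit_vec_in_Cn[OF that] by (auto simp: u_def bij_betw_def inv_into_into f_inv_into_f)
  have sm: "c \<odot>\<^bsub>M\<^esub> x \<in> carrier M" if "x \<in> carrier M" for c x using smult_closed that by simp
  have inj: "x = y" if "\<phi> x = \<phi> y" "x \<in> carrier M" "y \<in> carrier M" for x y
    using \<phi>(2) that by (auto simp: bij_betw_def inj_on_def)
  \<comment> \<open>\<open>finite_dim\<close> takes coefficients as a function of the vector, not of
    the index, so distinct indices must give distinct vectors.\<close>
  have inj_u: "inj_on u {..<d}"
  proof (rule inj_onI)
    fix i j assume ij: "i \<in> {..<d}" "j \<in> {..<d}" "u i = u j"
    then have "unit_vec i = unit_vec j" using u(2)[of i] u(2)[of j] by simp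
    then show "i = j" by (metis unit_vec_def zero_neq_one)
  qed
  have phi_sum: "finsum M (\<lambda>i. v i \<odot>\<^bsub>M\<^esub> u i) {..<n} \<in> carrier M \<and>
      \<phi> (finsum M (\<lambda>i. v i \<odot>\<^bsub>M\<^esub> u i) {..<n}) = (\<lambda>i. if i < n then v i else 0)" if "n \<le> d" for n v
    using that
  proof (induction n)
    case 0
    have "\<phi> \<zero>\<^bsub>M\<^esub> = \<phi> (0 \<odot>\<^bsub>M\<^esub> \<zero>\<^bsub>M\<^esub>)" using smult_l_null[of "\<zero>\<^bsub>M\<^esub>"] by simp
    then show ?case using linear_mapD(3)[OF \<phi>(1), of "\<zero>\<^bsub>M\<^esub>" 0] by simp
  next
    case (Suc n)
    let ?s = "finsum M (\<lambda>i. v i \<odot>\<^bsub>M\<^esub> u i) {..<n}"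
    have s: "?s \<in> carrier M" "\<phi> ?s = (\<lambda>i. if i < n then v i else 0)" using Suc by simp_all
    have un: "u n \<in> carrier M" "\<phi> (u n) = unit_vec n" using u[of n] Suc.prems by simp_all
    have eq: "finsum M (\<lambda>i. v i \<odot>\<^bsub>M\<^esub> u i) {..<Suc n} = v n \<odot>\<^bsub>M\<^esub> u n \<oplus>\<^bsub>M\<^esub> ?s"
      unfolding lessThan_Suc using Suc.prems u sm by (intro finsum_insert) auto
    have "\<phi> (v n \<odot>\<^bsub>M\<^esub> u n \<oplus>\<^bsub>M\<^esub> ?s) = (\<lambda>i. if i < Suc n then v i else 0)"
      using linear_mapD(2)[OF \<phi>(1), of "v n \<odot>\<^bsub>M\<^esub> u n" ?s] linear_mapD(3)[OF \<phi>(1), of "u n" "v n"] s un sm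
      by (auto simp: unit_vec_def fun_eq_iff less_Suc_eq)
    then show ?case unfolding eq using s(1) un(1) sm by simp
  qed
  show ?thesis
    unfolding finite_dim_def
  proof (intro exI[of _ "u ` {..<d}"] conjI ballI)
    show "u ` {..<d} \<subseteq> carrier M" using u by auto
    fix x assume x: "x \<in> carrier M"
    define c where "c b = \<phi> x (the_inv_into {..<d} u b)" for b
    have cu: "c (u i) = \<phi> x i" if "i < d" for i
      using the_inv_into_f_f[OF inj_u] that by (simp add: c_def)
    have "finsum M (\<lambda>b. c b \<odot>\<^bsub>M\<^esub> b) (u ` {..<d}) = finsum M (\<lambda>i. c (u i) \<odot>\<^bsub>M\<^esub> u i) {..<d}"
      using u sm inj_u by (intro finsum_reindex) auto
    also have "\<dots> = finsum M (\<lambda>i. \<phi> x i \<odot>\<^bsub>M\<^esub> u i) {..<d}"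
      using u sm cu by (intro finsum_cong') auto
    also have "\<dots> = x"
    proof (rule inj)
      have "\<phi> x \<in> Cn d" using linear_mapD(1)[OF \<phi>(1) x] by simp
      then show "\<phi> (finsum M (\<lambda>i. \<phi> x i \<odot>\<^bsub>M\<^esub> u i) {..<d}) = \<phi> x"
        using phi_sum[OF order_refl, of "\<phi> x"] by (auto simp: Cn_def fun_eq_iff)
    qed (use phi_sum x in auto)
    finally show "\<exists>c. x = finsum M (\<lambda>b. c b \<odot>\<^bsub>M\<^esub> b) (u ` {..<d})" by metis
  qed simp
qed

lemma Cn_inner_cnj: "Cn_inner d w v = cnj (Cn_inner d v w)"
  by (simp add: Cn_inner_def mult.commute)

text \<open>The inner product is that of \<open>Cn d\<close> read through a linear bijection. This
  runs opposite to \<open>unitary_chart_exists\<close>: the chart comes first and the Hilbert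
  structure is deduced.\<close>

lemma hilbert_fibre_via_chart:
  assumes M: "module complex_ring (fibre_module E a)" and \<phi>: "unitary_chart E a d \<phi>"
  shows "hilbert_fibre E a"
proof -
  interpret module complex_ring "fibre_module E a" by fact
  have ip: "ip E x y = Cn_inner d (\<phi> x) (\<phi> y)" if "x \<in> fibre E a" "y \<in> fibre E a" for x y
    using \<phi> that by (simp add: unitary_chart_def)
  have lin: "linear_map (fibre_module E a) (Cn_module d) \<phi>" and bij: "bij_betw \<phi> (fibre E a) (Cn d)"
    using \<phi> by (simp_all add: unitary_chart_def)
  note add = linear_mapD(2)[OF lin, simplified] and sc = linear_mapD(3)[OF lin, simplified]
  have cl: "vadd E x y \<in> fibre E a" "vscale E c x \<in> fibre E a"
    if "x \<in> fibre E a" "y \<in> fibre E a" for x y c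
    using that M.add.m_closed smult_closed by simp_all
  have self: "ip E x x = complex_of_real ((L2_set (\<lambda>i. cmod (\<phi> x i)) {..<d})\<^sup>2)" if "x \<in> fibre E a" for x
    using ip[OF that that] by (simp only: Cn_inner_self)
  show ?thesis
    unfolding hilbert_fibre_def
  proof (intro conjI M ballI allI impI unitary_chart_metric(3)[OF M \<phi>])
    fix x y z c assume x: "x \<in> fibre E a" and y: "y \<in> fibre E a"
    show "ip E y x = cnj (ip E x y)"
      unfolding ip[OF x y] ip[OF y x] by (rule Cn_inner_cnj)
    show "ip E (vscale E c x) y = c * ip E x y"
      unfolding ip[OF x y] ip[OF cl(2)[OF x x] y] sc[OF x] Cn_inner_def
      by (simp add: sum_distrib_left mult.assoc)
    assume z: "z \<in> fibre E a"
    show "ip E (vadd E x y) z = ip E x z + ip E y z"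
      unfolding ip[OF x z] ip[OF y z] ip[OF cl(1)[OF x y] z] add[OF x y] Cn_inner_def
      by (simp add: sum.distrib distrib_right)
  next
    fix x assume x: "x \<in> fibre E a"
    show "0 \<le> Re (ip E x x)" using self[OF x] by (simp only: Re_complex_of_real zero_le_power2)
    assume "ip E x x = 0"
    then have "\<phi> x i = 0" if "i < d" for i
      using self[OF x] that by (simp add: L2_set_eq_0_iff)
    moreover have "\<phi> x \<in> Cn d" using linear_mapD(1)[OF lin] x by simp
    ultimately have "\<phi> x = (\<lambda>_. 0)" by (auto simp: Cn_def fun_eq_iff not_less[symmetric])
    moreover have "\<phi> (vzero E a) = (\<lambda>_. 0)"
    proof -
      have "vzero E a \<in> fibre E a" using M.zero_closed by simp
      then have "\<phi> (vscale E 0 (vzero E a)) = (\<lambda>_. 0)" using sc[of "vzero E a" 0] by simp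
      then show ?thesis using smult_l_null[OF M.zero_closed] by simp
    qed
    moreover have "vzero E a \<in> fibre E a" using M.zero_closed by simp
    ultimately show "x = vzero E a"
      using inj_onD[OF bij_betw_imp_inj_on[OF bij], of x "vzero E a"] x by simp
  qed
qed

text \<open>Locally constant morphisms come without norm bounds; in finite dimension the matrix in
  unitary coordinates provides one.\<close>

lemma linear_map_fibre_bounded:
  assumes E: "E \<in> Ob V_net" and E': "E' \<in> Ob V_net"
    and T: "linear_map (fibre_module E a) (fibre_module E' a) T"
  shows "\<exists>C. \<forall>x\<in>fibre E a. fnorm E' (T x) \<le> C * fnorm E x"
proof -
  obtain d \<phi> where \<phi>: "unitary_chart E a d \<phi>" using unitary_chart_exists[OF E] .
  obtain d' \<psi> where \<psi>: "unitary_chart E' a d' \<psi>" using unitary_chart_exists[OF E'] .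
  note M = hilbert_net_bundleD(2)[OF V_netD(1)[OF E]]
  have bij: "bij_betw \<phi> (fibre E a) (Cn d)" using \<phi> by (simp add: unitary_chart_def)
  define t where "t v = \<psi> (T (inv_into (fibre E a) \<phi> v))" for v
  have "linear_map (Cn_module d) (fibre_module E a) (inv_into (fibre E a) \<phi>)"
    using linear_map_inv_into[OF M, where N = "Cn_module d" and f = \<phi>] \<phi> by (simp add: unitary_chart_def)
  then have t: "linear_map (Cn_module d) (Cn_module d') t"
    unfolding t_def using linear_map_compose[OF linear_map_compose[OF _ T], of _ _ "Cn_module d'" \<psi>] \<psi>
    by (simp add: unitary_chart_def)
  \<comment> \<open>The sum of the moduli of all matrix entries: crude, but it allows the image norm
    to be bounded by the sum of its coordinates, each estimated separately.\<close>
  define C where "C = (\<Sum>i<d'. \<Sum>j<d. cmod (t (unit_vec j) i))"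
  have nE: "fnorm E x = L2_set (\<lambda>i. cmod (\<phi> x i)) {..<d}" if "x \<in> fibre E a" for x
  proof -
    have "ip E x x = Cn_inner d (\<phi> x) (\<phi> x)" using \<phi> that by (simp add: unitary_chart_def)
    then show ?thesis unfolding fnorm_def by (simp add: Cn_inner_self)
  qed
  have nE': "fnorm E' x = L2_set (\<lambda>i. cmod (\<psi> x i)) {..<d'}" if "x \<in> fibre E' a" for x
  proof -
    have "ip E' x x = Cn_inner d' (\<psi> x) (\<psi> x)" using \<psi> that by (simp add: unitary_chart_def)
    then show ?thesis unfolding fnorm_def by (simp add: Cn_inner_self)
  qed
  have "fnorm E' (T x) \<le> C * fnorm E x" if x: "x \<in> fibre E a" for x
  proof -
    let ?v = "\<phi> x" and ?n = "L2_set (\<lambda>i. cmod (\<phi> x i)) {..<d}"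
    have v: "?v \<in> Cn d" using bij x by (auto simp: bij_betw_def)
    have Tx: "T x \<in> fibre E' a" using linear_mapD(1)[OF T] x by simp
    have tv: "\<psi> (T x) = t ?v" using bij x by (simp add: t_def bij_betw_def)
    have "fnorm E' (T x) \<le> (\<Sum>i<d'. cmod (t ?v i))"
      unfolding nE'[OF Tx] tv by (rule L2_set_le_sum) simp
    also have "\<dots> \<le> (\<Sum>i<d'. \<Sum>j<d. cmod (t (unit_vec j) i) * ?n)"
    proof (rule sum_mono)
      fix i
      have "cmod (t ?v i) \<le> (\<Sum>j<d. cmod (?v j * t (unit_vec j) i))"
        unfolding linear_map_Cn_expand[OF t v] by (rule norm_sum)
      also have "\<dots> \<le> (\<Sum>j<d. cmod (t (unit_vec j) i) * ?n)"
      proof (rule sum_mono)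
        fix j assume "j \<in> {..<d}"
        then have "cmod (?v j) \<le> ?n" by (intro member_le_L2_set) auto
        then show "cmod (?v j * t (unit_vec j) i) \<le> cmod (t (unit_vec j) i) * ?n"
          unfolding norm_mult by (subst mult.commute) (rule mult_left_mono, simp_all)
      qed
      finally show "cmod (t ?v i) \<le> (\<Sum>j<d. cmod (t (unit_vec j) i) * ?n)" .
    qed
    also have "\<dots> = C * fnorm E x" by (simp add: C_def nE[OF x] sum_distrib_right)
    finally show ?thesis .
  qed
  then show ?thesis by blast
qed

text \<open>A description of the net rather than a construction: flat charts fix the inner product
  on each fibre and, being injective there, the transport maps. What the inverse functor needs
  follows from these clauses, whichever such net is chosen.\<close>

definition is_net_of :: "('k::order, 'e) lc_vbundle \<Rightarrow> ('k, 'e) hilbert_net \<Rightarrow> bool" where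
  "is_net_of F E \<longleftrightarrow>
     E \<in> Ob V_net \<and> total E = total F \<and> prj E = prj F \<and> (\<forall>b. fibre_module E b = fibre_module F b) \<and>
     (\<forall>U \<phi> a d. (U, \<phi>) \<in> atlas F \<longrightarrow> a \<in> U \<longrightarrow> local_trivialization alexandroff F d U \<phi> \<longrightarrow> flat_chart E a d \<phi>)"

text \<open>Near \<open>b\<close> any two charts of the atlas differ by one unitary map on all of
  \<open>{b..}\<close>. Hence an inner product read in one chart at \<open>b\<close> is the same in
  all, and a vector with its transport having equal coordinates in one chart have equal coordinates
  in every chart at the source.\<close>

lemma is_net_of_exists:
  assumes F: "lc_vector_bundle Unitary alexandroff F"
  shows "\<exists>E. is_net_of F E"
proof -
  note V = lc_vector_bundleD(1)[OF F]
  have M: "module complex_ring (fibre_module F b)" for b using vector_bundleD(3)[OF V] by simp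
  obtain d where triv: "\<And>U \<phi>. (U, \<phi>) \<in> atlas F \<Longrightarrow> local_trivialization alexandroff F d U \<phi>"
    and trans0: "\<And>U \<phi> V \<psi> y. \<lbrakk>(U, \<phi>) \<in> atlas F; (V, \<psi>) \<in> atlas F; y \<in> U \<inter> V\<rbrakk> \<Longrightarrow>
      \<exists>W. openin alexandroff W \<and> y \<in> W \<and> W \<subseteq> U \<inter> V \<and> (\<exists>g\<in>Unitary d. \<forall>e\<in>over F W. \<psi> e = g (\<phi> e))"
    using lc_vector_bundle_atlasE[OF F] by blast
  have trans: "\<exists>g\<in>Unitary d. \<forall>e\<in>over F {y..}. \<psi> e = g (\<phi> e)"
    if UV: "(U, \<phi>) \<in> atlas F" "(V, \<psi>) \<in> atlas F" "y \<in> U" "y \<in> V" for U \<phi> V \<psi> y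
  proof -
    obtain W g where W: "openin alexandroff W" "y \<in> W" and g: "g \<in> Unitary d" "\<forall>e\<in>over F W. \<psi> e = g (\<phi> e)"
      using trans0[OF UV(1,2)] UV(3,4) by blast
    have "over F {y..} \<subseteq> over F W" using W unfolding openin_alexandroff over_def by blast
    then show ?thesis using g by blast
  qed
  have up: "b \<in> U" if "(U, \<phi>) \<in> atlas F" "a \<in> U" "a \<le> b" for U \<phi> a b
  proof -
    have "openin alexandroff U" using triv[OF that(1)] by (simp add: local_trivialization_def)
    then show ?thesis using that(2,3) unfolding openin_alexandroff by auto
  qed
  have bij: "bij_betw \<phi> (fibre F b) (Cn d)" if "(U, \<phi>) \<in> atlas F" "b \<in> U" for U \<phi> b
    by (rule local_trivialization_bij[OF vector_bundleD(1)[OF V] triv[OF that(1)] that(2)])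
  have lin: "linear_map (fibre_module F b) (Cn_module d) \<phi>" if "(U, \<phi>) \<in> atlas F" "b \<in> U" for U \<phi> b
    using triv[OF that(1)] that(2) by (simp add: local_trivialization_def)
  have "\<exists>U \<phi>. (U, \<phi>) \<in> atlas F \<and> b \<in> U" for b
    by (rule lc_vector_bundle_chartE[OF F, of b]) auto
  then obtain N c where c: "(N b, c b) \<in> atlas F" "b \<in> N b" for b by metis
  note cbij = bij[OF c(1) up[OF c]]
  \<comment> \<open>The inner product uses the chart chosen at the base point of the first argument.
    The transport uses the chart chosen at the source \<open>a\<close>, which is also defined over
    every \<open>b\<close> above \<open>a\<close> since chart domains are up-sets.\<close>
  define E where "E = \<lparr>total = total F, prj = prj F, vzero = vzero F, vadd = vadd F, vscale = vscale F,
    ip = (\<lambda>x y. Cn_inner d (c (prj F x) x) (c (prj F x) y)),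
    J = (\<lambda>b a x. inv_into (fibre F b) (c a) (c a x))\<rparr>"
  have E_simps: "total E = total F" "prj E = prj F" "fibre E b = fibre F b" "fibre_module E b = fibre_module F b"
    "over E U = over F U" for b U
    by (auto simp: E_def fibre_def fibre_module_def over_def)
  have ipE: "ip E x y = Cn_inner d (c b x) (c b y)" if "x \<in> fibre F b" for x y b
    using that by (simp add: E_def fibre_def)
  \<comment> \<open>Unitarity of the transition map makes the inner product independent of the
    chosen chart.\<close>
  have chart: "unitary_chart E b d \<phi>" if U: "(U, \<phi>) \<in> atlas F" "b \<in> U" for U \<phi> b
  proof -
    have "Cn_inner d (\<phi> x) (\<phi> y) = ip E x y" if x: "x \<in> fibre F b" and y: "y \<in> fibre F b" for x y
    proof -
      obtain g where g: "g \<in> Unitary d" "\<forall>e\<in>over F {b..}. \<phi> e = g (c b e)"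
        using trans[OF c(1) U(1) c(2) U(2)] by blast
      have "\<phi> x = g (c b x)" "\<phi> y = g (c b y)" using g(2) x y by (auto simp: over_def fibre_def)
      moreover have "c b x \<in> Cn d" "c b y \<in> Cn d" using bij_betwE[OF bij[OF c]] x y by blast+
      ultimately show ?thesis using g(1) ipE[OF x] by (simp add: Unitary_def)
    qed
    then show ?thesis
      using lin[OF U] bij[OF U] by (simp add: unitary_chart_def E_simps)
  qed
  have JE: "J E b a x \<in> fibre F b" "c a (J E b a x) = c a x" if ab: "a \<le> b" and x: "x \<in> fibre F a" for a b x
  proof -
    have "c a x \<in> c a ` fibre F b"
      using bij_betwE[OF bij[OF c]] x cbij[OF ab] by (auto simp: bij_betw_def)
    then show "J E b a x \<in> fibre F b" "c a (J E b a x) = c a x"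
      by (simp_all add: E_def inv_into_into f_inv_into_f)
  qed
  \<comment> \<open>The chart \<open>\<phi>\<close> and the chosen one differ by a single map on
    \<open>{b..}\<close>, so invariance under transport passes from the chosen chart to
    \<open>\<phi>\<close>.\<close>
  have flat: "\<phi> (J E b' b x) = \<phi> x"
    if U: "(U, \<phi>) \<in> atlas F" "b \<in> U" and b: "b \<le> b'" and x: "x \<in> fibre F b" for U \<phi> b b' x
  proof -
    obtain g where g: "\<forall>e\<in>over F {b..}. \<phi> e = g (c b e)"
      using trans[OF c(1) U(1) c(2) U(2)] by blast
    have "x \<in> over F {b..}" "J E b' b x \<in> over F {b..}"
      using x JE(1)[OF b x] b by (auto simp: over_def fibre_def)
    then show ?thesis using g JE(2)[OF b x] by simp
  qed
  have inj: "x = y" if "(U, \<phi>) \<in> atlas F" "b \<in> U" "x \<in> fibre F b" "y \<in> fibre F b" "\<phi> x = \<phi> y" for U \<phi> b x y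
    using inj_onD[OF bij_betw_imp_inj_on[OF bij[OF that(1,2)]]] that(3-5) by blast
  have hf: "hilbert_fibre E b" for b
    by (rule hilbert_fibre_via_chart[OF _ chart[OF c]]) (simp add: E_simps M)
  have HE: "hilbert_net_bundle E"
    unfolding hilbert_net_bundle_def
  proof (intro conjI allI impI ballI hf; (unfold E_simps)?)
    show "prj F ` total F = UNIV"
    proof -
      have "b \<in> prj F ` total F" for b
      proof -
        interpret module complex_ring "fibre_module F b" by (rule M)
        \<comment> \<open>Every fibre is nonempty because it contains its zero vector.\<close>
        have "vzero F b \<in> fibre F b" using M.zero_closed by simp
        then show ?thesis by (auto simp: fibre_def intro: rev_image_eqI)
      qed
      then show ?thesis by auto
    qed
    fix a b :: 'a assume ab: "a \<le> b"
    have Jeq: "J E b a = (\<lambda>x. inv_into (fibre F b) (c a) (c a x))" by (simp add: E_def)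
    have "linear_map (Cn_module d) (fibre_module F b) (inv_into (fibre F b) (c a))"
      using linear_map_inv_into[OF M lin[OF c(1) up[OF c ab]]] cbij[OF ab] by simp
    then show "linear_map (fibre_module F a) (fibre_module F b) (J E b a)"
      unfolding Jeq by (rule linear_map_compose[OF lin[OF c]])
    show "bij_betw (J E b a) (fibre F a) (fibre F b)"
      unfolding Jeq using bij_betw_trans[OF bij[OF c] bij_betw_inv_into[OF cbij[OF ab]]] by (simp add: o_def)
    fix x y assume x: "x \<in> fibre F a" and y: "y \<in> fibre F a"
    have "ip E (J E b a x) (J E b a y) = Cn_inner d (c a (J E b a x)) (c a (J E b a y))"
      using chart[OF c(1) up[OF c ab]] JE(1)[OF ab x] JE(1)[OF ab y] by (simp add: unitary_chart_def E_simps)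
    then show "ip E (J E b a x) (J E b a y) = ip E x y"
      using JE(2)[OF ab x] JE(2)[OF ab y] ipE[OF x] by simp
  next
    fix a x assume x: "x \<in> fibre F a"
    show "J E a a x = x"
      by (rule inj[OF c _ x JE(2)[OF order_refl x]]) (rule JE(1)[OF order_refl x])
  next
    fix a b b' :: 'a and x assume *: "a \<le> b \<and> b \<le> b'" and x: "x \<in> fibre F a"
    then have ab: "a \<le> b" and bb: "b \<le> b'" and ab': "a \<le> b'" by auto
    \<comment> \<open>Both sides have the coordinates of \<open>x\<close> in the chart chosen at
      \<open>a\<close>, which is a chart over \<open>b\<close> and \<open>b'\<close> as
      well.\<close>
    show "J E b' b (J E b a x) = J E b' a x"
    proof (rule inj[OF c(1) up[OF c ab'] JE(1)[OF bb JE(1)[OF ab x]] JE(1)[OF ab' x]])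
      show "c a (J E b' b (J E b a x)) = c a (J E b' a x)"
        using flat[OF c(1) up[OF c ab] bb JE(1)[OF ab x]] JE(2)[OF ab x] JE(2)[OF ab' x] by simp
    qed
  qed
  have fd: "finite_dim (fibre_module E b)" for b
    using finite_dim_via_coordinates[OF M lin[OF c]] bij[OF c] by (simp add: E_simps)
  have "flat_chart E a d' \<phi>"
    if U: "(U, \<phi>) \<in> atlas F" "a \<in> U" and d': "local_trivialization alexandroff F d' U \<phi>" for U \<phi> a d'
  proof -
    have "d' = d"
      by (rule local_trivialization_dim[OF vector_bundleD(1)[OF V] d' triv[OF U(1)] U(2)])
    moreover have "flat_chart E a d \<phi>"
      by (rule flat_chartI[OF HE chart[OF U]]) (use flat[OF U] E_simps in auto)
    ultimately show ?thesis by simp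
  qed
  then have "is_net_of F E"
    unfolding is_net_of_def using HE fd by (auto simp: V_net_def E_simps)
  then show ?thesis by blast
qed

lemma flat_chart_inj:
  assumes "flat_chart E a d \<phi>" "a \<le> b" "x \<in> fibre E b" "y \<in> fibre E b" "\<phi> x = \<phi> y"
  shows "x = y"
  using assms by (auto simp: flat_chart_def unitary_chart_def bij_betw_def inj_on_def)

lemma fibre_eq_if_fibre_module_eq:
  "fibre_module E b = fibre_module F b \<Longrightarrow> fibre E b = fibre F b"
  using fibre_module_simps(1) by metis

text \<open>A vector and its transport have the same coordinates in a flat chart, hence so do their
  images under a fixed \<open>t\<close>; injectivity of the target chart on the fibre over
  \<open>b\<close> turns this into compatibility with \<open>J\<close>. Boundedness comes from
  finite dimension.\<close>

lemma net_morphism_of_lc_morphism: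
  assumes F: "lc_vector_bundle Unitary alexandroff F" and F': "lc_vector_bundle Unitary alexandroff F'"
    and E: "is_net_of F E" and E': "is_net_of F' E'" and f: "lc_morphism alexandroff F F' f"
  shows "net_morphism E E' f"
  unfolding net_morphism_def
proof (intro conjI allI impI ballI)
  have EV: "E \<in> Ob V_net" "E' \<in> Ob V_net" using E E' by (simp_all add: is_net_of_def)
  have "fibre_module E b = fibre_module F b" "fibre_module E' b = fibre_module F' b" for b
    using E E' by (simp_all add: is_net_of_def)
  note fib = this[THEN fibre_eq_if_fibre_module_eq]
  have "fibrewise_linear F F' f" using f by (simp add: lc_morphism_def bundle_morphism_def)
  then show fl: "fibrewise_linear E E' f"
    using E E' by (simp add: is_net_of_def fibrewise_linear_def)
  fix a
  have "a \<in> prj E ` total E" using V_netD(1)[OF EV(1)] by (simp add: hilbert_net_bundle_def)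
  then have "linear_map (fibre_module E a) (fibre_module E' a) f"
    using fl unfolding fibrewise_linear_def by blast
  then show "\<exists>C. \<forall>x\<in>fibre E a. fnorm E' (f x) \<le> C * fnorm E x"
    by (rule linear_map_fibre_bounded[OF EV])
  fix b x assume ab: "a \<le> b" and x: "x \<in> fibre E a"
  obtain U \<phi> where U: "(U, \<phi>) \<in> atlas F" "a \<in> U"
    using lc_vector_bundle_chartE[OF F, of a] by auto
  obtain V \<psi> where V: "(V, \<psi>) \<in> atlas F'" "a \<in> V"
    using lc_vector_bundle_chartE[OF F', of a] by auto
  obtain W d d' t where W: "openin alexandroff W" "a \<in> W" "W \<subseteq> U \<inter> V"
      "local_trivialization alexandroff F d U \<phi>" "local_trivialization alexandroff F' d' V \<psi>"
      and t: "\<And>e. e\<in>over F W \<Longrightarrow> \<psi> (f e) = t (\<phi> e)"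
    using lc_morphismE[OF f U(1) V(1) U(2) V(2)] by metis
  have \<phi>: "flat_chart E a d \<phi>" using E U W(4) unfolding is_net_of_def by blast
  have \<psi>: "flat_chart E' a d' \<psi>" using E' V W(5) unfolding is_net_of_def by blast
  have Jx: "J E b a x \<in> fibre E b" using hilbert_net_bundleD(8)[OF V_netD(1)[OF EV(1)] ab x] .
  have fx: "f x \<in> fibre E' a" using fibrewise_linearD(5)[OF fl x] .
  \<comment> \<open>Openness puts all of \<open>{a..}\<close> into \<open>W\<close>, so one
    \<open>t\<close> covers both the vector and its transport.\<close>
  have "x \<in> over F W" "J E b a x \<in> over F W"
    using W(1,2) ab x Jx unfolding fib openin_alexandroff by (auto simp: over_def fibre_def)
  then have "\<psi> (f (J E b a x)) = \<psi> (f x)"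
    using t \<phi> ab x by (simp add: flat_chart_def)
  also have "\<dots> = \<psi> (J E' b a (f x))"
    using \<psi> ab fx by (simp add: flat_chart_def)
  finally show "f (J E b a x) = J E' b a (f x)"
    using flat_chart_inj[OF \<psi> ab] fibrewise_linearD(5)[OF fl Jx]
      hilbert_net_bundleD(8)[OF V_netD(1)[OF EV(2)] ab fx] by blast
qed

text \<open>Objects are picked among the nets described by \<open>is_net_of\<close>; arrows keep
  their underlying functions, since the total sets agree.\<close>

definition net_functor :: "(('k::order, 'e) lc_vbundle, 'e \<Rightarrow> 'e, ('k, 'e) hilbert_net, 'e \<Rightarrow> 'e) cat_functor" where
  "net_functor = \<lparr>on_Ob = (\<lambda>F. SOME E. is_net_of F E), on_Hom = (\<lambda>_ _ f. f)\<rparr>"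

lemma is_net_of_net_functor:
  "lc_vector_bundle Unitary alexandroff F \<Longrightarrow> is_net_of F (on_Ob net_functor F)"
  unfolding net_functor_def using someI_ex[OF is_net_of_exists] by simp

lemma is_functor_net_functor: "is_functor (V_lc Unitary alexandroff) V_net net_functor"
  unfolding is_functor_def
proof (intro conjI ballI is_category_V_net is_category_V_lc)
  fix A :: "('k::order, 'e) lc_vbundle" assume "A \<in> Ob (V_lc Unitary alexandroff)"
  then have A: "lc_vector_bundle Unitary alexandroff A" by (simp add: V_lc_def)
  note GA = is_net_of_net_functor[OF A]
  show "on_Ob net_functor A \<in> Ob V_net" using GA by (simp add: is_net_of_def)
  show "on_Hom net_functor A A (ident (V_lc Unitary alexandroff) A) = ident V_net (on_Ob net_functor A)"
    using GA by (simp add: is_net_of_def V_lc_def V_net_def net_functor_def)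
  fix B :: "('k::order, 'e) lc_vbundle" and f assume "B \<in> Ob (V_lc Unitary alexandroff)"
    and f: "f \<in> Hom (V_lc Unitary alexandroff) A B"
  then have B: "lc_vector_bundle Unitary alexandroff B" by (simp add: V_lc_def)
  have "net_morphism (on_Ob net_functor A) (on_Ob net_functor B) f"
    using net_morphism_of_lc_morphism[OF A B GA is_net_of_net_functor[OF B]] f by (simp add: V_lc_def)
  then show "on_Hom net_functor A B f \<in> Hom V_net (on_Ob net_functor A) (on_Ob net_functor B)"
    by (simp add: V_net_def net_functor_def)
  fix E :: "('k::order, 'e) lc_vbundle" and g
  show "on_Hom net_functor A E (comp (V_lc Unitary alexandroff) A B E g f) =
      comp V_net (on_Ob net_functor A) (on_Ob net_functor B) (on_Ob net_functor E)
        (on_Hom net_functor B E g) (on_Hom net_functor A B f)"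
    using GA by (simp add: is_net_of_def V_lc_def V_net_def net_functor_def)
qed simp

text \<open>At every point the two nets have a flat chart in common: the charts of
  \<open>tau_lc_bundle E\<close> are flat for \<open>E\<close> by construction and for
  \<open>E'\<close> by \<open>is_net_of\<close>. A common flat chart forces equal norms and equal
  transport.\<close>

lemma net_of_tau_ident:
  assumes E: "E \<in> Ob V_net" and E': "is_net_of (tau_lc_bundle E) E'"
  shows "net_morphism E E' (restrict (\<lambda>e. e) (total E))"
    and "net_morphism E' E (restrict (\<lambda>e. e) (total E))"
proof -
  note H = V_netD(1)[OF E]
  have E'V: "E' \<in> Ob V_net" and tot: "total E' = total E"
    and mod: "\<And>b. fibre_module E' b = fibre_module E b"
    using E' by (simp_all add: is_net_of_def)
  have fib: "fibre E' b = fibre E b" for b by (rule fibre_eq_if_fibre_module_eq[OF mod])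
  have chart: "\<exists>d \<phi>. flat_chart E a d \<phi> \<and> flat_chart E' a d \<phi>" for a
  proof -
    obtain d \<phi> where \<phi>: "flat_chart E a d \<phi>" using flat_chart_exists[OF E] .
    have "({a..}, \<phi>) \<in> atlas (tau_lc_bundle E)" using \<phi> tau_atlas_iff[OF H] by auto
    then have "flat_chart E' a d \<phi>"
      using E' local_trivialization_tau(1)[OF E \<phi>] atLeast_iff[of a a] unfolding is_net_of_def by blast
    then show ?thesis using \<phi> by blast
  qed
  have norm: "fnorm E' x = fnorm E x" if x: "x \<in> total E" for x
  proof -
    obtain d \<phi> where \<phi>: "flat_chart E (prj E x) d \<phi>" "flat_chart E' (prj E x) d \<phi>" using chart by blast
    have xf: "x \<in> fibre E (prj E x)" using x by (simp add: fibre_def)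
    have "unitary_chart E (prj E x) d \<phi>" "unitary_chart E' (prj E x) d \<phi>"
      using \<phi> by (simp_all add: flat_chart_def)
    then have "ip E' x x = ip E x x" using xf fib unfolding unitary_chart_def by metis
    then show ?thesis by (simp add: fnorm_def)
  qed
  have J: "J E' b a x = J E b a x" if ab: "a \<le> b" and x: "x \<in> fibre E a" for a b x
  proof -
    obtain d \<phi> where \<phi>: "flat_chart E a d \<phi>" "flat_chart E' a d \<phi>" using chart by blast
    have 1: "J E b a x \<in> fibre E b" by (rule hilbert_net_bundleD(8)[OF H ab x])
    have 2: "J E' b a x \<in> fibre E b"
      using hilbert_net_bundleD(8)[OF V_netD(1)[OF E'V] ab, of x] x by (simp add: fib)
    have "\<phi> (J E b a x) = \<phi> x" using \<phi>(1) ab x by (simp add: flat_chart_def)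
    moreover have "\<phi> (J E' b a x) = \<phi> x" using \<phi>(2) ab x fib by (simp add: flat_chart_def)
    ultimately show ?thesis using flat_chart_inj[OF \<phi>(1) ab 2 1] by simp
  qed
  show "net_morphism E E' (restrict (\<lambda>e. e) (total E))"
    by (rule net_morphism_ident[OF H tot mod norm J])
  show "net_morphism E' E (restrict (\<lambda>e. e) (total E))"
    using net_morphism_ident[OF V_netD(1)[OF E'V], of E] tot mod norm J fib by simp
qed

text \<open>Charts of \<open>F\<close> and of \<open>tau_lc_bundle E\<close> are flat charts of the
  same net, so near each point they differ by a fixed linear map. Through
  \<open>lc_morphismI\<close> this also makes the identity continuous both ways: the topology of
  \<open>F\<close> is recovered from its net.\<close>

lemma tau_of_net_ident:
  assumes F: "lc_vector_bundle Unitary alexandroff F" and E: "is_net_of F E"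
  shows "lc_morphism alexandroff (tau_lc_bundle E) F (restrict (\<lambda>e. e) (total F))"
    and "lc_morphism alexandroff F (tau_lc_bundle E) (restrict (\<lambda>e. e) (total F))"
proof -
  note VF = lc_vector_bundleD(1)[OF F]
  have EV: "E \<in> Ob V_net" and tot: "total E = total F" and prjE: "prj E = prj F"
    and mod: "fibre_module E b = fibre_module F b" for b
    using E by (simp_all add: is_net_of_def)
  note H = V_netD(1)[OF EV]
  obtain d where triv: "\<And>U \<phi>. (U, \<phi>) \<in> atlas F \<Longrightarrow> local_trivialization alexandroff F d U \<phi>"
    by (rule lc_vector_bundle_rankE[OF F], rule that)
  have charts: "\<exists>d'. flat_chart E y d' \<phi> \<and> flat_chart E y d \<psi> \<and> {y..} \<subseteq> U \<inter> V \<and>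
      local_trivialization alexandroff (tau_lc_bundle E) d' U \<phi>"
    if U: "(U, \<phi>) \<in> atlas (tau_lc_bundle E)" and V: "(V, \<psi>) \<in> atlas F" and y: "y \<in> U" "y \<in> V" for U \<phi> V \<psi> y
  proof -
    obtain a d' where a: "U = {a..}" "flat_chart E a d' \<phi>" using U tau_atlas_iff[OF H] by auto
    have "flat_chart E y d \<psi>" using E V y triv[OF V] unfolding is_net_of_def by blast
    moreover have "flat_chart E y d' \<phi>" using flat_chart_mono[OF a(2)] y a(1) by simp
    moreover have "{y..} \<subseteq> V"
      using triv[OF V] y(2) unfolding local_trivialization_def openin_alexandroff by blast
    moreover have "{y..} \<subseteq> U" using a(1) y(1) by auto
    ultimately show ?thesis
      using local_trivialization_tau(1)[OF EV a(2)] a(1) by (intro exI[of _ d']) simp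
  qed
  have id_lin: "linear_map (fibre_module E y) (fibre_module E y) (\<lambda>x. x)" for y by (simp add: linear_map_def)
  show "lc_morphism alexandroff (tau_lc_bundle E) F (restrict (\<lambda>e. e) (total F))"
  proof (rule lc_morphismI[OF vector_bundle_tau(1)[OF EV] VF atlas_tau_cover[OF EV] lc_vector_bundleD(2)[OF F]])
    show "fibrewise_linear (tau_lc_bundle E) F (restrict (\<lambda>e. e) (total F))"
    proof -
      have "fibrewise_linear (tau_lc_bundle E) F (restrict (\<lambda>e. e) (total (tau_lc_bundle E)))"
      proof (rule fibrewise_linear_ident)
        show "module complex_ring (fibre_module (tau_lc_bundle E) b)" for b
          using hilbert_net_bundleD(2)[OF H] by simp
      qed (simp_all add: tot mod)
      then show ?thesis using tot by simp
    qed
    fix U \<phi> V \<psi> y assume U: "(U, \<phi>) \<in> atlas (tau_lc_bundle E)" and V: "(V, \<psi>) \<in> atlas F" and y: "y \<in> U \<inter> V"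
    obtain d' where *: "flat_chart E y d' \<phi>" "flat_chart E y d \<psi>" "{y..} \<subseteq> U \<inter> V"
      "local_trivialization alexandroff (tau_lc_bundle E) d' U \<phi>"
      using charts[OF U V, of y] y by auto
    obtain t where t: "linear_map (Cn_module d') (Cn_module d) t" "\<And>e. e \<in> over E {y..} \<Longrightarrow> \<psi> e = t (\<phi> e)"
      using flat_charts_intertwine[OF EV *(1,2) id_lin] by auto
    have "\<forall>e\<in>over (tau_lc_bundle E) {y..}. \<psi> (restrict (\<lambda>e. e) (total F) e) = t (\<phi> e)"
      using t(2) tot by (simp add: over_def)
    then show "\<exists>W d d' t. openin alexandroff W \<and> y \<in> W \<and> W \<subseteq> U \<inter> V \<and>
          local_trivialization alexandroff (tau_lc_bundle E) d U \<phi> \<and> local_trivialization alexandroff F d' V \<psi> \<and>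
          linear_map (Cn_module d) (Cn_module d') t \<and>
          (\<forall>e\<in>over (tau_lc_bundle E) W. \<psi> (restrict (\<lambda>e. e) (total F) e) = t (\<phi> e))"
      using * t(1) triv[OF V] by (intro exI[of _ "{y..}"] exI[of _ d'] exI[of _ d] exI[of _ t]) auto
  qed
  show "lc_morphism alexandroff F (tau_lc_bundle E) (restrict (\<lambda>e. e) (total F))"
  proof (rule lc_morphismI[OF VF vector_bundle_tau(1)[OF EV] lc_vector_bundleD(2)[OF F] atlas_tau_cover[OF EV]])
    show "fibrewise_linear F (tau_lc_bundle E) (restrict (\<lambda>e. e) (total F))"
      by (rule fibrewise_linear_ident[OF vector_bundleD(4)[OF VF]]) (simp_all add: tot mod)
    fix V \<psi> U \<phi> y assume V: "(V, \<psi>) \<in> atlas F" and U: "(U, \<phi>) \<in> atlas (tau_lc_bundle E)" and y: "y \<in> V \<inter> U"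
    obtain d' where *: "flat_chart E y d' \<phi>" "flat_chart E y d \<psi>" "{y..} \<subseteq> U \<inter> V"
      "local_trivialization alexandroff (tau_lc_bundle E) d' U \<phi>"
      using charts[OF U V, of y] y by auto
    obtain t where t: "linear_map (Cn_module d) (Cn_module d') t" "\<And>e. e \<in> over E {y..} \<Longrightarrow> \<phi> e = t (\<psi> e)"
      using flat_charts_intertwine[OF EV *(2,1) id_lin] by auto
    have "\<forall>e\<in>over F {y..}. \<phi> (restrict (\<lambda>e. e) (total F) e) = t (\<psi> e)"
      using t(2) tot prjE by (simp add: over_def)
    then show "\<exists>W d d' t. openin alexandroff W \<and> y \<in> W \<and> W \<subseteq> V \<inter> U \<and>
          local_trivialization alexandroff F d V \<psi> \<and> local_trivialization alexandroff (tau_lc_bundle E) d' U \<phi> \<and>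
          linear_map (Cn_module d) (Cn_module d') t \<and>
          (\<forall>e\<in>over F W. \<phi> (restrict (\<lambda>e. e) (total F) e) = t (\<psi> e))"
      using * t(1) triv[OF V] by (intro exI[of _ "{y..}"] exI[of _ d] exI[of _ d'] exI[of _ t]) auto
  qed
qed

lemma compose_ident_ident: "compose A (restrict (\<lambda>e. e) A) (restrict (\<lambda>e. e) A) = restrict (\<lambda>e. e) A"
  by (auto simp: compose_def restrict_def)

lemma compose_ident_naturality:
  assumes "f \<in> extensional A" "f \<in> A \<rightarrow> B"
  shows "compose A (restrict (\<lambda>e. e) B) f = compose A f (restrict (\<lambda>e. e) A)"
  using assms by (simp add: compose_Id Id_compose)

text \<open>Unit and counit are identity functions on total sets and both functors keep the
  functions underlying arrows, so naturality amounts to the two unit laws of composition.\<close>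

lemma is_equivalence_tau_star_lc:
  assumes conn: "pathwise_connected (UNIV :: 'k::order set)"
  shows "is_equivalence (V_net :: (('k, 'e) hilbert_net, 'e \<Rightarrow> 'e) category) (V_lc Unitary alexandroff) tau_star_lc"
proof -
  let ?C = "V_net :: (('k, 'e) hilbert_net, 'e \<Rightarrow> 'e) category"
  let ?D = "V_lc Unitary alexandroff :: (('k, 'e) lc_vbundle, 'e \<Rightarrow> 'e) category"
  let ?I = "\<lambda>A. restrict (\<lambda>e. e) (total A)"
  have tau: "is_functor ?C ?D tau_star_lc" using is_functor_tau_star_lc[OF conn] by blast
  have unit: "natural_iso ?C ?C id_functor (comp_functor net_functor tau_star_lc) ?I"
    unfolding natural_iso_def
  proof (intro conjI ballI)
    fix A assume A: "A \<in> Ob ?C"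
    define A' where "A' = on_Ob net_functor (tau_lc_bundle A)"
    have A': "is_net_of (tau_lc_bundle A) A'"
      unfolding A'_def by (rule is_net_of_net_functor[OF lc_vector_bundle_tau[OF conn A]])
    then have tot: "total A' = total A" by (simp add: is_net_of_def)
    have ob: "on_Ob id_functor A = A" "on_Ob (comp_functor net_functor tau_star_lc) A = A'"
      by (simp_all add: id_functor_def comp_functor_def tau_star_lc_def A'_def)
    show "is_iso ?C (on_Ob id_functor A) (on_Ob (comp_functor net_functor tau_star_lc) A) (?I A)"
      unfolding ob is_iso_def using net_of_tau_ident[OF A A'] tot
      by (auto simp: V_net_def compose_ident_ident)
    fix B f assume B: "B \<in> Ob ?C" and f: "f \<in> Hom ?C A B"
    have "f \<in> extensional (total A)" "f \<in> total A \<rightarrow> total B"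
      using f by (auto simp: V_net_def net_morphism_def fibrewise_linear_def)
    then show "comp ?C (on_Ob id_functor A) (on_Ob id_functor B) (on_Ob (comp_functor net_functor tau_star_lc) B)
        (?I B) (on_Hom id_functor A B f) =
      comp ?C (on_Ob id_functor A) (on_Ob (comp_functor net_functor tau_star_lc) A)
        (on_Ob (comp_functor net_functor tau_star_lc) B) (on_Hom (comp_functor net_functor tau_star_lc) A B f) (?I A)"
      using compose_ident_naturality
      by (simp add: V_net_def id_functor_def comp_functor_def tau_star_lc_def net_functor_def)
  qed
  have counit: "natural_iso ?D ?D (comp_functor tau_star_lc net_functor) id_functor ?I"
    unfolding natural_iso_def
  proof (intro conjI ballI)
    fix A assume "A \<in> Ob ?D"
    then have A: "lc_vector_bundle Unitary alexandroff A" by (simp add: V_lc_def)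
    define A' where "A' = on_Ob net_functor A"
    have A': "is_net_of A A'" unfolding A'_def by (rule is_net_of_net_functor[OF A])
    then have tot: "total A' = total A" by (simp add: is_net_of_def)
    have ob: "on_Ob id_functor A = A" "on_Ob (comp_functor tau_star_lc net_functor) A = tau_lc_bundle A'"
      by (simp_all add: id_functor_def comp_functor_def tau_star_lc_def A'_def)
    show "is_iso ?D (on_Ob (comp_functor tau_star_lc net_functor) A) (on_Ob id_functor A) (?I A)"
      unfolding ob is_iso_def using tau_of_net_ident[OF A A'] tot
      by (auto simp: V_lc_def compose_ident_ident)
    fix B f assume B: "B \<in> Ob ?D" and f: "f \<in> Hom ?D A B"
    have "f \<in> extensional (total A)" "f \<in> total A \<rightarrow> total B"
      using f by (auto simp: V_lc_def lc_morphism_def bundle_morphism_def fibrewise_linear_def)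
    then show "comp ?D (on_Ob (comp_functor tau_star_lc net_functor) A) (on_Ob (comp_functor tau_star_lc net_functor) B)
        (on_Ob id_functor B) (?I B) (on_Hom (comp_functor tau_star_lc net_functor) A B f) =
      comp ?D (on_Ob (comp_functor tau_star_lc net_functor) A) (on_Ob id_functor A)
        (on_Ob id_functor B) (on_Hom id_functor A B f) (?I A)"
      using compose_ident_naturality tot unfolding ob
      by (simp add: V_lc_def id_functor_def comp_functor_def tau_star_lc_def net_functor_def)
  qed
  show ?thesis
    unfolding is_equivalence_def using tau is_functor_net_functor unit counit by blast
qed

section \<open>Pullbacks\<close>

lemma pullback_bundle_simps:
  "total (pullback_bundle Z f F) = {(z, e). z \<in> topspace Z \<and> e \<in> total F \<and> f z = prj F e}"
  "prj (pullback_bundle Z f F) = fst"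
  "vzero (pullback_bundle Z f F) = (\<lambda>z. (z, vzero F (f z)))"
  "vadd (pullback_bundle Z f F) = (\<lambda>(z, e) (_, e'). (z, vadd F e e'))"
  "vscale (pullback_bundle Z f F) = (\<lambda>c (z, e). (z, vscale F c e))"
  "vtop (pullback_bundle Z f F) = subtopology (prod_topology Z (vtop F)) (total (pullback_bundle Z f F))"
  "atlas (pullback_bundle Z f F) = (\<lambda>(U, \<phi>). ({z \<in> topspace Z. f z \<in> U}, \<phi> \<circ> snd)) ` atlas F"
  by (simp_all add: pullback_bundle_def Let_def)

lemma fibre_pullback_bundle:
  "z \<in> topspace Z \<Longrightarrow> fibre (pullback_bundle Z f F) z = {z} \<times> fibre F (f z)"
  by (auto simp: fibre_def pullback_bundle_simps)

lemma over_pullback_bundle: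
  "over (pullback_bundle Z f F) {z \<in> topspace Z. f z \<in> U} =
     {(z, e). z \<in> topspace Z \<and> e \<in> over F U \<and> f z = prj F e}"
  by (auto simp: over_def pullback_bundle_simps)

text \<open>The map \<open>snd\<close> identifies the fibre over \<open>z\<close> with the fibre
  over \<open>f z\<close>, and the module axioms are carried over along it.\<close>

lemma module_fibre_pullback_bundle:
  assumes M: "module complex_ring (fibre_module F (f z))" and z: "z \<in> topspace Z"
  shows "module complex_ring (fibre_module (pullback_bundle Z f F) z)"
    and "linear_map (fibre_module (pullback_bundle Z f F) z) (fibre_module F (f z)) snd"
proof -
  interpret module complex_ring "fibre_module F (f z)" by fact
  note fib = fibre_pullback_bundle[OF z, of f F]
  have cl: "vadd F x y \<in> fibre F (f z)" "vscale F c x \<in> fibre F (f z)" "vzero F (f z) \<in> fibre F (f z)"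
    if "x \<in> fibre F (f z)" "y \<in> fibre F (f z)" for x y c
    using that M.add.m_closed smult_closed M.zero_closed by simp_all
  have zero: "vzero F (f z) \<in> fibre F (f z)" using M.zero_closed by simp
  show lin: "linear_map (fibre_module (pullback_bundle Z f F) z) (fibre_module F (f z)) snd"
    by (auto simp: linear_map_def fib pullback_bundle_simps)
  show "module complex_ring (fibre_module (pullback_bundle Z f F) z)"
    by (rule module_via_bij[OF M, where h = snd])
      (use lin zero cl in \<open>auto simp: fib bij_betw_def inj_on_def pullback_bundle_simps\<close>)
qed

text \<open>The inverse sends \<open>(z, v)\<close> to \<open>z\<close> paired with the vector over
  \<open>f z\<close> that has coordinates \<open>v\<close> in the given trivialization.\<close>

lemma local_trivialization_pullback_bundle:
  assumes F: "vector_bundle Y F" and f: "continuous_map Z Y f" and \<phi>: "local_trivialization Y F d U \<phi>"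
  shows "local_trivialization Z (pullback_bundle Z f F) d {z \<in> topspace Z. f z \<in> U} (\<phi> \<circ> snd)"
proof -
  let ?P = "pullback_bundle Z f F" and ?U = "{z \<in> topspace Z. f z \<in> U}"
  let ?S = "subtopology (vtop ?P) (over ?P ?U)" and ?R = "prod_topology (subtopology Z ?U) (Cn_top d)"
  have U: "openin Y U" using \<phi> by (simp add: local_trivialization_def)
  have oU: "openin Z ?U" using openin_continuous_map_preimage[OF f U] .
  have "homeomorphic_map (subtopology (vtop F) (over F U))
       (prod_topology (subtopology Y U) (Cn_top d)) (\<lambda>e. (prj F e, \<phi> e))"
    using \<phi> by (simp add: local_trivialization_def)
  then obtain k where k: "homeomorphic_maps (subtopology (vtop F) (over F U))
       (prod_topology (subtopology Y U) (Cn_top d)) (\<lambda>e. (prj F e, \<phi> e)) k"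
    by (auto simp: homeomorphic_map_maps)
  have oF: "topspace (subtopology (vtop F) (over F U)) = over F U"
    using vector_bundleD(1)[OF F] by (auto simp: over_def)
  have UY: "topspace Y \<inter> U = U" using openin_subset[OF U] by auto
  have k1: "k (prj F e, \<phi> e) = e" if "e \<in> over F U" for e
    using k that oF by (simp add: homeomorphic_maps_def)
  have kc: "continuous_map (prod_topology (subtopology Y U) (Cn_top d)) (subtopology (vtop F) (over F U)) k"
    and \<phi>c: "continuous_map (subtopology (vtop F) (over F U)) (Cn_top d) \<phi>"
    using k by (simp_all add: homeomorphic_maps_def continuous_map_paired)
  have k2: "k (y, v) \<in> over F U" "prj F (k (y, v)) = y" "\<phi> (k (y, v)) = v" if "y \<in> U" "v \<in> Cn d" for y v
  proof -
    have yv: "(y, v) \<in> topspace (prod_topology (subtopology Y U) (Cn_top d))" using that UY by auto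
    show "k (y, v) \<in> over F U" using continuous_map_image_subset_topspace[OF kc] yv oF by blast
    show "prj F (k (y, v)) = y" "\<phi> (k (y, v)) = v" using k yv by (simp_all add: homeomorphic_maps_def)
  qed
  \<comment> \<open>The two nested subspaces are merged, so that continuity into \<open>?S\<close>
    can be checked in the product of \<open>Z\<close> with the total space of
    \<open>F\<close>.\<close>
  have S: "?S = subtopology (prod_topology Z (vtop F)) (over ?P ?U)"
    unfolding pullback_bundle_simps(6) subtopology_subtopology
    by (rule arg_cong[where f = "subtopology _"]) (auto simp: over_def)
  have topS: "topspace ?S = over ?P ?U"
  proof -
    have "topspace ?S = topspace (subtopology (prod_topology Z (vtop F)) (over ?P ?U))"
      by (rule arg_cong[OF S])
    also have "\<dots> = (topspace Z \<times> total F) \<inter> over ?P ?U"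
      by (simp only: topspace_subtopology topspace_prod_topology vector_bundleD(1)[OF F])
    also have "\<dots> = over ?P ?U"
      unfolding over_pullback_bundle by (auto simp: over_def)
    finally show ?thesis .
  qed
  have c1: "continuous_map ?S ?R (\<lambda>p. (fst p, \<phi> (snd p)))"
  proof (rule continuous_map_pairedI)
    show "continuous_map ?S (subtopology Z ?U) fst"
    proof (rule continuous_map_into_subtopology)
      show "continuous_map ?S Z fst"
        unfolding S by (rule continuous_map_from_subtopology[OF continuous_map_fst])
      show "fst \<in> topspace ?S \<rightarrow> ?U"
        unfolding topS over_pullback_bundle by (auto simp: over_def)
    qed
    have "continuous_map ?S (subtopology (vtop F) (over F U)) snd"
    proof (rule continuous_map_into_subtopology)
      show "continuous_map ?S (vtop F) snd"
        unfolding S by (rule continuous_map_from_subtopology[OF continuous_map_snd])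
      show "snd \<in> topspace ?S \<rightarrow> over F U"
        unfolding topS over_pullback_bundle by auto
    qed
    then show "continuous_map ?S (Cn_top d) (\<lambda>p. \<phi> (snd p))"
      using continuous_map_compose[OF _ \<phi>c] by (simp add: o_def)
  qed
  have c2: "continuous_map ?R ?S (\<lambda>q. (fst q, k (f (fst q), snd q)))"
    unfolding S
  proof (intro continuous_map_into_subtopology continuous_map_pairedI)
    have fst: "continuous_map ?R (subtopology Z ?U) fst" by (rule continuous_map_fst)
    then show "continuous_map ?R Z fst" by (rule continuous_map_into_fulltopology)
    then have "continuous_map ?R Y (\<lambda>q. f (fst q))"
      using continuous_map_compose[OF _ f] by (simp add: o_def)
    then have "continuous_map ?R (subtopology Y U) (\<lambda>q. f (fst q))"
      by (rule continuous_map_into_subtopology) auto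
    then have "continuous_map ?R (prod_topology (subtopology Y U) (Cn_top d)) (\<lambda>q. (f (fst q), snd q))"
      by (rule continuous_map_pairedI[OF _ continuous_map_snd])
    then have "continuous_map ?R (subtopology (vtop F) (over F U)) (\<lambda>q. k (f (fst q), snd q))"
      using continuous_map_compose[OF _ kc] by (simp add: o_def)
    then show "continuous_map ?R (vtop F) (\<lambda>q. k (f (fst q), snd q))"
      by (rule continuous_map_into_fulltopology)
    show "(\<lambda>q. (fst q, k (f (fst q), snd q))) \<in> topspace ?R \<rightarrow> over ?P ?U"
      using k2 unfolding over_pullback_bundle by auto
  qed
  have "homeomorphic_maps ?S ?R (\<lambda>p. (fst p, \<phi> (snd p))) (\<lambda>q. (fst q, k (f (fst q), snd q)))"
    unfolding homeomorphic_maps_def topS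
  proof (intro conjI c1 c2 ballI)
    fix p assume "p \<in> over ?P ?U"
    then have "snd p \<in> over F U" "f (fst p) = prj F (snd p)" unfolding over_pullback_bundle by auto
    then show "(fst (fst p, \<phi> (snd p)), k (f (fst (fst p, \<phi> (snd p))), snd (fst p, \<phi> (snd p)))) = p"
      using k1 by simp
  next
    fix q assume "q \<in> topspace ?R"
    then have "f (fst q) \<in> U" "snd q \<in> Cn d" by auto
    then show "(fst (fst q, k (f (fst q), snd q)), \<phi> (snd (fst q, k (f (fst q), snd q)))) = q"
      using k2(3) by simp
  qed
  then have "homeomorphic_map ?S ?R (\<lambda>p. (prj ?P p, (\<phi> \<circ> snd) p))"
    unfolding pullback_bundle_simps(2) by (auto simp: homeomorphic_map_maps)
  moreover have "linear_map (fibre_module ?P z) (Cn_module d) (\<phi> \<circ> snd)" if z: "z \<in> ?U" for z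
  proof -
    have "f z \<in> topspace Y" using z UY by auto
    then have "module complex_ring (fibre_module F (f z))" by (rule vector_bundleD(3)[OF F])
    then have "linear_map (fibre_module ?P z) (fibre_module F (f z)) snd"
      by (rule module_fibre_pullback_bundle(2)) (use z in simp)
    moreover have "linear_map (fibre_module F (f z)) (Cn_module d) \<phi>"
      using \<phi> z by (simp add: local_trivialization_def)
    ultimately show ?thesis unfolding o_def by (rule linear_map_compose)
  qed
  ultimately show ?thesis using oU by (simp add: local_trivialization_def)
qed

lemma vector_bundle_pullback_bundle:
  assumes F: "vector_bundle Y F" and f: "continuous_map Z Y f"
  shows "vector_bundle Z (pullback_bundle Z f F)"
  unfolding vector_bundle_def
proof (intro conjI ballI)
  let ?P = "pullback_bundle Z f F"
  show "topspace (vtop ?P) = total ?P"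
    using vector_bundleD(1)[OF F] unfolding pullback_bundle_simps by auto
  show "continuous_map (vtop ?P) Z (prj ?P)"
    unfolding pullback_bundle_simps(2,6) by (intro continuous_map_from_subtopology continuous_map_fst)
  fix z assume z: "z \<in> topspace Z"
  then have fz: "f z \<in> topspace Y" using f by (auto simp: continuous_map_def)
  show "module complex_ring (fibre_module ?P z)"
    by (rule module_fibre_pullback_bundle(1)[where f = f, OF vector_bundleD(3)[OF F fz] z])
  obtain U d \<phi> where U: "f z \<in> U" and \<phi>: "local_trivialization Y F d U \<phi>"
    using F fz unfolding vector_bundle_def by blast
  show "\<exists>U d \<phi>. z \<in> U \<and> local_trivialization Z ?P d U \<phi>"
    using local_trivialization_pullback_bundle[OF F f \<phi>] U z
    by (intro exI[of _ "{z \<in> topspace Z. f z \<in> U}"] exI[of _ d] exI[of _ "\<phi> \<circ> snd"]) simp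
qed

lemma atlas_pullback_bundleE:
  assumes "(V, \<psi>) \<in> atlas (pullback_bundle Z f F)"
  obtains U \<phi> where "(U, \<phi>) \<in> atlas F" "V = {z \<in> topspace Z. f z \<in> U}" "\<psi> = \<phi> \<circ> snd"
  using assms unfolding pullback_bundle_simps by auto

text \<open>Transition maps are pulled back by composing with \<open>f\<close>: the same
  \<open>g\<close> works over the preimage of \<open>W\<close>, so the group \<open>G\<close> is
  kept.\<close>

lemma lc_vector_bundle_pullback_bundle:
  assumes F: "lc_vector_bundle G Y F" and f: "continuous_map Z Y f"
  shows "lc_vector_bundle G Z (pullback_bundle Z f F)"
proof -
  let ?P = "pullback_bundle Z f F"
  note VF = lc_vector_bundleD(1)[OF F]
  obtain d where triv: "\<And>U \<phi>. (U, \<phi>) \<in> atlas F \<Longrightarrow> local_trivialization Y F d U \<phi>"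
    and trans: "\<And>U \<phi> V \<psi> y. \<lbrakk>(U, \<phi>) \<in> atlas F; (V, \<psi>) \<in> atlas F; y \<in> U \<inter> V\<rbrakk> \<Longrightarrow>
      \<exists>W. openin Y W \<and> y \<in> W \<and> W \<subseteq> U \<inter> V \<and> (\<exists>g\<in>G d. \<forall>e\<in>over F W. \<psi> e = g (\<phi> e))"
    using lc_vector_bundle_atlasE[OF F] by blast
  show ?thesis
  proof (rule lc_vector_bundleI[where d = d])
    show "vector_bundle Z ?P" by (rule vector_bundle_pullback_bundle[OF VF f])
    show "(\<Union>(U, \<phi>)\<in>atlas ?P. U) = topspace Z"
    proof (intro equalityI subsetI)
      fix z assume "z \<in> (\<Union>(U, \<phi>)\<in>atlas ?P. U)"
      then show "z \<in> topspace Z" by (auto simp: pullback_bundle_simps)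
    next
      fix z assume z: "z \<in> topspace Z"
      then have "f z \<in> topspace Y" using f by (auto simp: continuous_map_def)
      then obtain U \<phi> where "(U, \<phi>) \<in> atlas F" "f z \<in> U" by (rule lc_vector_bundle_chartE[OF F])
      then show "z \<in> (\<Union>(U, \<phi>)\<in>atlas ?P. U)" using z by (force simp: pullback_bundle_simps)
    qed
  next
    fix V \<psi> assume "(V, \<psi>) \<in> atlas ?P"
    then show "local_trivialization Z ?P d V \<psi>"
      using local_trivialization_pullback_bundle[OF VF f triv] by (elim atlas_pullback_bundleE) simp
  next
    fix U' \<phi>' V' \<psi>' z assume U': "(U', \<phi>') \<in> atlas ?P" and V': "(V', \<psi>') \<in> atlas ?P" and z: "z \<in> U' \<inter> V'"
    obtain U \<phi> where U: "(U, \<phi>) \<in> atlas F" "U' = {z \<in> topspace Z. f z \<in> U}" "\<phi>' = \<phi> \<circ> snd"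
      using U' by (rule atlas_pullback_bundleE)
    obtain V \<psi> where V: "(V, \<psi>) \<in> atlas F" "V' = {z \<in> topspace Z. f z \<in> V}" "\<psi>' = \<psi> \<circ> snd"
      using V' by (rule atlas_pullback_bundleE)
    have "f z \<in> U \<inter> V" using z U(2) V(2) by simp
    then obtain W g where W: "openin Y W" "f z \<in> W" "W \<subseteq> U \<inter> V" and g: "g \<in> G d" "\<forall>e\<in>over F W. \<psi> e = g (\<phi> e)"
      using trans[OF U(1) V(1)] by blast
    let ?W = "{z \<in> topspace Z. f z \<in> W}"
    have "openin Z ?W" by (rule openin_continuous_map_preimage[OF f W(1)])
    moreover have "\<forall>p\<in>over ?P ?W. \<psi>' p = g (\<phi>' p)"
      using g(2) unfolding over_pullback_bundle U(3) V(3) by auto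
    ultimately show "\<exists>W. openin Z W \<and> z \<in> W \<and> W \<subseteq> U' \<inter> V' \<and> (\<exists>g\<in>G d. \<forall>e\<in>over ?P W. \<psi>' e = g (\<phi>' e))"
      using W(2,3) g(1) z U(2) V(2) by (intro exI[of _ ?W]) auto
  qed
qed

text \<open>The arrow part of the pullback for an arbitrary base map;
  \<open>pullback_functor\<close> is the case of the projection of a net.\<close>

definition pullback_map :: "'c topology \<Rightarrow> ('c \<Rightarrow> 'b) \<Rightarrow> ('b, 'e) lc_vbundle \<Rightarrow> ('e \<Rightarrow> 'f) \<Rightarrow> 'c \<times> 'e \<Rightarrow> 'c \<times> 'f" where
  "pullback_map Z f F t = restrict (\<lambda>(z, e). (z, t e)) (total (pullback_bundle Z f F))"

text \<open>In pulled back charts the morphism is given by the same linear map \<open>s\<close>,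
  over the preimage of the neighbourhood on which it was constant.\<close>

lemma lc_morphism_pullback_map:
  assumes F: "lc_vector_bundle G Y F" and F': "lc_vector_bundle G Y F'" and f: "continuous_map Z Y f"
    and t: "lc_morphism Y F F' t"
  shows "lc_morphism Z (pullback_bundle Z f F) (pullback_bundle Z f F') (pullback_map Z f F t)"
proof -
  let ?P = "pullback_bundle Z f F" and ?P' = "pullback_bundle Z f F'"
  let ?t = "pullback_map Z f F t"
  note VF = lc_vector_bundleD(1)[OF F] and VF' = lc_vector_bundleD(1)[OF F']
  note LP = lc_vector_bundle_pullback_bundle[OF F f] and LP' = lc_vector_bundle_pullback_bundle[OF F' f]
  have tl: "fibrewise_linear F F' t" using t by (simp add: lc_morphism_def bundle_morphism_def)
  show ?thesis
  proof (rule lc_morphismI[OF lc_vector_bundleD(1)[OF LP] lc_vector_bundleD(1)[OF LP']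
        lc_vector_bundleD(2)[OF LP] lc_vector_bundleD(2)[OF LP']])
    show "fibrewise_linear ?P ?P' ?t"
      unfolding fibrewise_linear_def
    proof (intro conjI ballI)
      show "?t \<in> extensional (total ?P)" by (simp add: pullback_map_def)
      show "?t \<in> total ?P \<rightarrow> total ?P'"
        using fibrewise_linearD(2,3)[OF tl] by (auto simp: pullback_map_def pullback_bundle_simps)
      fix z assume zP: "z \<in> prj ?P ` total ?P"
      then obtain e0 where z: "z \<in> topspace Z" and e0: "e0 \<in> fibre F (f z)"
        by (auto simp: pullback_bundle_simps fibre_def)
      have lin: "linear_map (fibre_module F (f z)) (fibre_module F' (f z)) t"
        by (rule fibrewise_linearD(6)[OF tl e0])
      have M: "module complex_ring (fibre_module ?P z)"
        by (rule vector_bundleD(3)[OF lc_vector_bundleD(1)[OF LP] z])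
      have "linear_map (fibre_module ?P z) (fibre_module ?P' z) (\<lambda>(z, e). (z, t e))"
        using linear_mapD[OF lin] unfolding linear_map_def
        by (auto simp: fibre_pullback_bundle[OF z] pullback_bundle_simps)
      then show "linear_map (fibre_module ?P z) (fibre_module ?P' z) ?t"
        by (rule linear_map_cong[OF M]) (simp add: pullback_map_def fibre_def)
    qed
    fix U' \<phi>' V' \<psi>' z assume U': "(U', \<phi>') \<in> atlas ?P" and V': "(V', \<psi>') \<in> atlas ?P'" and z: "z \<in> U' \<inter> V'"
    obtain U \<phi> where U: "(U, \<phi>) \<in> atlas F" "U' = {z \<in> topspace Z. f z \<in> U}" "\<phi>' = \<phi> \<circ> snd"
      using U' by (rule atlas_pullback_bundleE)
    obtain V \<psi> where V: "(V, \<psi>) \<in> atlas F'" "V' = {z \<in> topspace Z. f z \<in> V}" "\<psi>' = \<psi> \<circ> snd"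
      using V' by (rule atlas_pullback_bundleE)
    have "f z \<in> U" "f z \<in> V" using z U(2) V(2) by simp_all
    then obtain W d d' s where W: "openin Y W" "f z \<in> W" "W \<subseteq> U \<inter> V"
      and triv: "local_trivialization Y F d U \<phi>" "local_trivialization Y F' d' V \<psi>"
      and s: "linear_map (Cn_module d) (Cn_module d') s" "\<And>e. e\<in>over F W \<Longrightarrow> \<psi> (t e) = s (\<phi> e)"
      using lc_morphismE[OF t U(1) V(1)] by metis
    let ?W = "{z \<in> topspace Z. f z \<in> W}"
    have oW: "openin Z ?W" by (rule openin_continuous_map_preimage[OF f W(1)])
    have sub: "z \<in> ?W" "?W \<subseteq> U' \<inter> V'" using z W(2,3) U(2) V(2) by auto
    have eq: "\<forall>p\<in>over ?P ?W. \<psi>' (?t p) = s (\<phi>' p)"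
    proof
      fix p assume p: "p \<in> over ?P ?W"
      then have "p \<in> total ?P" "snd p \<in> over F W" by (auto simp: over_def pullback_bundle_simps)
      then show "\<psi>' (?t p) = s (\<phi>' p)"
        using s(2) unfolding U(3) V(3) pullback_map_def by (simp add: case_prod_beta)
    qed
    show "\<exists>W d d' s. openin Z W \<and> z \<in> W \<and> W \<subseteq> U' \<inter> V' \<and>
          local_trivialization Z ?P d U' \<phi>' \<and> local_trivialization Z ?P' d' V' \<psi>' \<and>
          linear_map (Cn_module d) (Cn_module d') s \<and> (\<forall>e\<in>over ?P W. \<psi>' (?t e) = s (\<phi>' e))"
      using oW sub eq s(1) local_trivialization_pullback_bundle[OF VF f triv(1)]
        local_trivialization_pullback_bundle[OF VF' f triv(2)] U(2,3) V(2,3)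
      by (intro exI[of _ ?W] exI[of _ d] exI[of _ d'] exI[of _ s] conjI) simp_all
  qed
qed

text \<open>This is \<open>tau_star_lc\<close> followed by pullback along the projection, whose
  continuity for \<open>tau X\<close> lets locally constant bundles and morphisms be pulled
  back.\<close>

lemma is_functor_pullback_functor:
  assumes conn: "pathwise_connected (UNIV :: 'k::order set)"
    and X: "net_bundle_of_spaces (X :: ('k, 'x) net_space)"
  shows "is_functor (V_net :: (('k, 'e) hilbert_net, 'e \<Rightarrow> 'e) category) (V_lc GL (tau X)) (pullback_functor X)"
  unfolding is_functor_def
proof (intro conjI ballI is_category_V_net is_category_V_lc)
  note p = continuous_map_proj_map[OF X]
  have lc: "lc_vector_bundle GL alexandroff (tau_lc_bundle E)" if "E \<in> Ob V_net" for E :: "('k, 'e) hilbert_net"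
    using lc_vector_bundle_Unitary_GL lc_vector_bundle_tau[OF conn that] by blast
  fix A :: "('k, 'e) hilbert_net" assume A: "A \<in> Ob V_net"
  show "on_Ob (pullback_functor X) A \<in> Ob (V_lc GL (tau X))"
    using lc_vector_bundle_pullback_bundle[OF lc[OF A] p] by (simp add: pullback_functor_def V_lc_def)
  show "on_Hom (pullback_functor X) A A (ident V_net A) = ident (V_lc GL (tau X)) (on_Ob (pullback_functor X) A)"
    unfolding pullback_functor_def V_lc_def V_net_def category.simps cat_functor.simps
    by (rule restrict_ext) (auto simp: pullback_bundle_simps)
  fix B :: "('k, 'e) hilbert_net" and f assume B: "B \<in> Ob V_net" and f: "f \<in> Hom V_net A B"
  have f': "net_morphism A B f" using f by (simp add: V_net_def)
  then have fl: "fibrewise_linear A B f" by (simp add: net_morphism_def)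
  show "on_Hom (pullback_functor X) A B f \<in>
      Hom (V_lc GL (tau X)) (on_Ob (pullback_functor X) A) (on_Ob (pullback_functor X) B)"
    using lc_morphism_pullback_map[OF lc[OF A] lc[OF B] p lc_morphism_tau[OF A B f']]
    by (simp add: pullback_functor_def V_lc_def pullback_map_def)
  fix E :: "('k, 'e) hilbert_net" and g
  show "on_Hom (pullback_functor X) A E (comp V_net A B E g f) =
      comp (V_lc GL (tau X)) (on_Ob (pullback_functor X) A) (on_Ob (pullback_functor X) B)
        (on_Ob (pullback_functor X) E) (on_Hom (pullback_functor X) B E g) (on_Hom (pullback_functor X) A B f)"
    unfolding pullback_functor_def V_lc_def V_net_def category.simps cat_functor.simps compose_def
    by (rule restrict_ext) (use fibrewise_linearD(2,3)[OF fl] in \<open>auto simp: pullback_bundle_simps\<close>)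
qed simp

theorem theorem5p15:
  assumes "pathwise_connected (UNIV :: 'k::order set)"
  shows
    "(\<forall>E \<in> Ob (V_net :: (('k, 'e) hilbert_net, 'e \<Rightarrow> 'e) category).
        continuous_map (tau (net_space_of E)) alexandroff (prj E) \<and>
        lc_vector_bundle GL alexandroff (tau_lc_bundle E)) \<and>
     is_functor (V_net :: (('k, 'e) hilbert_net, 'e \<Rightarrow> 'e) category) (V_top alexandroff) tau_star \<and>
     is_functor (V_net :: (('k, 'e) hilbert_net, 'e \<Rightarrow> 'e) category) (V_lc GL alexandroff) tau_star_lc \<and>
     is_equivalence (V_net :: (('k, 'e) hilbert_net, 'e \<Rightarrow> 'e) category) (V_lc Unitary alexandroff) tau_star_lc \<and>
     (\<forall>X :: ('k, 'x) net_space. net_bundle_of_spaces X \<longrightarrow>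
        is_functor (V_net :: (('k, 'e) hilbert_net, 'e \<Rightarrow> 'e) category) (V_lc GL (tau X)) (pullback_functor X))"
proof (intro conjI ballI allI impI)
  fix E :: "('k, 'e) hilbert_net" assume E: "E \<in> Ob V_net"
  show "continuous_map (tau (net_space_of E)) alexandroff (prj E)"
    using continuous_map_proj_map[OF net_bundle_net_space_of[OF E]] by simp
  show "lc_vector_bundle GL alexandroff (tau_lc_bundle E)"
    by (rule lc_vector_bundle_Unitary_GL[OF lc_vector_bundle_tau[OF assms E]])
next
  show "is_functor (V_net :: (('k, 'e) hilbert_net, 'e \<Rightarrow> 'e) category) (V_top alexandroff) tau_star"
    by (rule is_functor_tau_star)
  show "is_functor (V_net :: (('k, 'e) hilbert_net, 'e \<Rightarrow> 'e) category) (V_lc GL alexandroff) tau_star_lc"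
    by (rule is_functor_tau_star_lc[OF assms]) simp
  show "is_equivalence (V_net :: (('k, 'e) hilbert_net, 'e \<Rightarrow> 'e) category) (V_lc Unitary alexandroff) tau_star_lc"
    by (rule is_equivalence_tau_star_lc[OF assms])
next
  fix X :: "('k, 'x) net_space" assume "net_bundle_of_spaces X"
  then show "is_functor (V_net :: (('k, 'e) hilbert_net, 'e \<Rightarrow> 'e) category) (V_lc GL (tau X)) (pullback_functor X)"
    by (rule is_functor_pullback_functor[OF assms])
qed

end
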